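(* Let $u$ be a weak supersolution of $A_{\mu,p}u=0$ in $\Omega$ such that $u\ge0$ in $B_R(x_0)\subset\Omega$. Suppose that $\zeta\ge0$ and there exists $\sigma\in(0,1]$ such that $$|\{u\ge\zeta\}\cap B_r(x_0)|\ge\sigma|B_r(x_0)|$$ for some $r\in(0,1]$ with $0<16r<R$. Then there exists a constant $C=C(N,p,\mu,\Sigma)>0$ such that $$\left|B_{6r}(x_0)\cap\left\{u\le2\delta\zeta-\frac12\sup_{s\in\Sigma}\left(\frac rR\right)^{\frac{sp}{p-1}}\operatorname{Tail}(u_-;x_0,R)-\epsilon\right\}\right|\le\frac{C|B_{6r}(x_0)|}{\sigma\log\frac1{2\delta}}$$ for any $\delta\in(0,\frac14)$ and $\epsilon>0$.
   Context: Setting: $p\in(1,\infty)$, $\Omega\subset\mathbb{R}^N$ is a bounded domain, and $\mu$ is a nonnegative finite Borel measure on $[0,1]$, nontrivial on $(0,1)$, with $\mu(\{0\})=0$ and $\alpha:=\mu(\{1\})>0$; $\Sigma:=\operatorname{supp}\mu$. The operator is $A_{\mu,p}u=\int_{(0,1)}(-\Delta)_p^su\,d\mu(s)-\alpha\Delta_pu$. The normalizing constant (written $C_{N,s,p}$ or $C_{N,p,s}$) is $$C_{N,s,p}=\frac{\frac{sp}{2}(1-s)2^{2s-1}}{\pi^{\frac{N-1}{2}}}\,\frac{\Gamma(\frac{N+ps}{2})}{\Gamma(\frac{p+1}{2})\Gamma(2-s)}.$$ $B_r(x_0)$ is the open ball of center $x_0$ and radius $r>0$; $u_-=\max\{-u,0\}$;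 $|E|$ is the Lebesgue measure of $E$. Tail: for $u\in L^{p-1}_{loc}(\mathbb{R}^N)$, $$\operatorname{Tail}(u;x_0,r)=\left[\int_{(0,1)}C_{N,s,p}\,r^{sp}\left(\int_{\mathbb{R}^N\setminus B_r(x_0)}\frac{|u(y)|^{p-1}}{|y-x_0|^{N+sp}}\,dy\right)d\mu(s)\right]^{\frac1{p-1}},$$ and $L^{p-1}_{sp,\mu}(\mathbb{R}^N)$ is the set of $u\in L^{p-1}_{loc}(\mathbb{R}^N)$ with $\operatorname{Tail}(u;x,r)<\infty$ for all $x\in\mathbb{R}^N$, $r\in(0,\infty)$. Weak solutions: $W_0^{1,p}(\Omega')$ is the standard Sobolev space, its elements being taken equal to $0$ in $\mathbb{R}^N\setminus\Omega'$. A function $u\in W^{1,p}_{loc}(\Omega)\cap L^{p-1}_{sp,\mu}(\mathbb{R}^N)$ is a weak supersolution of $A_{\mu,p}u=0$ in $\Omega$ if for every $\Omega'\Subset\Omega$ and every nonnegative $v\in W_0^{1,p}(\Omega')$, $$\int_{(0,1)}C_{N,s,p}\left(\iint_{\mathbb{R}^{2N}}\frac{|u(x)-u(y)|^{p-2}(u(x)-u(y))(v(x)-v(y))}{|x-y|^{N+sp}}\,dx\,dy\right)d\mu(s)+\alpha\int_\Omega|\nabla u|^{p-2}\nabla u\cdot\nabla v\,dx\ge0.$$ *)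

theory Defs
  imports "HOL-Analysis.Analysis"
begin

text \<open>
  \<open>\<real>\<^sup>N\<close> is a type of class \<open>euclidean_space\<close>, with \<open>N = DIM('a)\<close>. Elements of Lebesgue and
  Sobolev spaces are Lebesgue measurable functions, i.e. representatives; statements about them
  are made almost everywhere.
\<close>

section \<open>Lebesgue and Sobolev spaces\<close>

definition Lp :: "real \<Rightarrow> 'a::euclidean_space set \<Rightarrow> ('a \<Rightarrow> 'b::euclidean_space) \<Rightarrow> bool" where
  "Lp q S f \<longleftrightarrow> set_borel_measurable lebesgue S f \<and>
     set_integrable lebesgue S (\<lambda>x. norm (f x) powr q)"

definition Lp_loc :: "real \<Rightarrow> 'a::euclidean_space set \<Rightarrow> ('a \<Rightarrow> 'b::euclidean_space) \<Rightarrow> bool" where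
  "Lp_loc q S f \<longleftrightarrow> set_borel_measurable lebesgue S f \<and>
     (\<forall>K. compact K \<and> K \<subseteq> S \<longrightarrow> set_integrable lebesgue K (\<lambda>x. norm (f x) powr q))"

text \<open>A function is \<open>C\<^sup>k\<^sup>+\<^sup>1\<close> iff it is differentiable and its first partial derivatives are \<open>C\<^sup>k\<close>.\<close>

primrec Ck :: "nat \<Rightarrow> ('a::euclidean_space \<Rightarrow> real) \<Rightarrow> bool" where
  "Ck 0 f \<longleftrightarrow> continuous_on UNIV f"
| "Ck (Suc k) f \<longleftrightarrow> (\<forall>x. f differentiable (at x)) \<and>
     (\<forall>i\<in>Basis. Ck k (\<lambda>x. frechet_derivative f (at x) i))"

definition Cc_infinity :: "'a::euclidean_space set \<Rightarrow> ('a \<Rightarrow> real) set" where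
  "Cc_infinity S = {\<phi>. (\<forall>k. Ck k \<phi>) \<and> (\<exists>K. compact K \<and> K \<subseteq> S \<and> (\<forall>x. x \<notin> K \<longrightarrow> \<phi> x = 0))}"

definition is_weak_gradient ::
    "'a::euclidean_space set \<Rightarrow> ('a \<Rightarrow> real) \<Rightarrow> ('a \<Rightarrow> 'a) \<Rightarrow> bool" where
  "is_weak_gradient S u g \<longleftrightarrow> Lp_loc 1 S u \<and> Lp_loc 1 S g \<and>
     (\<forall>\<phi>\<in>Cc_infinity S. \<forall>i\<in>Basis.
        (LINT x:S|lebesgue. u x * frechet_derivative \<phi> (at x) i) =
        - (LINT x:S|lebesgue. (g x \<bullet> i) * \<phi> x))"

text \<open>The weak gradient on an open set is unique up to null sets; this picks a representative.\<close>

definition weak_gradient :: "'a::euclidean_space set \<Rightarrow> ('a \<Rightarrow> real) \<Rightarrow> 'a \<Rightarrow> 'a" where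
  "weak_gradient S u = (SOME g. is_weak_gradient S u g)"

definition W1p :: "real \<Rightarrow> 'a::euclidean_space set \<Rightarrow> ('a \<Rightarrow> real) set" where
  "W1p p S = {u. Lp p S u \<and> (\<exists>g. is_weak_gradient S u g \<and> Lp p S g)}"

definition W1p_loc :: "real \<Rightarrow> 'a::euclidean_space set \<Rightarrow> ('a \<Rightarrow> real) set" where
  "W1p_loc p S = {u. Lp_loc p S u \<and> (\<exists>g. is_weak_gradient S u g \<and> Lp_loc p S g)}"

definition W1p_norm :: "real \<Rightarrow> 'a::euclidean_space set \<Rightarrow> ('a \<Rightarrow> real) \<Rightarrow> real" where
  "W1p_norm p S u =
     ((LINT x:S|lebesgue. \<bar>u x\<bar> powr p) +
      (LINT x:S|lebesgue. norm (weak_gradient S u x) powr p)) powr (1 / p)"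

text \<open>
  The closure of \<open>Cc_infinity S\<close> in \<open>W1p p S\<close>; its elements are functions on the whole space that
  vanish outside \<open>S\<close>.
\<close>

definition W1p_zero :: "real \<Rightarrow> 'a::euclidean_space set \<Rightarrow> ('a \<Rightarrow> real) set" where
  "W1p_zero p S = {v \<in> W1p p S. (\<forall>x. x \<notin> S \<longrightarrow> v x = 0) \<and>
     (\<forall>e>0. \<exists>\<phi>\<in>Cc_infinity S. W1p_norm p S (\<lambda>x. v x - \<phi> x) < e)}"


section \<open>The nonlocal tail\<close>

definition frac_const :: "nat \<Rightarrow> real \<Rightarrow> real \<Rightarrow> real" where
  "frac_const N s p =
     ((s * p / 2) * (1 - s) * 2 powr (2 * s - 1)) / pi powr ((real N - 1) / 2) *
     (Gamma ((real N + p * s) / 2) / (Gamma ((p + 1) / 2) * Gamma (2 - s)))"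

text \<open>The expression in square brackets in the definition of the tail, possibly infinite.\<close>

definition tail_integral ::
    "real measure \<Rightarrow> real \<Rightarrow> ('a::euclidean_space \<Rightarrow> real) \<Rightarrow> 'a \<Rightarrow> real \<Rightarrow> ennreal" where
  "tail_integral \<mu> p u x0 r =
     (\<integral>\<^sup>+s\<in>{0<..<1}. ennreal (frac_const DIM('a) s p * r powr (s * p)) *
        (\<integral>\<^sup>+y\<in>- ball x0 r. ennreal (\<bar>u y\<bar> powr (p - 1) /
            norm (y - x0) powr (real DIM('a) + s * p)) \<partial>lebesgue) \<partial>\<mu>)"

definition Tail ::
    "real measure \<Rightarrow> real \<Rightarrow> ('a::euclidean_space \<Rightarrow> real) \<Rightarrow> 'a \<Rightarrow> real \<Rightarrow> ennreal" where
  "Tail \<mu> p u x0 r =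
     (if tail_integral \<mu> p u x0 r = \<infinity> then \<infinity>
      else ennreal (enn2real (tail_integral \<mu> p u x0 r) powr (1 / (p - 1))))"

definition tail_space :: "real measure \<Rightarrow> real \<Rightarrow> ('a::euclidean_space \<Rightarrow> real) set" where
  "tail_space \<mu> p = {u. Lp_loc (p - 1) UNIV u \<and> (\<forall>x r. 0 < r \<longrightarrow> Tail \<mu> p u x r < \<infinity>)}"


section \<open>Weak supersolutions\<close>

definition nonlocal_form ::
    "real \<Rightarrow> real \<Rightarrow> ('a::euclidean_space \<Rightarrow> real) \<Rightarrow> ('a \<Rightarrow> real) \<Rightarrow> real" where
  "nonlocal_form p s u v =
     (LINT z|(lebesgue :: ('a \<times> 'a) measure).
        (case z of (x, y) \<Rightarrow>
           \<bar>u x - u y\<bar> powr (p - 2) * (u x - u y) * (v x - v y) /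
             norm (x - y) powr (real DIM('a) + s * p)))"

definition local_form ::
    "real \<Rightarrow> 'a::euclidean_space set \<Rightarrow> ('a \<Rightarrow> real) \<Rightarrow> ('a \<Rightarrow> real) \<Rightarrow> real" where
  "local_form p \<Omega> u v =
     (LINT x:\<Omega>|lebesgue.
        (norm (weak_gradient \<Omega> u x) powr (p - 2) *\<^sub>R weak_gradient \<Omega> u x) \<bullet> weak_gradient \<Omega> v x)"

text \<open>
  The local coefficient \<open>\<alpha>\<close> of the operator is \<open>\<mu>({1})\<close>. For \<open>u\<close> and \<open>v\<close> as below the double
  integral converges absolutely for \<open>\<mu>\<close>-almost every \<open>s \<in> (0,1)\<close>, and so do the other integrals;
  hence the convention that non-integrable functions have integral \<open>0\<close> plays no role.
\<close>

definition weak_supersolution ::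
    "real measure \<Rightarrow> real \<Rightarrow> 'a::euclidean_space set \<Rightarrow> ('a \<Rightarrow> real) \<Rightarrow> bool" where
  "weak_supersolution \<mu> p \<Omega> u \<longleftrightarrow>
     u \<in> W1p_loc p \<Omega> \<and> u \<in> tail_space \<mu> p \<and>
     (\<forall>\<Omega>' v. open \<Omega>' \<and> compact (closure \<Omega>') \<and> closure \<Omega>' \<subseteq> \<Omega> \<and>
        v \<in> W1p_zero p \<Omega>' \<and> (AE x in lebesgue. 0 \<le> v x) \<longrightarrow>
        0 \<le> (LINT s:{0<..<1}|\<mu>. frac_const DIM('a) s p * nonlocal_form p s u v)
             + measure \<mu> {1} * local_form p \<Omega> u v)"

text \<open>The support of a Borel measure on \<open>[0,1]\<close>.\<close>

definition measure_support :: "real measure \<Rightarrow> real set" where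
  "measure_support \<mu> = {s\<in>{0..1}. \<forall>U. open U \<and> s \<in> U \<longrightarrow> 0 < emeasure \<mu> (U \<inter> {0..1})}"

definition neg_part :: "('a \<Rightarrow> real) \<Rightarrow> 'a \<Rightarrow> real" where
  "neg_part u x = max (- u x) 0"

end

theory Submission
  imports Defs
begin

text \<open>
  The supersolution \<open>u\<close> is tested with \<open>v = \<eta>\<^sup>p (u + d)\<^sup>1\<^sup>-\<^sup>p\<close>, where \<open>\<eta>\<close> is a cutoff function supported in
  the ball of radius \<open>7 r\<close> and \<open>d\<close> is half the supremum of the tail terms plus \<open>\<epsilon>\<close>. In the local form
  this \<open>v\<close> produces \<open>- (p - 1) \<integral> \<eta>\<^sup>p |\<nabla> log (u + d)|\<^sup>p\<close>, up to a term that Young's inequality absorbs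
  into it at the price of a multiple of \<open>r\<^sup>-\<^sup>p\<close>. Since \<open>\<mu>({1}) > 0\<close>, the weak inequality bounds
  \<open>\<integral> |\<nabla> log (u + d)|\<^sup>p\<close> on the ball of radius \<open>6 r\<close> by \<open>C r\<^sup>N\<^sup>-\<^sup>p\<close> as soon as the nonlocal form
  is bounded above by such a quantity.

  The upper bound for the nonlocal form is pointwise in the pair \<open>(x, y)\<close>. If both points are close to the
  centre, then \<open>u \<ge> 0\<close> at both, and the discrete Picone inequality \<open>discrete_picone\<close> leaves only
  \<open>|\<eta> x - \<eta> y|\<^sup>p / |x - y|\<^sup>N\<^sup>+\<^sup>s\<^sup>p\<close>. If \<open>y\<close> is far away, then \<open>\<eta> y = 0\<close> and the integrand is at most a
  multiple of \<open>1 + (u\<^sub>-(y) / d)\<^sup>p\<^sup>-\<^sup>1\<close> times the kernel (\<open>tail_interaction_bound\<close>). The choice of \<open>d\<close> is such that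
  the part with \<open>u\<^sub>-\<close> integrates to at most a constant times \<open>r\<^sup>N\<^sup>-\<^sup>p\<close> (\<open>tail_bounded_by_shift\<close>), and the factor \<open>s (1 - s)\<close>
  in the normalizing constant makes the kernel integrals bounded uniformly in \<open>s\<close>. Together these
  give \<open>nonlocal_energy_bound\<close> and then \<open>log_gradient_estimate\<close>.

  The conclusion is a Poincare argument. If \<open>x\<close> lies in the set where \<open>u + d \<le> 2 \<delta> \<zeta>\<close> and \<open>y\<close> in the set
  where \<open>u \<ge> \<zeta>\<close>, then \<open>log (u + d)\<close> differs by at least \<open>log (1 / (2 \<delta>))\<close> between \<open>x\<close> and \<open>y\<close>. Hence
  the product of the measures of the two sets, multiplied by this logarithm, is at most the double integral of
  \<open>|log (u x + d) - log (u y + d)|\<close> over pairs, which \<open>poincare_limit\<close> bounds by the \<open>L\<^sup>1\<close> norm of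
  the logarithmic gradient.

  The Sobolev theory behind this is developed through mollification: the weak gradient is unique almost
  everywhere (\<open>weak_gradient_unique\<close>), so that the choice made in its definition is immaterial; a function with
  a weak gradient is locally a limit of continuously differentiable functions (\<open>weak_gradient_C1_approx\<close>), which
  yields the chain rule \<open>chain_rule_limit\<close> and the Poincare inequality; and \<open>v\<close> is approximated in \<open>W\<^sup>1\<^sup>,\<^sup>p\<close> by
  its own mollifications (\<open>W1p_zeroI\<close>), hence is admissible.
\<close>

section \<open>Smooth bump functions\<close>

text \<open>
  These functions extend \<open>exp (- 1 / t) / t\<^sup>k\<close> by \<open>0\<close> to \<open>t \<le> 0\<close>. The power of \<open>t\<close> is kept as a parameter
  because differentiation only shifts it.
\<close>

definition bump_profile :: "nat \<Rightarrow> real \<Rightarrow> real" where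
  "bump_profile k t = (if 0 < t then exp (- (1 / t)) / t ^ k else 0)"

text \<open>
  In the variable \<open>s = 1 / t\<close> this is the decay of \<open>s\<^sup>k exp (- s)\<close> at infinity.
\<close>

lemma bump_profile_tendsto_0: "(bump_profile k \<longlongrightarrow> 0) (at 0)"
proof -
  have "((\<lambda>s. bump_profile k (inverse s)) \<longlongrightarrow> 0) at_top"
  proof (rule Lim_transform_eventually)
    show "((\<lambda>s::real. s ^ k / exp s) \<longlongrightarrow> 0) at_top"
      by (rule tendsto_power_div_exp_0)
    show "\<forall>\<^sub>F s in at_top. s ^ k / exp s = bump_profile k (inverse s)"
      using eventually_gt_at_top[of "0::real"]
      by eventually_elim (simp add: bump_profile_def exp_minus field_simps)
  qed
  then have "(bump_profile k \<longlongrightarrow> 0) (at_right 0)"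
    by (simp add: filterlim_at_right_to_top)
  moreover have "(bump_profile k \<longlongrightarrow> 0) (at_left 0)"
    by (rule tendsto_eventually) (auto simp: eventually_at_filter bump_profile_def)
  ultimately show ?thesis
    by (simp add: filterlim_at_split)
qed

lemma bump_profile_deriv:
  "(bump_profile k has_real_derivative
     (bump_profile (k + 2) t - real k * bump_profile (k + 1) t)) (at t)"
proof -
  consider "t < 0" | "t = 0" | "0 < t" by linarith
  then show ?thesis
  proof cases
    case 1
    have "((\<lambda>_. 0) has_real_derivative 0) (at t)" by simp
    then have "(bump_profile k has_real_derivative 0) (at t)"
      by (rule DERIV_cong_ev[THEN iffD1, rotated 3])
         (use 1 eventually_nhds_in_open[of "{..<0}" t] in
           \<open>auto simp: bump_profile_def elim!: eventually_mono\<close>)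
    with 1 show ?thesis by (simp add: bump_profile_def)
  next
    case 2
    have eq: "(bump_profile k h - bump_profile k 0) / (h - 0) = bump_profile (Suc k) h" for h
      by (simp add: bump_profile_def field_simps)
    have "(bump_profile k has_real_derivative 0) (at 0)"
      unfolding has_field_derivative_iff eq by (rule bump_profile_tendsto_0)
    with 2 show ?thesis by (simp add: bump_profile_def)
  next
    case 3
    have "((\<lambda>t. exp (- (1 / t)) / t ^ k) has_real_derivative
        (exp (- (1 / t)) * (1 / t\<^sup>2) * t ^ k - exp (- (1 / t)) * (real k * t ^ (k - 1))) / (t ^ k * t ^ k)) (at t)"
      using 3 by (auto intro!: derivative_eq_intros simp: power2_eq_square)
    moreover have "(exp (- (1 / t)) * (1 / t\<^sup>2) * t ^ k - exp (- (1 / t)) * (real k * t ^ (k - 1))) / (t ^ k * t ^ k)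
        = exp (- (1 / t)) / t ^ (k + 2) - real k * (exp (- (1 / t)) / t ^ (k + 1))"
      using 3 by (cases k) (auto simp: field_simps power2_eq_square)
    ultimately have "((\<lambda>t. exp (- (1 / t)) / t ^ k) has_real_derivative
        (exp (- (1 / t)) / t ^ (k + 2) - real k * (exp (- (1 / t)) / t ^ (k + 1)))) (at t)"
      by simp
    then have "(bump_profile k has_real_derivative
        (exp (- (1 / t)) / t ^ (k + 2) - real k * (exp (- (1 / t)) / t ^ (k + 1)))) (at t)"
      by (rule DERIV_cong_ev[THEN iffD1, rotated 3])
         (use 3 eventually_nhds_in_open[of "{0<..}" t] in
           \<open>auto simp: bump_profile_def elim!: eventually_mono\<close>)
    with 3 show ?thesis by (simp add: bump_profile_def)
  qed
qed

text \<open>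
  A class of functions that contains the standard bump about every centre and is closed under directional
  derivatives; all its members are therefore smooth. Coordinates are allowed as factors because they appear
  when a profile is composed with \<open>1 - a |x - c|\<^sup>2\<close> and differentiated.
\<close>

inductive bump_class :: "('a::euclidean_space \<Rightarrow> real) \<Rightarrow> bool" where
  profile: "bump_class (\<lambda>x. bump_profile k (1 - a * ((x - c) \<bullet> (x - c))))"
| coord: "bump_class f \<Longrightarrow> bump_class (\<lambda>x. (x \<bullet> i) * f x)"
| scale: "bump_class f \<Longrightarrow> bump_class (\<lambda>x. b * f x)"
| add: "bump_class f \<Longrightarrow> bump_class g \<Longrightarrow> bump_class (\<lambda>x. f x + g x)"

text \<open>
  The derivative of \<open>1 - a |x - c|\<^sup>2\<close> in the direction \<open>h\<close> is \<open>- 2 a (x \<bullet> h) + 2 a (c \<bullet> h)\<close>: a multiple of a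
  coordinate plus a constant.
\<close>

lemma bump_class_derivative:
  "bump_class f \<Longrightarrow> \<exists>f'. (\<forall>x. (f has_derivative f' x) (at x)) \<and> (\<forall>h. bump_class (\<lambda>x. f' x h))"
proof (induction rule: bump_class.induct)
  case (profile k a c)
  let ?q = "\<lambda>x. 1 - a * ((x - c) \<bullet> (x - c))"
  let ?D = "\<lambda>x. bump_profile (k + 2) (?q x) + (- real k) * bump_profile (k + 1) (?q x)"
  let ?f' = "\<lambda>x h. (- 2 * a) * ((x \<bullet> h) * ?D x) + (2 * a * (c \<bullet> h)) * ?D x"
  have "((\<lambda>x. bump_profile k (?q x)) has_derivative ?f' x) (at x)" for x
  proof -
    have q: "(?q has_derivative (\<lambda>h. - 2 * a * ((x - c) \<bullet> h))) (at x)"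
      by (auto intro!: derivative_eq_intros simp: inner_commute algebra_simps)
    have "(bump_profile k has_derivative (\<lambda>y. y * ?D x)) (at (?q x))"
      using bump_profile_deriv[of k "?q x"] unfolding has_field_derivative_def
      by (rule has_derivative_eq_rhs) (simp add: fun_eq_iff mult.commute)
    from has_derivative_compose[OF q this] show ?thesis
      by (rule has_derivative_eq_rhs) (auto simp: algebra_simps)
  qed
  moreover have D: "bump_class ?D"
    by (intro bump_class.intros)
  have "bump_class (\<lambda>x. ?f' x h)" for h
    by (intro bump_class.add bump_class.scale bump_class.coord bump_class.profile)
  ultimately show ?case by (intro exI[of _ ?f']) blast
next
  case (coord f i)
  then obtain f' where f': "\<And>x. (f has_derivative f' x) (at x)" "\<And>h. bump_class (\<lambda>x. f' x h)"
    by blast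
  have "((\<lambda>x. (x \<bullet> i) * f x) has_derivative (\<lambda>h. (x \<bullet> i) * f' x h + (h \<bullet> i) * f x)) (at x)" for x
    by (auto intro!: derivative_eq_intros f'(1))
  moreover have "bump_class (\<lambda>x. (x \<bullet> i) * f' x h + (h \<bullet> i) * f x)" for h
    by (intro bump_class.add bump_class.scale bump_class.coord f' coord)
  ultimately show ?case by (intro exI[of _ "\<lambda>x h. (x \<bullet> i) * f' x h + (h \<bullet> i) * f x"]) blast
next
  case (scale f b)
  then obtain f' where f': "\<And>x. (f has_derivative f' x) (at x)" "\<And>h. bump_class (\<lambda>x. f' x h)"
    by blast
  have "((\<lambda>x. b * f x) has_derivative (\<lambda>h. b * f' x h)) (at x)" for x
    by (auto intro!: derivative_eq_intros f'(1))
  moreover have "bump_class (\<lambda>x. b * f' x h)" for h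
    by (intro bump_class.scale f')
  ultimately show ?case by (intro exI[of _ "\<lambda>x h. b * f' x h"]) blast
next
  case (add f g)
  then obtain f' g' where f': "\<And>x. (f has_derivative f' x) (at x)" "\<And>h. bump_class (\<lambda>x. f' x h)"
    and g': "\<And>x. (g has_derivative g' x) (at x)" "\<And>h. bump_class (\<lambda>x. g' x h)"
    by blast
  have "((\<lambda>x. f x + g x) has_derivative (\<lambda>h. f' x h + g' x h)) (at x)" for x
    by (auto intro!: derivative_eq_intros f'(1) g'(1))
  moreover have "bump_class (\<lambda>x. f' x h + g' x h)" for h
    by (intro bump_class.add f' g')
  ultimately show ?case by (intro exI[of _ "\<lambda>x h. f' x h + g' x h"]) blast
qed

lemma bump_class_Ck: "bump_class f \<Longrightarrow> Ck k f"
proof (induction k arbitrary: f)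
  case 0
  then obtain f' where "\<And>x. (f has_derivative f' x) (at x)"
    using bump_class_derivative by blast
  then have "continuous_on UNIV f"
    by (meson has_derivative_continuous continuous_at_imp_continuous_on)
  then show ?case by simp
next
  case (Suc k)
  then obtain f' where f': "\<And>x. (f has_derivative f' x) (at x)" "\<And>h. bump_class (\<lambda>x. f' x h)"
    using bump_class_derivative by blast
  have fd: "frechet_derivative f (at x) = f' x" for x
    using frechet_derivative_at[OF f'(1)] by simp
  show ?case
    using f' Suc.IH by (auto simp: fd differentiable_def)
qed

section \<open>Continuously differentiable functions\<close>

text \<open>
  The gradient is carried along as a vector field, so that sums over partial derivatives do not appear in the
  integrations by parts.
\<close>

definition C1_grad :: "('a::euclidean_space \<Rightarrow> real) \<Rightarrow> ('a \<Rightarrow> 'a) \<Rightarrow> bool" where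
  "C1_grad f Df \<longleftrightarrow>
     (\<forall>x. (f has_derivative (\<lambda>h. Df x \<bullet> h)) (at x)) \<and> continuous_on UNIV Df"

lemma C1_grad_continuous: "C1_grad f Df \<Longrightarrow> continuous_on UNIV f"
  unfolding C1_grad_def by (meson has_derivative_continuous continuous_at_imp_continuous_on)

lemma C1_grad_frechet_derivative:
  assumes "C1_grad f Df" shows "frechet_derivative f (at x) h = Df x \<bullet> h"
proof -
  have "(\<lambda>h. Df x \<bullet> h) = frechet_derivative f (at x)"
    by (rule frechet_derivative_at) (use assms in \<open>auto simp: C1_grad_def\<close>)
  from fun_cong[OF this, of h] show ?thesis by simp
qed

lemma Ck_imp_C1_grad:
  assumes "Ck (Suc 0) f"
  shows "C1_grad f (\<lambda>x. \<Sum>i\<in>Basis. frechet_derivative f (at x) i *\<^sub>R i)"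
proof -
  have d: "(f has_derivative frechet_derivative f (at x)) (at x)" for x
    using assms by (simp add: frechet_derivative_works)
  have "frechet_derivative f (at x) =
     (\<lambda>h. (\<Sum>i\<in>Basis. frechet_derivative f (at x) i *\<^sub>R i) \<bullet> h)" for x
  proof
    fix h
    interpret linear "frechet_derivative f (at x)"
      using d[of x] by (simp add: has_derivative_linear)
    have "frechet_derivative f (at x) h = frechet_derivative f (at x) (\<Sum>i\<in>Basis. (h \<bullet> i) *\<^sub>R i)"
      by (simp add: euclidean_representation)
    also have "\<dots> = (\<Sum>i\<in>Basis. (h \<bullet> i) * frechet_derivative f (at x) i)"
      by (simp add: sum scale)
    finally show "frechet_derivative f (at x) h =
      (\<Sum>i\<in>Basis. frechet_derivative f (at x) i *\<^sub>R i) \<bullet> h"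
      by (simp add: inner_sum_left inner_sum_right inner_commute mult.commute)
  qed
  then have "(f has_derivative
       (\<lambda>h. (\<Sum>i\<in>Basis. frechet_derivative f (at x) i *\<^sub>R i) \<bullet> h)) (at x)" for x
    by (rule has_derivative_eq_rhs[OF d])
  moreover have "continuous_on UNIV (\<lambda>x. \<Sum>i\<in>Basis. frechet_derivative f (at x) i *\<^sub>R i)"
    using assms by (intro continuous_intros) auto
  ultimately show ?thesis unfolding C1_grad_def by blast
qed

lemma Cc_infinity_C1_grad:
  assumes "\<phi> \<in> Cc_infinity S"
  obtains D K where "C1_grad \<phi> D" "compact K" "K \<subseteq> S" "\<And>x. x \<notin> K \<Longrightarrow> \<phi> x = 0"
proof -
  have "Ck (Suc 0) \<phi>" using assms unfolding Cc_infinity_def by blast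
  from Ck_imp_C1_grad[OF this] assms that show ?thesis
    unfolding Cc_infinity_def by blast
qed

lemma C1_grad_support:
  assumes "C1_grad f Df" "closed K" "\<And>x. x \<notin> K \<Longrightarrow> f x = 0" "x \<notin> K"
  shows "Df x = 0"
proof -
  have "(f has_derivative (\<lambda>h. Df x \<bullet> h)) (at x)"
    using assms by (auto simp: C1_grad_def)
  moreover have "(f has_derivative (\<lambda>h. 0)) (at x)"
    by (rule has_derivative_transform_within_open[of "\<lambda>_. 0" _ _ UNIV "- K"])
       (use assms in auto)
  ultimately have "(\<lambda>h. Df x \<bullet> h) = (\<lambda>h. 0)"
    by (rule has_derivative_unique)
  from fun_cong[OF this, of "Df x"] have "Df x \<bullet> Df x = 0" by simp
  then show ?thesis by simp
qed

lemma C1_grad_mult: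
  assumes "C1_grad f Df" "C1_grad g Dg"
  shows "C1_grad (\<lambda>x. f x * g x) (\<lambda>x. g x *\<^sub>R Df x + f x *\<^sub>R Dg x)"
  using assms C1_grad_continuous[OF assms(1)] C1_grad_continuous[OF assms(2)]
  unfolding C1_grad_def
  by (auto intro!: derivative_eq_intros continuous_intros simp: inner_left_distrib mult.commute)

lemma continuous_compact_support_uniform:
  fixes f :: "'a::euclidean_space \<Rightarrow> 'b::real_normed_vector"
  assumes f: "continuous_on UNIV f" and K: "compact K" "\<And>x. x \<notin> K \<Longrightarrow> f x = 0"
  shows "uniformly_continuous_on UNIV f"
proof -
  obtain R where R: "\<And>x. x \<in> K \<Longrightarrow> norm x \<le> R"
    using compact_imp_bounded[OF K(1)] by (auto simp: bounded_iff)
  have u: "uniformly_continuous_on (cball 0 (R + 1)) f"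
    by (rule compact_uniformly_continuous) (auto intro: continuous_on_subset[OF f])
  show ?thesis
    unfolding uniformly_continuous_on_def
  proof (intro allI impI)
    fix e :: real assume "0 < e"
    with u obtain d where d: "0 < d" "\<And>x x'. x \<in> cball 0 (R + 1) \<Longrightarrow> x' \<in> cball 0 (R + 1) \<Longrightarrow>
        dist x' x < d \<Longrightarrow> dist (f x') (f x) < e"
      unfolding uniformly_continuous_on_def by metis
    show "\<exists>d>0. \<forall>x\<in>UNIV. \<forall>x'\<in>UNIV. dist x' x < d \<longrightarrow> dist (f x') (f x) < e"
    proof (intro exI[of _ "min d 1"] conjI ballI impI)
      fix x x' :: 'a assume *: "dist x' x < min d 1"
      show "dist (f x') (f x) < e"
      proof (cases "x \<in> cball 0 (R + 1) \<and> x' \<in> cball 0 (R + 1)")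
        case True
        then show ?thesis using d(2) * by auto
      next
        case False
        have "norm x > R \<and> norm x' > R"
          using False * norm_triangle_ineq2[of x x'] norm_triangle_ineq2[of x' x]
          by (auto simp: dist_norm norm_minus_commute)
        then have "x \<notin> K" "x' \<notin> K" using R by (auto simp: not_le[symmetric])
        then show ?thesis using K(2) \<open>0 < e\<close> by simp
      qed
    qed (use d in auto)
  qed
qed

text \<open>
  The gradient is uniformly continuous, so the remainder of the first order expansion is small uniformly in
  the base point. Both differentiation under an integral and integration by parts rest on this.
\<close>

lemma C1_grad_uniform:
  assumes f: "C1_grad f Df" and K: "compact K" "\<And>x. x \<notin> K \<Longrightarrow> f x = 0" and "0 < e"
  obtains d where "0 < d" "\<And>x h. norm h < d \<Longrightarrow> \<bar>f (x + h) - f x - Df x \<bullet> h\<bar> \<le> e * norm h"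
proof -
  have "uniformly_continuous_on UNIV Df"
    by (rule continuous_compact_support_uniform[OF _ K(1)])
       (use f C1_grad_support[OF f compact_imp_closed[OF K(1)] K(2)] in \<open>auto simp: C1_grad_def\<close>)
  then obtain d where d: "0 < d" "\<And>x x'. dist x' x < d \<Longrightarrow> dist (Df x') (Df x) < e"
    using \<open>0 < e\<close> unfolding uniformly_continuous_on_def by (metis UNIV_I)
  show ?thesis
  proof
    fix x h :: 'a assume h: "norm h < d"
    have "norm ((f (x + h) - Df x \<bullet> (x + h)) - (f x - Df x \<bullet> x)) \<le> e * norm ((x + h) - x)"
    proof (rule differentiable_bound[of "ball x d" "\<lambda>y. f y - Df x \<bullet> y" "\<lambda>y h. Df y \<bullet> h - Df x \<bullet> h"])
      fix y assume y: "y \<in> ball x d"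
      show "((\<lambda>y. f y - Df x \<bullet> y) has_derivative (\<lambda>h. Df y \<bullet> h - Df x \<bullet> h)) (at y within ball x d)"
      proof (rule has_derivative_at_withinI)
        have "(f has_derivative (\<lambda>h. Df y \<bullet> h)) (at y)" using f by (simp add: C1_grad_def)
        then show "((\<lambda>y. f y - Df x \<bullet> y) has_derivative (\<lambda>h. Df y \<bullet> h - Df x \<bullet> h)) (at y)"
          by (intro has_derivative_diff has_derivative_inner_right has_derivative_ident)
      qed
      show "onorm (\<lambda>h. Df y \<bullet> h - Df x \<bullet> h) \<le> e"
      proof (rule onorm_le)
        fix h
        have "norm (Df y \<bullet> h - Df x \<bullet> h) \<le> norm (Df y - Df x) * norm h"
          by (metis inner_diff_left Cauchy_Schwarz_ineq2 real_norm_def)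
        also have "\<dots> \<le> e * norm h"
          using d(2)[of y x] y by (intro mult_right_mono) (auto simp: dist_norm norm_minus_commute less_imp_le)
        finally show "norm (Df y \<bullet> h - Df x \<bullet> h) \<le> e * norm h" .
      qed
    qed (use h d in \<open>auto simp: dist_norm\<close>)
    then show "\<bar>f (x + h) - f x - Df x \<bullet> h\<bar> \<le> e * norm h"
      by (simp add: inner_add_right algebra_simps)
  qed (rule d)
qed

lemma integral_translate_plus:
  fixes f :: "'a::euclidean_space \<Rightarrow> 'b::{banach, second_countable_topology}"
  assumes [measurable]: "f \<in> borel_measurable borel"
  shows "(LINT x|lborel. f (x + a)) = (LINT x|lborel. f x)"
proof -
  have "(LINT x|lborel. f x) = (LINT x|distr lborel borel ((+) a). f x)"
    by (simp only: lborel_distr_plus)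
  also have "\<dots> = (LINT x|lborel. f (a + x))"
    by (rule integral_distr) auto
  finally show ?thesis by (simp add: add.commute)
qed

lemma integrable_compact_support:
  fixes f :: "'a::euclidean_space \<Rightarrow> 'b::{banach, second_countable_topology}"
  assumes "continuous_on UNIV f" "compact K" "\<And>x. x \<notin> K \<Longrightarrow> f x = 0"
  shows "integrable lborel f"
proof -
  have "integrable lborel (\<lambda>x. indicator K x *\<^sub>R f x)"
    by (intro borel_integrable_compact continuous_on_subset[OF assms(1)] assms) auto
  also have "(\<lambda>x. indicator K x *\<^sub>R f x) = f"
    using assms(3) by (auto simp: indicator_def fun_eq_iff)
  finally show ?thesis .
qed

text \<open>
  The integral of \<open>f (x + t i) - f x\<close> vanishes by translation invariance. Divided by \<open>t\<close>, the integrand tends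
  to \<open>Df x \<bullet> i\<close> uniformly and inside a fixed ball.
\<close>

lemma integral_C1_grad_zero:
  assumes f: "C1_grad f Df" and K: "compact K" "\<And>x. x \<notin> K \<Longrightarrow> f x = 0"
  shows "(LINT x|lborel. Df x \<bullet> i) = 0"
proof (cases "i = 0")
  case False
  let ?K = "cball (0::'a)"
  obtain R where R: "\<And>x. x \<in> K \<Longrightarrow> norm x \<le> R"
    using compact_imp_bounded[OF K(1)] by (auto simp: bounded_iff)
  have f0: "f x = 0" if "norm x > R" for x using R[of x] K(2)[of x] that by auto
  have D0: "Df x = 0" if "norm x > R" for x
    using C1_grad_support[OF f compact_imp_closed[OF K(1)] K(2)] R[of x] that by auto
  have cf: "continuous_on UNIV f" by (rule C1_grad_continuous[OF f])
  have cD: "continuous_on UNIV Df" using f by (simp add: C1_grad_def)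
  have [measurable]: "f \<in> borel_measurable borel" "Df \<in> borel_measurable borel"
    using cf cD by (auto intro: borel_measurable_continuous_onI)
  have if1: "integrable lborel f" by (rule integrable_compact_support[OF cf K])
  have iD: "integrable lborel (\<lambda>x. Df x \<bullet> i)"
    by (rule integrable_compact_support[of _ "?K R"])
       (use cD D0 in \<open>auto intro!: continuous_intros\<close>)
  define V where "V = measure lborel (?K (R + 1))"
  have fin: "emeasure lborel (?K (R + 1)) < \<infinity>" by (simp add: emeasure_bounded_finite[simplified])
  have "\<bar>LINT x|lborel. Df x \<bullet> i\<bar> \<le> e" if "0 < e" for e
  proof -
    define e' where "e' = e / (norm i * V + 1)"
    have V0: "0 \<le> V" by (simp add: V_def)
    have "0 < norm i * V + 1" using V0 by (simp add: add_nonneg_pos)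
    have e': "0 < e'" unfolding e'_def using \<open>0 < e\<close> \<open>0 < norm i * V + 1\<close> by (rule divide_pos_pos)
    obtain d where d: "0 < d" "\<And>x h. norm h < d \<Longrightarrow> \<bar>f (x + h) - f x - Df x \<bullet> h\<bar> \<le> e' * norm h"
      using C1_grad_uniform[OF f K e'] by blast
    (* The step is so small that the expansion applies, and at most 1 in length, so that
       the shifted support stays in the ball of radius R + 1. *)
    define t where "t = min (d / 2) 1 / norm i"
    have t: "0 < t" "norm (t *\<^sub>R i) < d" "norm (t *\<^sub>R i) \<le> 1"
      using False d by (auto simp: t_def)
    have cs: "continuous_on UNIV (\<lambda>x. f (x + t *\<^sub>R i))"
      by (rule continuous_on_compose2[OF cf]) (auto intro!: continuous_intros)
    have f0sh: "f (x + t *\<^sub>R i) = 0" if "norm x > R + 1" for x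
    proof (rule f0)
      have "norm x - norm (t *\<^sub>R i) \<le> norm (x + t *\<^sub>R i)" by (rule norm_diff_ineq)
      then show "norm (x + t *\<^sub>R i) > R" using that t(3) by linarith
    qed
    have ish: "integrable lborel (\<lambda>x. f (x + t *\<^sub>R i))"
      by (rule integrable_compact_support[OF cs, of "?K (R + 1)"])
         (use f0sh in auto)
    have eq: "t * (LINT x|lborel. Df x \<bullet> i) = - (LINT x|lborel. f (x + t *\<^sub>R i) - f x - t * (Df x \<bullet> i))"
      using if1 iD ish by (simp add: integral_translate_plus)
    have "norm (LINT x|lborel. f (x + t *\<^sub>R i) - f x - t * (Df x \<bullet> i))
        \<le> (LINT x|lborel. e' * norm (t *\<^sub>R i) * indicator (?K (R + 1)) x)"
    proof (rule order_trans[OF integral_norm_bound], rule integral_mono)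
      show "norm (f (x + t *\<^sub>R i) - f x - t * (Df x \<bullet> i)) \<le> e' * norm (t *\<^sub>R i) * indicator (?K (R + 1)) x" for x
      proof (cases "norm x \<le> R + 1")
        case True
        then show ?thesis using d(2)[OF t(2), of x] by simp
      next
        case False
        then have "norm (x + t *\<^sub>R i) > R" "norm x > R"
          using norm_diff_ineq[of x "t *\<^sub>R i"] t(3) by linarith+
        then show ?thesis using f0 D0 less_imp_le[OF e'] by simp
      qed
    qed (use if1 iD ish fin in auto)
    also have "\<dots> = e' * norm (t *\<^sub>R i) * V" by (simp add: V_def)
    finally have "\<bar>t * (LINT x|lborel. Df x \<bullet> i)\<bar> \<le> t * (e' * (norm i * V))"
      unfolding eq using t(1) by (simp add: algebra_simps)
    then have "\<bar>LINT x|lborel. Df x \<bullet> i\<bar> \<le> e' * (norm i * V)"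
      using t(1) by (simp add: abs_mult)
    also have "\<dots> \<le> e' * (norm i * V + 1)"
      using e' by (intro mult_left_mono) auto
    also have "\<dots> = e" using \<open>0 < norm i * V + 1\<close> by (simp add: e'_def)
    finally show ?thesis .
  qed
  then have "\<bar>LINT x|lborel. Df x \<bullet> i\<bar> \<le> 0" by (rule dense_ge)
  then show ?thesis by simp
qed simp

section \<open>Mollifiers and convolution\<close>

text \<open>
  The normalizing constant of the mollifier of radius \<open>e\<close>. The centre \<open>0\<close> is written out so that the integrand
  is literally a member of \<open>bump_class\<close>.
\<close>

definition mollifier_mass :: "'a::euclidean_space itself \<Rightarrow> real \<Rightarrow> real" where
  "mollifier_mass _ e = (LINT z::'a|lborel. bump_profile 0 (1 - 1 / e\<^sup>2 * ((z - 0) \<bullet> (z - 0))))"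

definition mollifier :: "real \<Rightarrow> 'a::euclidean_space \<Rightarrow> real" where
  "mollifier e z = 1 / mollifier_mass TYPE('a) e * bump_profile 0 (1 - 1 / e\<^sup>2 * ((z - 0) \<bullet> (z - 0)))"

lemma bump_class_continuous: "bump_class f \<Longrightarrow> continuous_on UNIV f"
  using bump_class_Ck[of f 0] by simp

lemma bump_profile_support:
  fixes z :: "'a::euclidean_space"
  assumes "0 < e"
  shows "0 < bump_profile 0 (1 - 1 / e\<^sup>2 * ((z - 0) \<bullet> (z - 0))) \<longleftrightarrow> norm z < e"
    and "e \<le> norm z \<Longrightarrow> bump_profile 0 (1 - 1 / e\<^sup>2 * ((z - 0) \<bullet> (z - 0))) = 0"
proof -
  have "0 < 1 - 1 / e\<^sup>2 * ((z - 0) \<bullet> (z - 0)) \<longleftrightarrow> norm z < e"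
    using assms power_strict_mono[of "norm z" e 2] power_mono[of e "norm z" 2]
    by (cases "norm z < e") (auto simp: not_less power2_norm_eq_inner[symmetric] field_simps)
  then show "0 < bump_profile 0 (1 - 1 / e\<^sup>2 * ((z - 0) \<bullet> (z - 0))) \<longleftrightarrow> norm z < e"
    and "e \<le> norm z \<Longrightarrow> bump_profile 0 (1 - 1 / e\<^sup>2 * ((z - 0) \<bullet> (z - 0))) = 0"
    by (auto simp: bump_profile_def)
qed

lemma bump_profile_nonneg: "0 \<le> bump_profile k t"
  by (simp add: bump_profile_def)

lemma mollifier_mass_pos:
  assumes "0 < e" shows "0 < mollifier_mass TYPE('a::euclidean_space) e"
proof -
  let ?b = "\<lambda>z::'a. bump_profile 0 (1 - 1 / e\<^sup>2 * ((z - 0) \<bullet> (z - 0)))"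
  have c: "continuous_on UNIV ?b" by (rule bump_class_continuous[OF bump_class.profile])
  have i: "integrable lborel ?b"
  proof (rule integrable_compact_support[OF c, of "cball 0 e"])
    fix x :: 'a assume "x \<notin> cball 0 e"
    then have "e \<le> norm x" by simp
    then show "?b x = 0" by (rule bump_profile_support(2)[OF assms])
  qed simp
  have "mollifier_mass TYPE('a) e \<noteq> 0"
  proof
    assume "mollifier_mass TYPE('a) e = 0"
    then have "AE z in lborel. ?b z = 0"
      unfolding mollifier_mass_def using integral_nonneg_eq_0_iff_AE[OF i] bump_profile_nonneg by auto
    then have "AE z in lborel. z \<notin> ball (0::'a) e"
      by eventually_elim (use bump_profile_support(1)[OF assms] in force)
    then have "emeasure lborel (ball (0::'a) e) = 0"
      by (subst (asm) AE_iff_measurable[of "ball 0 e"]) auto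
    then show False using assms unit_ball_vol_pos[of "real DIM('a)"]
      by (simp add: emeasure_ball)
  qed
  moreover have "0 \<le> mollifier_mass TYPE('a) e"
    unfolding mollifier_mass_def by (intro integral_nonneg_AE) (simp add: bump_profile_nonneg)
  ultimately show ?thesis by simp
qed

lemma mollifier_bump_class: "bump_class (mollifier e)"
  unfolding mollifier_def[abs_def] by (intro bump_class.intros)

lemma mollifier_continuous: "continuous_on UNIV (mollifier e)"
  by (rule bump_class_continuous[OF mollifier_bump_class])

lemma mollifier_measurable[measurable]: "mollifier e \<in> borel_measurable borel"
  by (intro borel_measurable_continuous_onI mollifier_continuous)

lemma mollifier_nonneg: "0 < e \<Longrightarrow> 0 \<le> mollifier e z"
  unfolding mollifier_def
  using mollifier_mass_pos[where 'a='a, of e] by (simp add: bump_profile_nonneg)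

lemma mollifier_eq_zero: "0 < e \<Longrightarrow> e \<le> norm z \<Longrightarrow> mollifier e z = 0"
  unfolding mollifier_def by (subst bump_profile_support(2)) auto

lemma mollifier_support:
  "0 < e \<Longrightarrow> z \<notin> cball 0 e \<Longrightarrow> mollifier e z = 0"
  "0 < e \<Longrightarrow> y \<notin> cball x e \<Longrightarrow> mollifier e (x - y) = 0"
  by (rule mollifier_eq_zero; auto simp: dist_norm)+

lemma mollifier_integrable: "0 < e \<Longrightarrow> integrable lborel (mollifier e)"
  by (rule integrable_compact_support[OF mollifier_continuous, of "cball 0 e"])
     (auto simp: mollifier_eq_zero)

lemma mollifier_integral: "0 < e \<Longrightarrow> (LINT z::'a::euclidean_space|lborel. mollifier e z) = 1"
  using mollifier_mass_pos[where 'a='a, of e]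
  unfolding mollifier_def by (subst integral_mult_right_zero, subst mollifier_mass_def[symmetric]) simp

lemma mollifier_bounded:
  obtains B where "\<And>z::'a::euclidean_space. norm (mollifier e z) \<le> B"
proof
  fix z :: 'a
  show "norm (mollifier e z) \<le> \<bar>1 / mollifier_mass TYPE('a) e\<bar>"
    unfolding mollifier_def by (simp add: abs_mult bump_profile_def divide_le_cancel)
qed

lemma mollifier_Cc_infinity:
  assumes "0 < e" "cball x e \<subseteq> S"
  shows "(\<lambda>y. mollifier e (x - y)) \<in> Cc_infinity S"
proof -
  have eq: "(\<lambda>y. mollifier e (x - y)) = (\<lambda>y. 1 / mollifier_mass TYPE('a) e * bump_profile 0 (1 - 1 / e\<^sup>2 * ((y - x) \<bullet> (y - x))))"
    unfolding mollifier_def by (simp add: fun_eq_iff algebra_simps inner_commute)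
  have "Ck k (\<lambda>y. mollifier e (x - y))" for k
    unfolding eq by (intro bump_class_Ck bump_class.intros)
  then show ?thesis
    unfolding Cc_infinity_def using assms
    by (auto intro!: exI[of _ "cball x e"] mollifier_eq_zero simp: dist_norm)
qed

lemma mollifier_C1_grad: obtains D where "C1_grad (mollifier e) D"
  using Ck_imp_C1_grad[OF bump_class_Ck[OF mollifier_bump_class]] by blast

lemma C1_grad_reflect:
  assumes "C1_grad f D" shows "C1_grad (\<lambda>y. f (x - y)) (\<lambda>y. - D (x - y))"
proof -
  have "((\<lambda>y. f (x - y)) has_derivative (\<lambda>h. - D (x - y) \<bullet> h)) (at y)" for y
  proof -
    have "((\<lambda>y. x - y) has_derivative (\<lambda>h. - h)) (at y)"
      by (auto intro!: derivative_eq_intros)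
    moreover have "(f has_derivative (\<lambda>h. D (x - y) \<bullet> h)) (at (x - y))"
      using assms by (simp add: C1_grad_def)
    ultimately show ?thesis
      by (rule has_derivative_eq_rhs[OF has_derivative_compose]) simp
  qed
  moreover have "continuous_on UNIV (\<lambda>y. - D (x - y))"
    using assms unfolding C1_grad_def
    by (auto intro!: continuous_intros intro: continuous_on_compose2)
  ultimately show ?thesis by (simp add: C1_grad_def)
qed

lemma lborel_eq_reflect: "lborel = distr lborel borel (\<lambda>y. a - y :: 'a::euclidean_space)"
proof -
  have "lborel = density (distr lborel borel (\<lambda>x::'a. a + (-1) *\<^sub>R x)) (\<lambda>_. \<bar>-1::real\<bar>^DIM('a))"
    using lborel_affine[of "-1" a] by simp
  then show ?thesis by (simp add: density_1 flip: one_ennreal_def)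
qed

lemma integrable_reflect:
  fixes f :: "'a::euclidean_space \<Rightarrow> 'b::{banach, second_countable_topology}"
  assumes "integrable lborel f"
  shows "integrable lborel (\<lambda>y. f (a - y))"
proof -
  have [measurable]: "f \<in> borel_measurable borel" using assms by auto
  have "integrable (distr lborel borel (\<lambda>y. a - y)) f"
    using assms lborel_eq_reflect[of a] by simp
  then show ?thesis by (subst (asm) integrable_distr_eq) auto
qed

lemma integral_reflect:
  fixes f :: "'a::euclidean_space \<Rightarrow> 'b::{banach, second_countable_topology}"
  assumes [measurable]: "f \<in> borel_measurable borel"
  shows "(LINT y|lborel. f (a - y)) = (LINT y|lborel. f y)"
proof -
  have "(LINT y|lborel. f y) = (LINT y|distr lborel borel (\<lambda>y. a - y). f y)"
    using lborel_eq_reflect[of a] by simp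
  also have "\<dots> = (LINT y|lborel. f (a - y))" by (rule integral_distr) auto
  finally show ?thesis by simp
qed

lemma nn_integral_reflect:
  fixes f :: "'a::euclidean_space \<Rightarrow> ennreal"
  assumes [measurable]: "f \<in> borel_measurable borel"
  shows "(\<integral>\<^sup>+y. f (a - y) \<partial>lborel) = (\<integral>\<^sup>+y. f y \<partial>lborel)"
proof -
  have "(\<integral>\<^sup>+y. f y \<partial>lborel) = (\<integral>\<^sup>+y. f y \<partial>distr lborel borel (\<lambda>y. a - y))"
    using lborel_eq_reflect[of a] by simp
  also have "\<dots> = (\<integral>\<^sup>+y. f (a - y) \<partial>lborel)" by (rule nn_integral_distr) auto
  finally show ?thesis by simp
qed

lemma integrable_translate:
  fixes f :: "'a::euclidean_space \<Rightarrow> 'b::{banach, second_countable_topology}"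
  assumes "integrable lborel f"
  shows "integrable lborel (\<lambda>y. f (y - a))"
proof -
  from integrable_reflect[OF integrable_reflect[OF assms, of 0], of a]
  show ?thesis by simp
qed

lemma integral_translate:
  fixes f :: "'a::euclidean_space \<Rightarrow> 'b::{banach, second_countable_topology}"
  assumes "f \<in> borel_measurable borel"
  shows "(LINT y|lborel. f (y - a)) = (LINT y|lborel. f y)"
  using integral_translate_plus[OF assms, of "-a"] by simp

lemma integrable_bounded_scaleR:
  fixes f :: "'a \<Rightarrow> 'b::{banach, second_countable_topology}" and g :: "'a \<Rightarrow> real"
  assumes "integrable M f" and [measurable]: "g \<in> borel_measurable M" and "\<And>x. norm (g x) \<le> B"
  shows "integrable M (\<lambda>x. g x *\<^sub>R f x)"
proof (rule Bochner_Integration.integrable_bound)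
  show "integrable M (\<lambda>x. B *\<^sub>R f x)" using assms(1) by simp
  show "AE x in M. norm (g x *\<^sub>R f x) \<le> norm (B *\<^sub>R f x)"
  proof (intro AE_I2)
    fix x show "norm (g x *\<^sub>R f x) \<le> norm (B *\<^sub>R f x)"
      using assms(3)[of x] by (auto intro!: mult_right_mono)
  qed
qed (use assms in auto)

lemma integrable_scaleR_bounded:
  fixes g :: "'a \<Rightarrow> 'b::{banach, second_countable_topology}" and f :: "'a \<Rightarrow> real"
  assumes "integrable M f" and [measurable]: "g \<in> borel_measurable M" and "\<And>x. norm (g x) \<le> B"
  shows "integrable M (\<lambda>x. f x *\<^sub>R g x)"
proof (rule Bochner_Integration.integrable_bound)
  show "integrable M (\<lambda>x. B * f x)" using assms(1) by simp
  show "AE x in M. norm (f x *\<^sub>R g x) \<le> norm (B * f x)"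
  proof (intro AE_I2)
    fix x show "norm (f x *\<^sub>R g x) \<le> norm (B * f x)"
    proof -
      have "norm (g x) * \<bar>f x\<bar> \<le> \<bar>B\<bar> * \<bar>f x\<bar>"
        using assms(3)[of x] by (intro mult_right_mono) auto
      then show ?thesis by (simp add: abs_mult mult.commute)
    qed
  qed
qed (use assms in auto)

lemma bounded_of_compact_support:
  fixes f :: "'a::euclidean_space \<Rightarrow> 'b::real_normed_vector"
  assumes "continuous_on UNIV f" "compact K" "\<And>x. x \<notin> K \<Longrightarrow> f x = 0"
  obtains B where "0 < B" "\<And>x. norm (f x) \<le> B"
proof -
  have "bounded (f ` K)"
    by (intro compact_imp_bounded compact_continuous_image continuous_on_subset[OF assms(1)] assms(2)) simp
  then obtain B where B: "0 < B" "\<And>x. x \<in> K \<Longrightarrow> norm (f x) \<le> B"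
    by (auto simp: bounded_pos)
  show ?thesis
  proof
    show "norm (f x) \<le> B" for x using B assms(3)[of x] by (cases "x \<in> K") auto
  qed (rule B)
qed

lemma integrable_times_continuous:
  fixes f :: "'a::euclidean_space \<Rightarrow> 'b::euclidean_space" and h :: "'a \<Rightarrow> real"
  assumes f: "integrable lborel f" and K: "compact K" "\<And>x. x \<notin> K \<Longrightarrow> f x = 0" and h: "continuous_on UNIV h"
  shows "integrable lborel (\<lambda>x. h x *\<^sub>R f x)"
proof -
  have [measurable]: "h \<in> borel_measurable borel" using h by (rule borel_measurable_continuous_onI)
  have "bounded (h ` K)"
    by (intro compact_imp_bounded compact_continuous_image continuous_on_subset[OF h] K(1)) simp
  then obtain B where B: "0 < B" "\<And>x. x \<in> K \<Longrightarrow> \<bar>h x\<bar> \<le> B" by (auto simp: bounded_pos)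
  show ?thesis
  proof (rule Bochner_Integration.integrable_bound)
    show "integrable lborel (\<lambda>x. B *\<^sub>R f x)" using f by simp
    show "AE x in lborel. norm (h x *\<^sub>R f x) \<le> norm (B *\<^sub>R f x)"
    proof (intro AE_I2)
      fix x show "norm (h x *\<^sub>R f x) \<le> norm (B *\<^sub>R f x)"
        using B(1) B(2)[of x] K(2)[of x] by (cases "x \<in> K") (auto intro!: mult_right_mono)
    qed
  qed (use f in auto)
qed

lemma C1_grad_measurable:
  assumes "C1_grad f D" shows "f \<in> borel_measurable borel" "D \<in> borel_measurable borel"
  using assms C1_grad_continuous[OF assms]
  by (auto simp: C1_grad_def intro: borel_measurable_continuous_onI)

text \<open>
  The remainder of the first order expansion of \<open>\<rho>\<close> is at most \<open>e |h|\<close> for small \<open>h\<close>, uniformly, and so the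
  remainder for the convolution is at most \<open>e |h|\<close> times the \<open>L\<^sup>1\<close> norm of \<open>f\<close>.
\<close>

lemma convolution_C1_grad:
  fixes f :: "'a::euclidean_space \<Rightarrow> real"
  assumes r: "C1_grad \<rho> D" and K: "compact K" "\<And>x. x \<notin> K \<Longrightarrow> \<rho> x = 0"
    and f: "integrable lborel f"
  shows "C1_grad (\<lambda>x. LINT y|lborel. \<rho> (x - y) * f y) (\<lambda>x. LINT y|lborel. f y *\<^sub>R D (x - y))"
proof -
  note [measurable] = C1_grad_measurable[OF r]
  have [measurable]: "f \<in> borel_measurable borel" using f by auto
  have DK: "D x = 0" if "x \<notin> K" for x
    by (rule C1_grad_support[OF r compact_imp_closed[OF K(1)] K(2) that])
  have cD: "continuous_on UNIV D" using r by (simp add: C1_grad_def)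
  obtain B where B: "\<And>x. norm (\<rho> x) \<le> B"
    using bounded_of_compact_support[OF C1_grad_continuous[OF r] K] by metis
  obtain B' where B': "\<And>x. norm (D x) \<le> B'"
    using bounded_of_compact_support[OF cD K(1) DK] by metis
  have i1: "integrable lborel (\<lambda>y. \<rho> (x - y) * f y)" for x
    using integrable_bounded_scaleR[OF f, of "\<lambda>y. \<rho> (x - y)" B] B by simp
  have i2: "integrable lborel (\<lambda>y. f y *\<^sub>R D (x - y))" for x
    by (rule integrable_scaleR_bounded[OF f, of _ B']) (use B' in auto)
  have inner: "(LINT y|lborel. f y *\<^sub>R D (x - y)) \<bullet> h = (LINT y|lborel. f y * (D (x - y) \<bullet> h))"
    and i3: "integrable lborel (\<lambda>y. f y * (D (x - y) \<bullet> h))" for x h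
    using integral_inner_left[of h lborel "\<lambda>y. f y *\<^sub>R D (x - y)"]
      integrable_inner_left[of h lborel "\<lambda>y. f y *\<^sub>R D (x - y)"] i2[of x] by simp_all
  define F where "F = (LINT y|lborel. \<bar>f y\<bar>)"
  have F0: "0 \<le> F" by (auto simp: F_def)
  have "((\<lambda>x. LINT y|lborel. \<rho> (x - y) * f y) has_derivative
      (\<lambda>h. (LINT y|lborel. f y *\<^sub>R D (x - y)) \<bullet> h)) (at x)" for x
    unfolding has_derivative_at_alt
  proof (intro conjI allI impI)
    show "bounded_linear (\<lambda>h. (LINT y|lborel. f y *\<^sub>R D (x - y)) \<bullet> h)"
      by (rule bounded_linear_inner_right)
    fix e :: real assume "0 < e"
    then have "0 < e / (F + 1)" using F0 by simp
    from C1_grad_uniform[OF r K this] obtain d where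
      d: "0 < d" "\<And>x h. norm h < d \<Longrightarrow> \<bar>\<rho> (x + h) - \<rho> x - D x \<bullet> h\<bar> \<le> e / (F + 1) * norm h" by metis
    show "\<exists>d>0. \<forall>z. norm (z - x) < d \<longrightarrow>
       norm ((LINT y|lborel. \<rho> (z - y) * f y) - (LINT y|lborel. \<rho> (x - y) * f y) -
         (LINT y|lborel. f y *\<^sub>R D (x - y)) \<bullet> (z - x)) \<le> e * norm (z - x)"
    proof (intro exI[of _ d] conjI allI impI d(1))
      fix z assume z: "norm (z - x) < d"
      have "(LINT y|lborel. \<rho> (z - y) * f y) - (LINT y|lborel. \<rho> (x - y) * f y) -
         (LINT y|lborel. f y *\<^sub>R D (x - y)) \<bullet> (z - x) =
         (LINT y|lborel. \<rho> (z - y) * f y - \<rho> (x - y) * f y - f y * (D (x - y) \<bullet> (z - x)))"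
        using i1 i3 by (simp add: inner)
      also have "\<dots> = (LINT y|lborel. f y * (\<rho> ((x - y) + (z - x)) - \<rho> (x - y) - D (x - y) \<bullet> (z - x)))"
        by (intro Bochner_Integration.integral_cong) (auto simp: algebra_simps)
      finally have eq: "(LINT y|lborel. \<rho> (z - y) * f y) - (LINT y|lborel. \<rho> (x - y) * f y) -
         (LINT y|lborel. f y *\<^sub>R D (x - y)) \<bullet> (z - x) = \<dots>" .
      have "norm (LINT y|lborel. f y * (\<rho> ((x - y) + (z - x)) - \<rho> (x - y) - D (x - y) \<bullet> (z - x)))
        \<le> (LINT y|lborel. \<bar>f y\<bar> * (e / (F + 1) * norm (z - x)))"
      proof (rule order_trans[OF integral_norm_bound], rule integral_mono')
        show "integrable lborel (\<lambda>y. \<bar>f y\<bar> * (e / (F + 1) * norm (z - x)))" using f by simp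
        show "norm (f y * (\<rho> ((x - y) + (z - x)) - \<rho> (x - y) - D (x - y) \<bullet> (z - x)))
          \<le> \<bar>f y\<bar> * (e / (F + 1) * norm (z - x))" for y
          unfolding real_norm_def abs_mult by (intro mult_left_mono d(2)[OF z]) auto
      qed (use \<open>0 < e\<close> F0 in auto)
      also have "\<dots> = F * (e / (F + 1) * norm (z - x))" by (simp add: F_def)
      also have "\<dots> \<le> (F + 1) * (e / (F + 1) * norm (z - x))"
        using less_imp_le[OF \<open>0 < e / (F + 1)\<close>] by (intro mult_right_mono mult_nonneg_nonneg) auto
      also have "\<dots> = e * norm (z - x)" using F0 by simp
      finally show "norm ((LINT y|lborel. \<rho> (z - y) * f y) - (LINT y|lborel. \<rho> (x - y) * f y) -
         (LINT y|lborel. f y *\<^sub>R D (x - y)) \<bullet> (z - x)) \<le> e * norm (z - x)" by (simp only: eq)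
    qed
  qed
  moreover have "continuous_on UNIV (\<lambda>x. LINT y|lborel. f y *\<^sub>R D (x - y))"
    unfolding continuous_on_iff
  proof (intro ballI allI impI)
    fix x :: 'a and e :: real assume "0 < e"
    then have e: "0 < e / (F + 1)" using F0 by simp
    from continuous_compact_support_uniform[OF cD K(1) DK]
    obtain d where d: "0 < d" "\<And>x x'. dist x' x < d \<Longrightarrow> dist (D x') (D x) < e / (F + 1)"
      unfolding uniformly_continuous_on_def using e by (metis UNIV_I)
    show "\<exists>d>0. \<forall>x'\<in>UNIV. dist x' x < d \<longrightarrow>
        dist (LINT y|lborel. f y *\<^sub>R D (x' - y)) (LINT y|lborel. f y *\<^sub>R D (x - y)) < e"
    proof (intro exI[of _ d] conjI ballI impI d(1))
      fix z assume z: "dist z x < d"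
      have "norm (LINT y|lborel. f y *\<^sub>R D (z - y) - f y *\<^sub>R D (x - y)) \<le> (LINT y|lborel. \<bar>f y\<bar> * (e / (F + 1)))"
      proof (rule order_trans[OF integral_norm_bound], rule integral_mono')
        show "integrable lborel (\<lambda>y. \<bar>f y\<bar> * (e / (F + 1)))" using f by simp
        fix y
        have "norm (D (z - y) - D (x - y)) \<le> e / (F + 1)"
          using d(2)[of "z - y" "x - y"] z by (simp add: dist_norm less_imp_le)
        then show "norm (f y *\<^sub>R D (z - y) - f y *\<^sub>R D (x - y)) \<le> \<bar>f y\<bar> * (e / (F + 1))"
          unfolding scaleR_diff_right[symmetric] norm_scaleR by (intro mult_left_mono) auto
      qed (rule mult_nonneg_nonneg[OF abs_ge_zero less_imp_le[OF e]])
      also have "\<dots> = F * (e / (F + 1))" by (simp add: F_def)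
      also have "\<dots> < e" using F0 \<open>0 < e\<close> by (simp add: field_simps)
      finally show "dist (LINT y|lborel. f y *\<^sub>R D (z - y)) (LINT y|lborel. f y *\<^sub>R D (x - y)) < e"
        using i2 by (simp add: dist_norm)
    qed
  qed
  ultimately show ?thesis by (simp add: C1_grad_def)
qed

text \<open>
  A partial derivative of the convolution is the convolution with a partial derivative of the kernel, which has
  the same properties; hence the induction with a general kernel.
\<close>

lemma convolution_Ck:
  fixes f :: "'a::euclidean_space \<Rightarrow> real"
  assumes "\<And>k. Ck k \<rho>" and K: "compact K" "\<And>x. x \<notin> K \<Longrightarrow> \<rho> x = 0"
    and f: "integrable lborel f"
  shows "Ck k (\<lambda>x. LINT y|lborel. \<rho> (x - y) * f y)"
  using assms(1) K(2)
proof (induction k arbitrary: \<rho>)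
  case 0
  obtain D where "C1_grad \<rho> D" using Ck_imp_C1_grad[OF 0(1)] by blast
  from C1_grad_continuous[OF convolution_C1_grad[OF this K(1) 0(2) f]] show ?case by simp
next
  case (Suc k)
  obtain D where D: "C1_grad \<rho> D" using Ck_imp_C1_grad[OF Suc.prems(1)] by blast
  note C = convolution_C1_grad[OF D K(1) Suc.prems(2) f]
  note [measurable] = C1_grad_measurable[OF D]
  have [measurable]: "f \<in> borel_measurable borel" using f by auto
  have DK: "D x = 0" if "x \<notin> K" for x
    by (rule C1_grad_support[OF D compact_imp_closed[OF K(1)] Suc.prems(2) that])
  have cD: "continuous_on UNIV D" using D by (simp add: C1_grad_def)
  obtain B' where B': "\<And>x. norm (D x) \<le> B'"
    using bounded_of_compact_support[OF cD K(1) DK] by metis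
  have i2: "integrable lborel (\<lambda>y. f y *\<^sub>R D (x - y))" for x
    by (rule integrable_scaleR_bounded[OF f, of _ B']) (use B' in auto)
  have "Ck k (\<lambda>x. frechet_derivative (\<lambda>x. LINT y|lborel. \<rho> (x - y) * f y) (at x) i)"
    if i: "i \<in> Basis" for i
  proof -
    have eq: "frechet_derivative \<rho> (at z) i = D z \<bullet> i" for z by (rule C1_grad_frechet_derivative[OF D])
    have "frechet_derivative (\<lambda>x. LINT y|lborel. \<rho> (x - y) * f y) (at x) i
       = (LINT y|lborel. f y * (D (x - y) \<bullet> i))" for x
      using C1_grad_frechet_derivative[OF C, of x i] integral_inner_left[of i lborel "\<lambda>y. f y *\<^sub>R D (x - y)"] i2[of x]
      by simp
    then have "(\<lambda>x. frechet_derivative (\<lambda>x. LINT y|lborel. \<rho> (x - y) * f y) (at x) i)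
       = (\<lambda>x. LINT y|lborel. frechet_derivative \<rho> (at (x - y)) i * f y)"
      by (simp add: eq mult.commute[of _ "f _"])
    moreover have "Ck k (\<lambda>x. LINT y|lborel. frechet_derivative \<rho> (at (x - y)) i * f y)"
    proof (rule Suc.IH)
      show "Ck k (\<lambda>z. frechet_derivative \<rho> (at z) i)" for k
        using Suc.prems(1)[of "Suc k"] i by simp
      show "frechet_derivative \<rho> (at z) i = 0" if "z \<notin> K" for z
        using DK[OF that] by (simp add: eq)
    qed
    ultimately show ?thesis by simp
  qed
  moreover have "(\<lambda>x. LINT y|lborel. \<rho> (x - y) * f y) differentiable (at x)" for x
    using C unfolding C1_grad_def differentiable_def by blast
  ultimately show ?case by simp
qed

section \<open>Convergence of mollifications\<close>

text \<open>
  Continuity of translations in \<open>L\<^sup>1\<close>, in terms of sequences so that dominated convergence applies.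
\<close>

definition translation_continuous :: "('a::euclidean_space \<Rightarrow> 'b::{banach,second_countable_topology}) \<Rightarrow> bool" where
  "translation_continuous f \<longleftrightarrow>
     (\<forall>X. X \<longlonglongrightarrow> 0 \<longrightarrow> (\<lambda>n. LINT x|lborel. norm (f (x - X n) - f x)) \<longlonglongrightarrow> 0)"

text \<open>
  Translations preserve the \<open>L\<^sup>1\<close> norm, so the property passes to \<open>L\<^sup>1\<close> limits.
\<close>

lemma translation_continuous_approx:
  fixes f :: "'a::euclidean_space \<Rightarrow> 'b::{banach,second_countable_topology}"
  assumes f: "integrable lborel f"
    and g: "\<And>e. 0 < e \<Longrightarrow> \<exists>g. integrable lborel g \<and> translation_continuous g \<and>
              (LINT x|lborel. norm (f x - g x)) < e"
  shows "translation_continuous f"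
  unfolding translation_continuous_def
proof (intro allI impI)
  fix X :: "nat \<Rightarrow> 'a" assume X: "X \<longlonglongrightarrow> 0"
  show "(\<lambda>n. LINT x|lborel. norm (f (x - X n) - f x)) \<longlonglongrightarrow> 0"
  proof (rule LIMSEQ_I)
    fix e :: real assume "0 < e"
    then have "0 < e / 3" by simp
    from g[OF this] obtain g where g: "integrable lborel g" "translation_continuous g"
      "(LINT x|lborel. norm (f x - g x)) < e / 3" by blast
    have "(\<lambda>n. LINT x|lborel. norm (g (x - X n) - g x)) \<longlonglongrightarrow> 0"
      using g(2) X by (simp add: translation_continuous_def)
    from LIMSEQ_D[OF this \<open>0 < e / 3\<close>] obtain N where
      N: "\<And>n. n \<ge> N \<Longrightarrow> norm (LINT x|lborel. norm (g (x - X n) - g x)) < e / 3" by auto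
    show "\<exists>N. \<forall>n\<ge>N. norm ((LINT x|lborel. norm (f (x - X n) - f x)) - 0) < e"
    proof (intro exI[of _ N] allI impI)
      fix n assume "n \<ge> N"
      note i [simp] = f g(1) integrable_translate[OF f] integrable_translate[OF g(1)]
      have "(LINT x|lborel. norm (f (x - X n) - f x)) \<le>
        (LINT x|lborel. norm (f (x - X n) - g (x - X n)) + norm (g (x - X n) - g x) + norm (f x - g x))"
      proof (rule integral_mono)
        fix x
        have "norm ((f (x - X n) - g (x - X n)) + (g (x - X n) - g x) + (g x - f x)) \<le>
          norm (f (x - X n) - g (x - X n)) + norm (g (x - X n) - g x) + norm (g x - f x)"
          by (intro norm_triangle_le add_right_mono norm_triangle_ineq)
        then show "norm (f (x - X n) - f x) \<le>
          norm (f (x - X n) - g (x - X n)) + norm (g (x - X n) - g x) + norm (f x - g x)"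
          by (simp add: norm_minus_commute)
      qed simp_all
      also have "\<dots> = (LINT x|lborel. norm (f (x - X n) - g (x - X n))) +
          (LINT x|lborel. norm (g (x - X n) - g x)) + (LINT x|lborel. norm (f x - g x))"
        by simp
      also have "(LINT x|lborel. norm (f (x - X n) - g (x - X n))) = (LINT x|lborel. norm (f x - g x))"
        by (rule integral_translate[of "\<lambda>x. norm (f x - g x)"]) (use f g(1) in measurable)
      finally have "(LINT x|lborel. norm (f (x - X n) - f x)) < e"
        using N[OF \<open>n \<ge> N\<close>] g(3) by (simp add: abs_less_iff)
      then show "norm ((LINT x|lborel. norm (f (x - X n) - f x)) - 0) < e"
        by (simp add: abs_of_nonneg)
    qed
  qed
qed

text \<open>
  The \<open>L\<^sup>1\<close> distance between the indicators of \<open>U\<close> and of a translate is twice the difference between the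
  measure of \<open>U\<close> and that of the overlap. The overlap tends to the full measure because every point of an open
  set stays in it under small shifts.
\<close>

lemma translation_continuous_open:
  fixes U :: "'a::euclidean_space set" and c :: "'b::{banach,second_countable_topology}"
  assumes U: "open U" "emeasure lborel U < \<infinity>"
  shows "translation_continuous (\<lambda>x. indicator U x *\<^sub>R c)"
  unfolding translation_continuous_def
proof (intro allI impI)
  fix X :: "nat \<Rightarrow> 'a" assume X: "X \<longlonglongrightarrow> 0"
  have [measurable]: "U \<in> sets borel" using U by simp
  let ?i = "indicator U :: 'a \<Rightarrow> real"
  have iU: "integrable lborel ?i" using U by simp
  note iUt = integrable_translate[OF iU]
  have iUU: "integrable lborel (\<lambda>x. ?i x * ?i (x - X n))" for n
    by (rule Bochner_Integration.integrable_bound[OF iU]) (auto simp: indicator_def)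
  have "(\<lambda>n. LINT x|lborel. ?i x * ?i (x - X n)) \<longlonglongrightarrow> (LINT x|lborel. ?i x)"
  proof (rule integral_dominated_convergence[where w="?i"])
    show "AE x in lborel. (\<lambda>n. ?i x * ?i (x - X n)) \<longlonglongrightarrow> ?i x"
    proof (intro AE_I2)
      fix x
      show "(\<lambda>n. ?i x * ?i (x - X n)) \<longlonglongrightarrow> ?i x"
      proof (cases "x \<in> U")
        case True
        have "(\<lambda>n. x - X n) \<longlonglongrightarrow> x - 0" by (intro tendsto_intros X)
        then have "\<forall>\<^sub>F n in sequentially. x - X n \<in> U"
          using topological_tendstoD[OF _ U(1), of "\<lambda>n. x - X n" x] True by simp
        then show ?thesis
          by (intro tendsto_eventually) (auto elim!: eventually_mono simp: True)
      qed simp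
    qed
  qed (use iU in \<open>auto simp: indicator_def\<close>)
  then have "(\<lambda>n. 2 * ((LINT x|lborel. ?i x) - (LINT x|lborel. ?i x * ?i (x - X n))) * norm c) \<longlonglongrightarrow>
      2 * ((LINT x|lborel. ?i x) - (LINT x|lborel. ?i x)) * norm c"
    by (intro tendsto_intros)
  moreover have "(LINT x|lborel. norm (?i (x - X n) *\<^sub>R c - ?i x *\<^sub>R c)) =
      2 * ((LINT x|lborel. ?i x) - (LINT x|lborel. ?i x * ?i (x - X n))) * norm c" for n
  proof -
    have "(LINT x|lborel. norm (?i (x - X n) *\<^sub>R c - ?i x *\<^sub>R c)) =
       (LINT x|lborel. (?i (x - X n) + ?i x - 2 * (?i x * ?i (x - X n))) * norm c)"
      by (intro Bochner_Integration.integral_cong) (auto simp: indicator_def)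
    also have "\<dots> = (LINT x|lborel. ?i (x - X n) + ?i x - 2 * (?i x * ?i (x - X n))) * norm c"
      by simp
    also have "(LINT x|lborel. ?i (x - X n) + ?i x - 2 * (?i x * ?i (x - X n))) =
       (LINT x|lborel. ?i (x - X n)) + (LINT x|lborel. ?i x) - 2 * (LINT x|lborel. ?i x * ?i (x - X n))"
      using iU iUt iUU
      by (subst Bochner_Integration.integral_diff Bochner_Integration.integral_add integral_mult_right_zero;
          (intro Bochner_Integration.integrable_add integrable_mult_right)?; simp)+
    also have "(LINT x|lborel. ?i (x - X n)) = (LINT x|lborel. ?i x)"
      by (rule integral_translate) measurable
    finally show ?thesis by (simp add: algebra_simps)
  qed
  ultimately show "(\<lambda>n. LINT x|lborel. norm (?i (x - X n) *\<^sub>R c - ?i x *\<^sub>R c)) \<longlonglongrightarrow> 0"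
    by simp
qed

text \<open>
  Outer regularity reduces this to open sets.
\<close>

lemma translation_continuous_indicator:
  fixes A :: "'a::euclidean_space set" and c :: "'b::{banach,second_countable_topology}"
  assumes A: "A \<in> sets lborel" "emeasure lborel A < \<infinity>"
  shows "translation_continuous (\<lambda>x. indicator A x *\<^sub>R c)"
proof (rule translation_continuous_approx)
  have [measurable]: "A \<in> sets borel" using A by simp
  show iA: "integrable lborel (\<lambda>x. indicator A x *\<^sub>R c)"
    using A by (intro integrable_scaleR_left) (auto)
  fix e :: real assume "0 < e"
  define e' where "e' = e / (norm c + 1)"
  have nc: "0 < norm c + 1" by (simp add: add_nonneg_pos)
  have e': "0 < e'" using \<open>0 < e\<close> nc by (simp add: e'_def)
  have Al: "A \<in> sets lebesgue" using A by auto
  obtain U where U: "open U" "A \<subseteq> U" "emeasure lebesgue (U - A) < ennreal e'"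
    using sets_lebesgue_outer_open[OF Al e'] by metis
  have [measurable]: "U \<in> sets borel" using U by simp
  have UA: "emeasure lborel (U - A) < ennreal e'" using U(3) by simp
  have fUA: "emeasure lborel (U - A) < \<infinity>" using less_trans[OF UA ennreal_less_top] by simp
  have "emeasure lborel U = emeasure lborel (A \<union> (U - A))" using U(2) by (simp add: Un_absorb1)
  also have "\<dots> \<le> emeasure lborel A + emeasure lborel (U - A)" by (rule emeasure_subadditive) auto
  also have "\<dots> < \<infinity>" using A(2) fUA by simp
  finally have fU: "emeasure lborel U < \<infinity>" .
  have iU: "integrable lborel (\<lambda>x. indicator U x *\<^sub>R c)"
    using fU by (intro integrable_scaleR_left) auto
  have "(LINT x|lborel. norm (indicator A x *\<^sub>R c - indicator U x *\<^sub>R c)) =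
     (LINT x|lborel. indicator (U - A) x * norm c)"
    using U(2) by (intro Bochner_Integration.integral_cong) (auto simp: indicator_def)
  also have "\<dots> = measure lborel (U - A) * norm c" by simp
  also have "measure lborel (U - A) \<le> e'"
    using less_imp_le[OF UA] e' unfolding measure_def by (intro enn2real_leI) auto
  finally have "(LINT x|lborel. norm (indicator A x *\<^sub>R c - indicator U x *\<^sub>R c)) \<le> e' * norm c"
    by (simp add: mult_right_mono)
  also have "\<dots> < e" using nc \<open>0 < e\<close> by (simp add: e'_def field_simps)
  finally show "\<exists>g. integrable lborel g \<and> translation_continuous g \<and>
              (LINT x|lborel. norm (indicator A x *\<^sub>R c - g x)) < e"
    using iU translation_continuous_open[OF U(1) fU, of c] by blast
qed

lemma translation_continuous_add:
  assumes f: "integrable lborel f" "translation_continuous f"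
    and g: "integrable lborel g" "translation_continuous g"
  shows "translation_continuous (\<lambda>x. f x + g x)"
  unfolding translation_continuous_def
proof (intro allI impI)
  fix X :: "nat \<Rightarrow> 'a" assume X: "X \<longlonglongrightarrow> 0"
  note i [simp] = f(1) g(1) integrable_translate[OF f(1)] integrable_translate[OF g(1)]
  have l: "(\<lambda>n. (LINT x|lborel. norm (f (x - X n) - f x)) + (LINT x|lborel. norm (g (x - X n) - g x))) \<longlonglongrightarrow> 0 + 0"
    using f(2) g(2) X unfolding translation_continuous_def by (intro tendsto_add) auto
  show "(\<lambda>n. LINT x|lborel. norm (f (x - X n) + g (x - X n) - (f x + g x))) \<longlonglongrightarrow> 0"
  proof (rule tendsto_sandwich[OF _ _ tendsto_const l[simplified]])
    show "\<forall>\<^sub>F n in sequentially. (LINT x|lborel. norm (f (x - X n) + g (x - X n) - (f x + g x))) \<le>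
      (LINT x|lborel. norm (f (x - X n) - f x)) + (LINT x|lborel. norm (g (x - X n) - g x))"
    proof (intro always_eventually allI)
      fix n
      have "(LINT x|lborel. norm (f (x - X n) + g (x - X n) - (f x + g x))) \<le>
         (LINT x|lborel. norm (f (x - X n) - f x) + norm (g (x - X n) - g x))"
        by (rule integral_mono) (simp_all add: norm_diff_triangle_ineq)
      then show "(LINT x|lborel. norm (f (x - X n) + g (x - X n) - (f x + g x))) \<le>
      (LINT x|lborel. norm (f (x - X n) - f x)) + (LINT x|lborel. norm (g (x - X n) - g x))" by simp
    qed
  qed (auto intro!: always_eventually)
qed

lemma integrable_translation_continuous:
  fixes f :: "'a::euclidean_space \<Rightarrow> 'b::{banach,second_countable_topology}"
  assumes "integrable lborel f"
  shows "translation_continuous f"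
  using assms
proof (induction rule: integrable_induct)
  case (base A c)
  then show ?case by (rule translation_continuous_indicator)
next
  case (add f g)
  then show ?case by (intro translation_continuous_add)
next
  case (lim f s)
  have "(\<lambda>i. LINT x|lborel. norm (f x - s i x)) \<longlonglongrightarrow> (LINT x|(lborel::'a measure). 0)"
  proof (rule integral_dominated_convergence[where w="\<lambda>x. 3 * norm (f x)"])
    show "AE x in lborel. (\<lambda>i. norm (f x - s i x)) \<longlonglongrightarrow> 0"
    proof (intro AE_I2)
      fix x
      have "(\<lambda>i. norm (f x - s i x)) \<longlonglongrightarrow> norm (f x - f x)"
        by (intro tendsto_intros) (use lim in simp)
      then show "(\<lambda>i. norm (f x - s i x)) \<longlonglongrightarrow> 0" by simp
    qed
    show "AE x in lborel. norm (norm (f x - s i x)) \<le> 3 * norm (f x)" for i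
    proof (intro AE_I2)
      fix x
      show "norm (norm (f x - s i x)) \<le> 3 * norm (f x)"
      proof -
        have "norm (s i x) \<le> 2 * norm (f x)" using lim by simp
        then show ?thesis using norm_triangle_ineq4[of "f x" "s i x"] by simp
      qed
    qed
  qed (use lim in auto)
  then have l: "(\<lambda>i. LINT x|lborel. norm (f x - s i x)) \<longlonglongrightarrow> 0" by simp
  show ?case
  proof (rule translation_continuous_approx)
    show "integrable lborel f" using lim by simp
  next
    fix e :: real assume "0 < e"
    from order_tendstoD(2)[OF l this] obtain i where "(LINT x|lborel. norm (f x - s i x)) < e"
      by (auto simp: eventually_sequentially)
    then show "\<exists>g. integrable lborel g \<and> translation_continuous g \<and> (LINT x|lborel. norm (f x - g x)) < e"
      using lim by blast
  qed
qed

definition mollify :: "real \<Rightarrow> ('a::euclidean_space \<Rightarrow> 'b::{banach,second_countable_topology}) \<Rightarrow> 'a \<Rightarrow> 'b" where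
  "mollify e f x = (LINT y|lborel. mollifier e (x - y) *\<^sub>R f y)"

lemma mollify_integrand:
  fixes f :: "'a::euclidean_space \<Rightarrow> 'b::{banach,second_countable_topology}"
  assumes "integrable lborel f"
  shows "integrable lborel (\<lambda>y. mollifier e (x - y) *\<^sub>R f y)"
proof -
  obtain B where "\<And>z::'a. norm (mollifier e z) \<le> B" using mollifier_bounded by blast
  then show ?thesis by (intro integrable_bounded_scaleR[OF assms, of _ B]) auto
qed

lemma mollify_measurable[measurable]:
  assumes [measurable]: "f \<in> borel_measurable borel"
  shows "mollify e f \<in> borel_measurable borel"
proof -
  have "(\<lambda>x. LINT y|lborel. mollifier e (x - y) *\<^sub>R f y) \<in> borel_measurable lborel"
    by measurable
  then show ?thesis by (simp add: mollify_def[abs_def])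
qed

lemma mollify_reflect:
  fixes f :: "'a::euclidean_space \<Rightarrow> 'b::{banach,second_countable_topology}"
  assumes "f \<in> borel_measurable borel"
  shows "mollify e f x = (LINT h|lborel. mollifier e h *\<^sub>R f (x - h))"
  unfolding mollify_def
  using integral_reflect[of "\<lambda>h. mollifier e h *\<^sub>R f (x - h)" x] assms by simp

text \<open>
  The error is the average, with weight the mollifier, of \<open>f (x - h) - f x\<close>; by Tonelli its \<open>L\<^sup>1\<close> norm is at
  most the supremum over \<open>|h| < e\<close> of the \<open>L\<^sup>1\<close> norms of these differences.
\<close>

lemma mollify_L1:
  fixes f :: "'a::euclidean_space \<Rightarrow> 'b::{banach,second_countable_topology}"
  assumes f: "integrable lborel f" and "0 < \<epsilon>"
  obtains d where "0 < d" "\<And>e. 0 < e \<Longrightarrow> e < d \<Longrightarrow>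
    integrable lborel (\<lambda>x. mollify e f x - f x) \<and> (LINT x|lborel. norm (mollify e f x - f x)) \<le> \<epsilon>"
proof -
  have [measurable]: "f \<in> borel_measurable borel" using f by auto
  have "\<exists>d>0. \<forall>h. norm h < d \<longrightarrow> (LINT x|lborel. norm (f (x - h) - f x)) \<le> \<epsilon>"
  proof (rule ccontr)
    assume "\<not> ?thesis"
    then have "\<forall>n. \<exists>h. norm h < 1 / real (Suc n) \<and> \<not> (LINT x|lborel. norm (f (x - h) - f x)) \<le> \<epsilon>"
      by (metis of_nat_0_less_iff zero_less_Suc zero_less_divide_1_iff)
    then obtain X where X: "\<And>n. norm (X n) < 1 / real (Suc n)"
      "\<And>n. \<not> (LINT x|lborel. norm (f (x - X n) - f x)) \<le> \<epsilon>" by metis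
    have "X \<longlonglongrightarrow> 0"
    proof (rule Lim_null_comparison)
      show "\<forall>\<^sub>F n in sequentially. norm (X n) \<le> inverse (real (Suc n))"
        using X(1) by (auto intro!: always_eventually simp: inverse_eq_divide less_imp_le)
      show "(\<lambda>n. inverse (real (Suc n))) \<longlonglongrightarrow> 0" by (rule LIMSEQ_inverse_real_of_nat)
    qed
    then have "(\<lambda>n. LINT x|lborel. norm (f (x - X n) - f x)) \<longlonglongrightarrow> 0"
      using integrable_translation_continuous[OF f] by (simp add: translation_continuous_def)
    from order_tendstoD(2)[OF this \<open>0 < \<epsilon>\<close>] X(2) show False
      by (auto simp: eventually_sequentially not_le) (meson less_asym order_refl)
  qed
  then obtain d where d: "0 < d" "\<And>h. norm h < d \<Longrightarrow> (LINT x|lborel. norm (f (x - h) - f x)) \<le> \<epsilon>"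
    by blast
  show ?thesis
  proof (rule that[OF d(1)])
    fix e :: real assume e: "0 < e" "e < d"
    have inf: "integrable lborel (\<lambda>x. f (x - h) - f x)" for h
      using f integrable_translate[OF f, of h] by simp
    have im: "integrable lborel (\<lambda>h. mollifier e h *\<^sub>R f (x - h))" for x
    proof -
      obtain B where "\<And>z::'a. norm (mollifier e z) \<le> B" using mollifier_bounded by blast
      then show ?thesis by (intro integrable_bounded_scaleR[OF integrable_reflect[OF f], of _ B]) auto
    qed
    have im2: "integrable lborel (\<lambda>h::'a. mollifier e h *\<^sub>R f x)" for x
      by (intro integrable_scaleR_left mollifier_integrable e)
    have diff: "mollify e f x - f x = (LINT h|lborel. mollifier e h *\<^sub>R (f (x - h) - f x))" for x
    proof -
      have "f x = (LINT h::'a|lborel. mollifier e h *\<^sub>R f x)"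
        using mollifier_integral[OF e(1), where 'a='a] mollifier_integrable[OF e(1), where 'a='a] by simp
      then have "mollify e f x - f x =
        (LINT h|lborel. mollifier e h *\<^sub>R f (x - h)) - (LINT h::'a|lborel. mollifier e h *\<^sub>R f x)"
        by (simp add: mollify_reflect)
      also have "\<dots> = (LINT h|lborel. mollifier e h *\<^sub>R f (x - h) - mollifier e h *\<^sub>R f x)"
        using im im2 by simp
      finally show ?thesis by (simp add: scaleR_diff_right)
    qed
    have "(\<integral>\<^sup>+x. ennreal (norm (mollify e f x - f x)) \<partial>lborel) \<le>
      (\<integral>\<^sup>+x. (\<integral>\<^sup>+h. ennreal (mollifier e h * norm (f (x - h) - f x)) \<partial>lborel) \<partial>lborel)"
    proof (rule nn_integral_mono)
      fix x
      have "ennreal (norm (mollify e f x - f x)) \<le> (\<integral>\<^sup>+h. norm (mollifier e h *\<^sub>R (f (x - h) - f x)) \<partial>lborel)"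
        unfolding diff using im im2 by (intro integral_norm_bound_ennreal) (simp add: scaleR_diff_right)
      then show "ennreal (norm (mollify e f x - f x)) \<le> (\<integral>\<^sup>+h. ennreal (mollifier e h * norm (f (x - h) - f x)) \<partial>lborel)"
        using mollifier_nonneg[OF e(1), where 'a='a] by simp
    qed
    also have "\<dots> = (\<integral>\<^sup>+h. (\<integral>\<^sup>+x. ennreal (mollifier e h * norm (f (x - h) - f x)) \<partial>lborel) \<partial>lborel)"
      by (rule lborel_pair.Fubini') measurable
    also have "\<dots> \<le> (\<integral>\<^sup>+h. ennreal (mollifier e (h::'a)) * ennreal \<epsilon> \<partial>lborel)"
    proof (rule nn_integral_mono)
      fix h :: 'a
      show "(\<integral>\<^sup>+x. ennreal (mollifier e h * norm (f (x - h) - f x)) \<partial>lborel) \<le> ennreal (mollifier e h) * ennreal \<epsilon>"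
      proof (cases "norm h < d")
        case True
        have "(\<integral>\<^sup>+x. ennreal (mollifier e h * norm (f (x - h) - f x)) \<partial>lborel) =
          ennreal (mollifier e h) * (\<integral>\<^sup>+x. ennreal (norm (f (x - h) - f x)) \<partial>lborel)"
          using mollifier_nonneg[OF e(1), where 'a='a] by (subst nn_integral_cmult[symmetric]) (auto simp: ennreal_mult)
        also have "(\<integral>\<^sup>+x. ennreal (norm (f (x - h) - f x)) \<partial>lborel) = ennreal (LINT x|lborel. norm (f (x - h) - f x))"
          using inf[of h] by (intro nn_integral_eq_integral) auto
        also have "\<dots> \<le> ennreal \<epsilon>" using d(2)[OF True] by (rule ennreal_leI)
        finally show ?thesis by (simp add: mult_left_mono)
      next
        case False
        then show ?thesis using mollifier_eq_zero[OF e(1), of h] e(2) by simp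
      qed
    qed
    also have "\<dots> = ennreal (LINT h::'a|lborel. mollifier e h) * ennreal \<epsilon>"
      using mollifier_integrable[OF e(1), where 'a='a] mollifier_nonneg[OF e(1), where 'a='a]
      by (subst nn_integral_multc) (auto simp: nn_integral_eq_integral)
    also have "\<dots> = ennreal \<epsilon>" by (simp add: mollifier_integral[OF e(1)])
    finally have le: "(\<integral>\<^sup>+x. ennreal (norm (mollify e f x - f x)) \<partial>lborel) \<le> ennreal \<epsilon>" .
    then have i: "integrable lborel (\<lambda>x. mollify e f x - f x)"
      by (intro integrableI_bounded) (auto intro: le_less_trans)
    moreover have "(LINT x|lborel. norm (mollify e f x - f x)) \<le> \<epsilon>"
      using le i \<open>0 < \<epsilon>\<close> by (subst (asm) nn_integral_eq_integral) (auto)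
    ultimately show "integrable lborel (\<lambda>x. mollify e f x - f x) \<and> (LINT x|lborel. norm (mollify e f x - f x)) \<le> \<epsilon>" ..
  qed
qed

lemma mollify_L1_tendsto:
  fixes f :: "'a::euclidean_space \<Rightarrow> 'b::{banach,second_countable_topology}"
  assumes f: "integrable lborel f" and e: "e \<longlonglongrightarrow> 0" "\<And>n. 0 < e n"
  shows "(\<lambda>n. LINT x|lborel. norm (mollify (e n) f x - f x)) \<longlonglongrightarrow> 0"
proof (rule LIMSEQ_I)
  fix \<epsilon> :: real assume "0 < \<epsilon>"
  then have "0 < \<epsilon> / 2" by simp
  from mollify_L1[OF f this] obtain d where d: "0 < d" "\<And>e. 0 < e \<Longrightarrow> e < d \<Longrightarrow>
    (LINT x|lborel. norm (mollify e f x - f x)) \<le> \<epsilon> / 2" by metis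
  from order_tendstoD(2)[OF e(1) d(1)] obtain N where "\<And>n. n \<ge> N \<Longrightarrow> e n < d"
    by (auto simp: eventually_sequentially)
  then show "\<exists>N. \<forall>n\<ge>N. norm ((LINT x|lborel. norm (mollify (e n) f x - f x)) - 0) < \<epsilon>"
    using d(2)[OF e(2)] \<open>0 < \<epsilon>\<close> by (intro exI[of _ N]) (fastforce simp: abs_of_nonneg)
qed

lemma mollify_integrable:
  fixes f :: "'a::euclidean_space \<Rightarrow> 'b::{banach,second_countable_topology}"
  assumes f: "integrable lborel f" and e: "0 < e"
  shows "integrable lborel (mollify e f)"
proof -
  have [measurable]: "f \<in> borel_measurable borel" using f by auto
  have "(\<integral>\<^sup>+x. ennreal (norm (mollify e f x)) \<partial>lborel) \<le>
      (\<integral>\<^sup>+x. (\<integral>\<^sup>+y. ennreal (mollifier e (x - y) * norm (f y)) \<partial>lborel) \<partial>lborel)"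
    using integral_norm_bound_ennreal[OF mollify_integrand[OF f, of e]] mollifier_nonneg[OF e, where 'a='a]
    by (intro nn_integral_mono) (simp add: mollify_def)
  also have "\<dots> = (\<integral>\<^sup>+y. (\<integral>\<^sup>+x. ennreal (mollifier e (x - y) * norm (f y)) \<partial>lborel) \<partial>lborel)"
    by (rule lborel_pair.Fubini') measurable
  also have "\<dots> = (\<integral>\<^sup>+y. ennreal (norm (f y)) \<partial>lborel)"
  proof (rule nn_integral_cong)
    fix y
    have "(\<integral>\<^sup>+x. ennreal (mollifier e (x - y) * norm (f y)) \<partial>lborel) =
       (\<integral>\<^sup>+x. ennreal (mollifier e (x - y)) * ennreal (norm (f y)) \<partial>lborel)"
      using mollifier_nonneg[OF e, where 'a='a] by (simp add: ennreal_mult)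
    also have "\<dots> = (\<integral>\<^sup>+x. ennreal (mollifier e (x - y)) \<partial>lborel) * ennreal (norm (f y))"
      by (rule nn_integral_multc) measurable
    also have "(\<integral>\<^sup>+x. ennreal (mollifier e (x - y)) \<partial>lborel) = ennreal (LINT x|lborel. mollifier e (x - y))"
      using integrable_translate[OF mollifier_integrable[OF e]] mollifier_nonneg[OF e, where 'a='a]
      by (intro nn_integral_eq_integral) auto
    also have "(LINT x|lborel. mollifier e (x - y)) = 1"
      by (subst integral_translate) (auto simp: mollifier_integral[OF e])
    finally show "(\<integral>\<^sup>+x. ennreal (mollifier e (x - y) * norm (f y)) \<partial>lborel) = ennreal (norm (f y))" by simp
  qed
  also have "\<dots> < \<infinity>" using f by (simp add: integrable_iff_bounded)
  finally show ?thesis by (intro integrableI_bounded) auto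
qed

text \<open>
  Young's inequality for the product of \<open>t\<close> and \<open>a\<^sup>p\<^sup>-\<^sup>1\<close>, rearranged.
\<close>

lemma powr_above_tangent:
  fixes p :: real assumes "1 < p" "0 \<le> t" "0 \<le> a"
  shows "a powr p + p * a powr (p - 1) * (t - a) \<le> t powr p"
proof -
  have q: "1 / p + 1 / (p / (p - 1)) = 1" using assms by (simp add: field_simps)
  have "t * a powr (p - 1) \<le> t powr p / p + (a powr (p - 1)) powr (p / (p - 1)) / (p / (p - 1))"
    by (rule Youngs_inequality[OF _ _ q]) (use assms in auto)
  also have "(a powr (p - 1)) powr (p / (p - 1)) = a powr p" using assms by (simp add: powr_powr)
  finally have "p * (t * a powr (p - 1)) \<le> t powr p + (p - 1) * a powr p"
    using assms by (simp add: field_simps)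
  moreover have "a powr (p - 1) * a = a powr p"
    using assms by (cases "a = 0") (auto simp: powr_diff)
  ultimately show ?thesis by (simp add: algebra_simps)
qed

text \<open>
  Jensen's inequality for the probability density given by the mollifier: the tangent inequality at the mean
  value \<open>a\<close> of \<open>|f|\<close>, integrated.
\<close>

lemma mollify_Jensen:
  fixes f :: "'a::euclidean_space \<Rightarrow> 'b::{banach,second_countable_topology}"
  assumes p: "1 < p" and e: "0 < e" and f: "integrable lborel f"
    and fp: "integrable lborel (\<lambda>x. norm (f x) powr p)"
  shows "norm (mollify e f x) powr p \<le> mollify e (\<lambda>x. norm (f x) powr p) x"
proof -
  define a where "a = (LINT y|lborel. mollifier e (x - y) * norm (f y))"
  have nf: "integrable lborel (\<lambda>y. norm (f y))" using f by simp
  have i1: "integrable lborel (\<lambda>y. mollifier e (x - y) * norm (f y))"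
    using mollify_integrand[OF nf] by simp
  have i2: "integrable lborel (\<lambda>y. mollifier e (x - y) * norm (f y) powr p)"
    using mollify_integrand[OF fp] by simp
  have i3: "integrable lborel (\<lambda>y. mollifier e (x - y))"
    using integrable_reflect[OF mollifier_integrable[OF e]] .
  have I3: "(LINT y|lborel. mollifier e (x - y)) = 1"
    by (subst integral_reflect) (auto simp: mollifier_integral[OF e])
  have m0: "0 \<le> mollifier e z" for z :: 'a by (rule mollifier_nonneg[OF e])
  have a0: "0 \<le> a" unfolding a_def by (intro integral_nonneg_AE) (simp add: m0)
  have "norm (mollify e f x) \<le> a"
    unfolding mollify_def a_def using integral_norm_bound[of lborel "\<lambda>y. mollifier e (x - y) *\<^sub>R f y"] m0
    by simp
  then have "norm (mollify e f x) powr p \<le> a powr p" using p by (intro powr_mono2) auto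
  also have "a powr p = (LINT y|lborel. (a powr p - p * a powr (p - 1) * a) * mollifier e (x - y) +
      (p * a powr (p - 1)) * (mollifier e (x - y) * norm (f y)))"
    using i1 i3 I3 by (simp add: a_def[symmetric])
  also have "\<dots> \<le> (LINT y|lborel. mollifier e (x - y) * norm (f y) powr p)"
  proof (rule integral_mono)
    fix y
    have "mollifier e (x - y) * (a powr p + p * a powr (p - 1) * (norm (f y) - a)) \<le> mollifier e (x - y) * norm (f y) powr p"
      by (intro mult_left_mono powr_above_tangent p a0 m0) simp
    then show "(a powr p - p * a powr (p - 1) * a) * mollifier e (x - y) +
      (p * a powr (p - 1)) * (mollifier e (x - y) * norm (f y)) \<le> mollifier e (x - y) * norm (f y) powr p"
      by (simp add: algebra_simps)
  qed (use i1 i2 i3 in auto)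
  finally show ?thesis by (simp add: mollify_def)
qed

lemma powr_add_le:
  fixes p :: real assumes "0 \<le> p" "0 \<le> a" "0 \<le> b"
  shows "(a + b) powr p \<le> 2 powr p * (a powr p + b powr p)"
proof -
  have "(a + b) powr p \<le> (2 * max a b) powr p" using assms by (intro powr_mono2) auto
  also have "\<dots> = 2 powr p * max a b powr p" using assms by (simp add: powr_mult)
  also have "max a b powr p \<le> a powr p + b powr p" by (auto simp: max_def)
  finally show ?thesis by simp
qed

text \<open>
  Convergence in \<open>L\<^sup>p\<close> is deduced from convergence in \<open>L\<^sup>1\<close>. Let \<open>P = |f|\<^sup>p\<close>. By Jensen's inequality the \<open>p\<close>-th
  power \<open>W\<close> of the error is at most \<open>2\<^sup>p\<close> times the sum of \<open>P\<close> and the mollified \<open>P\<close>. The part of \<open>W\<close> below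
  \<open>2 \<sqdot> 2\<^sup>p P\<close> tends to \<open>0\<close> by dominated convergence along a subsequence that converges almost everywhere;
  what exceeds it is at most \<open>Q\<close>, a multiple of the \<open>L\<^sup>1\<close> error for \<open>P\<close>.
\<close>

lemma mollify_Lp:
  fixes f :: "'a::euclidean_space \<Rightarrow> 'b::{banach,second_countable_topology}"
  assumes p: "1 < p" and f: "integrable lborel f"
    and fp: "integrable lborel (\<lambda>x. norm (f x) powr p)" and "0 < d" "0 < \<epsilon>"
  obtains e where "0 < e" "e < d" "integrable lborel (\<lambda>x. norm (mollify e f x - f x) powr p)"
    "(LINT x|lborel. norm (mollify e f x - f x) powr p) < \<epsilon>"
proof -
  let ?P = "\<lambda>x. norm (f x) powr p"
  have [measurable]: "f \<in> borel_measurable borel" using f by auto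
  define e0 where "e0 n = inverse (real (Suc n))" for n
  have e0: "e0 \<longlonglongrightarrow> 0" "0 < e0 n" for n
    unfolding e0_def by (rule LIMSEQ_inverse_real_of_nat) simp
  have "\<exists>r::nat\<Rightarrow>nat. strict_mono r \<and> (AE x in lborel. (\<lambda>n. mollify (e0 (r n)) f x - f x) \<longlonglongrightarrow> 0)"
    by (rule tendsto_L1_AE_subseq)
       (use mollify_L1_tendsto[OF f e0] mollify_integrable[OF f e0(2)] f in auto)
  then obtain r :: "nat \<Rightarrow> nat" where r: "strict_mono r"
    "AE x in lborel. (\<lambda>n. mollify (e0 (r n)) f x - f x) \<longlonglongrightarrow> 0" by blast
  define e where "e n = e0 (r n)" for n
  have e: "e \<longlonglongrightarrow> 0" "0 < e n" for n
    using LIMSEQ_subseq_LIMSEQ[OF e0(1) r(1)] e0(2) by (auto simp: e_def[abs_def] comp_def)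
  have lP: "(\<lambda>n. LINT x|lborel. norm (mollify (e n) ?P x - ?P x)) \<longlonglongrightarrow> 0"
    by (rule mollify_L1_tendsto[OF fp e])
  have iP: "integrable lborel (mollify (e n) ?P)" for n by (rule mollify_integrable[OF fp e(2)])
  define W where "W n x = norm (mollify (e n) f x - f x) powr p" for n x
  have [measurable]: "W n \<in> borel_measurable borel" for n unfolding W_def[abs_def] by measurable
  have W0: "0 \<le> W n x" for n x by (simp add: W_def)
  define Q where "Q n x = 2 powr p * norm (mollify (e n) ?P x - ?P x)" for n x
  have iQ: "integrable lborel (Q n)" for n unfolding Q_def[abs_def] using iP fp by simp
  have WQ: "W n x \<le> min (W n x) (2 * 2 powr p * ?P x) + Q n x" for n x
  proof -
    have "W n x \<le> (norm (mollify (e n) f x) + norm (f x)) powr p"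
      unfolding W_def using p by (intro powr_mono2 norm_triangle_ineq4) auto
    also have "\<dots> \<le> 2 powr p * (norm (mollify (e n) f x) powr p + ?P x)"
      using p by (intro powr_add_le) auto
    also have "\<dots> \<le> 2 powr p * (mollify (e n) ?P x + ?P x)"
      using mollify_Jensen[OF p e(2) f fp] by (intro mult_left_mono add_right_mono) auto
    also have "\<dots> \<le> 2 powr p * (2 * ?P x + norm (mollify (e n) ?P x - ?P x))"
      by (intro mult_left_mono) auto
    also have "\<dots> = 2 * 2 powr p * ?P x + Q n x" by (simp add: Q_def algebra_simps)
    finally have "W n x \<le> 2 * 2 powr p * ?P x + Q n x" .
    moreover have "0 \<le> Q n x" by (simp add: Q_def)
    ultimately show ?thesis by (simp add: min_def)
  qed
  have M0: "norm (min (W n x) (2 * 2 powr p * ?P x)) \<le> 2 * 2 powr p * ?P x" for n x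
    using W0[of n x] by (simp add: abs_of_nonneg)
  have iM: "integrable lborel (\<lambda>x. min (W n x) (2 * 2 powr p * ?P x))" for n
  proof (rule Bochner_Integration.integrable_bound)
    show "integrable lborel (\<lambda>x. 2 * 2 powr p * ?P x)" using fp by simp
    show "AE x in lborel. norm (min (W n x) (2 * 2 powr p * ?P x)) \<le> norm (2 * 2 powr p * ?P x)"
      using M0 by (intro AE_I2) simp
  qed measurable
  have lM: "(\<lambda>n. LINT x|lborel. min (W n x) (2 * 2 powr p * ?P x)) \<longlonglongrightarrow> (LINT x|(lborel::'a measure). 0)"
  proof (rule integral_dominated_convergence[where w="\<lambda>x. 2 * 2 powr p * ?P x"])
    show "AE x in lborel. (\<lambda>n. min (W n x) (2 * 2 powr p * ?P x)) \<longlonglongrightarrow> 0"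
      using r(2)
    proof eventually_elim
      case (elim x)
      have "(\<lambda>n. norm (mollify (e n) f x - f x)) \<longlonglongrightarrow> 0"
        using tendsto_norm_zero[OF elim] by (simp add: e_def)
      then have "(\<lambda>n. W n x) \<longlonglongrightarrow> 0"
        unfolding W_def using p by (intro tendsto_zero_powrI[where b=p]) auto
      then have "(\<lambda>n. min (W n x) (2 * 2 powr p * ?P x)) \<longlonglongrightarrow> min 0 (2 * 2 powr p * ?P x)"
        by (intro tendsto_intros)
      then show ?case by (simp add: min_def)
    qed
    show "AE x in lborel. norm (min (W n x) (2 * 2 powr p * ?P x)) \<le> 2 * 2 powr p * ?P x" for n
      using M0 by (intro AE_I2)
  qed (use fp in auto)
  have iW: "integrable lborel (W n)" for n
  proof (rule Bochner_Integration.integrable_bound)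
    show "integrable lborel (\<lambda>x. min (W n x) (2 * 2 powr p * ?P x) + Q n x)" using iM iQ by simp
    show "AE x in lborel. norm (W n x) \<le> norm (min (W n x) (2 * 2 powr p * ?P x) + Q n x)"
    proof (intro AE_I2)
      fix x show "norm (W n x) \<le> norm (min (W n x) (2 * 2 powr p * ?P x) + Q n x)"
        using W0[of n x] WQ[of n x] by simp
    qed
  qed measurable
  have lQ: "(\<lambda>n. LINT x|lborel. Q n x) \<longlonglongrightarrow> 2 powr p * 0"
    unfolding Q_def integral_mult_right_zero by (intro tendsto_mult tendsto_const lP)
  have "(\<lambda>n. (LINT x|lborel. min (W n x) (2 * 2 powr p * ?P x)) + (LINT x|lborel. Q n x)) \<longlonglongrightarrow> 0 + 0"
    using lM lQ by (intro tendsto_add) auto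
  from order_tendstoD(2)[OF this, of \<epsilon>] order_tendstoD(2)[OF e(1) \<open>0 < d\<close>] \<open>0 < \<epsilon>\<close>
  have "\<forall>\<^sub>F n in sequentially. e n < d \<and>
     (LINT x|lborel. min (W n x) (2 * 2 powr p * ?P x)) + (LINT x|lborel. Q n x) < \<epsilon>"
    by (auto intro: eventually_conj)
  then obtain n where n: "e n < d"
     "(LINT x|lborel. min (W n x) (2 * 2 powr p * ?P x)) + (LINT x|lborel. Q n x) < \<epsilon>"
    by (auto simp: eventually_sequentially)
  have "(LINT x|lborel. W n x) \<le> (LINT x|lborel. min (W n x) (2 * 2 powr p * ?P x) + Q n x)"
    using iW iM iQ WQ by (intro integral_mono) auto
  also have "\<dots> < \<epsilon>" using n(2) iM iQ by simp
  finally show ?thesis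
    using that[of "e n"] e(2) n(1) iW[of n] by (simp add: W_def[abs_def])
qed

section \<open>Weak gradients\<close>

text \<open>
  Tonelli's theorem is applied to \<open>lborel\<close>; Lebesgue measurable functions enter through such representatives.
\<close>

lemma borel_version:
  fixes f :: "'a::euclidean_space \<Rightarrow> 'b::euclidean_space"
  assumes f: "f \<in> borel_measurable lebesgue"
  obtains f' where "f' \<in> borel_measurable borel" "AE x in lborel. f x = f' x"
proof -
  have "\<forall>i. \<exists>h\<in>borel_measurable lborel. AE x in lborel. f x \<bullet> i = h x"
    using f by (intro allI completion_ex_borel_measurable_real) auto
  then obtain h where h: "\<And>i. h i \<in> borel_measurable lborel" "\<And>i. AE x in lborel. f x \<bullet> i = h i x"
    by metis
  have [measurable]: "h i \<in> borel_measurable borel" for i using h(1) by simp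
  show ?thesis
  proof
    show "(\<lambda>x. \<Sum>i\<in>Basis. h i x *\<^sub>R i) \<in> borel_measurable borel" by measurable
    have "AE x in lborel. \<forall>i\<in>Basis. f x \<bullet> i = h i x"
      by (rule AE_finite_allI) (use h in auto)
    then show "AE x in lborel. f x = (\<Sum>i\<in>Basis. h i x *\<^sub>R i)"
    proof eventually_elim
      case (elim x)
      then have "(\<Sum>i\<in>Basis. h i x *\<^sub>R i) = (\<Sum>i\<in>Basis. (f x \<bullet> i) *\<^sub>R i)" by simp
      then show ?case by (simp add: euclidean_representation)
    qed
  qed
qed

lemma AE_lebesgue_iff: "(AE x in lebesgue. P x) \<longleftrightarrow> (AE x in lborel. P x)"
  by (rule AE_completion_iff)

lemma integrable_lebesgue_lborel:
  fixes f :: "'a::euclidean_space \<Rightarrow> 'b::euclidean_space"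
  assumes [measurable]: "f \<in> borel_measurable borel" "h \<in> borel_measurable lebesgue"
    and "AE x in lborel. h x = f x"
  shows "integrable lebesgue h \<longleftrightarrow> integrable lborel f" "integral\<^sup>L lebesgue h = integral\<^sup>L lborel f"
proof -
  have [measurable]: "f \<in> borel_measurable lebesgue" by (rule measurable_completion) simp
  have ae: "AE x in lebesgue. h x = f x" using assms(3) by (simp add: AE_lebesgue_iff)
  have "integrable lebesgue h \<longleftrightarrow> integrable lebesgue f"
    by (rule integrable_cong_AE) (use ae in auto)
  also have "\<dots> \<longleftrightarrow> integrable lborel f" by (rule integrable_completion) simp
  finally show "integrable lebesgue h \<longleftrightarrow> integrable lborel f" .
  have "integral\<^sup>L lebesgue h = integral\<^sup>L lebesgue f"
    by (rule integral_cong_AE) (use ae in auto)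
  also have "\<dots> = integral\<^sup>L lborel f" by (rule integral_completion) simp
  finally show "integral\<^sup>L lebesgue h = integral\<^sup>L lborel f" .
qed

lemma Lp_loc_borel_restriction:
  fixes u :: "'a::euclidean_space \<Rightarrow> 'b::euclidean_space"
  assumes u: "Lp_loc q S u" and K: "compact K" "K \<subseteq> S" and "0 < q"
  obtains u0 where "u0 \<in> borel_measurable borel" "\<And>x. x \<notin> K \<Longrightarrow> u0 x = 0"
    "AE x in lborel. x \<in> K \<longrightarrow> u0 x = u x" "integrable lborel (\<lambda>x. norm (u0 x) powr q)"
proof -
  have [measurable]: "K \<in> sets borel" using K by (simp add: compact_imp_closed)
  have [measurable]: "K \<in> sets lebesgue" using K by (simp add: lmeasurable_compact fmeasurableD)
  have [measurable]: "(\<lambda>x. indicator S x *\<^sub>R u x) \<in> borel_measurable lebesgue"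
    using u by (simp add: Lp_loc_def set_borel_measurable_def)
  have "(\<lambda>x. indicator K x *\<^sub>R (indicator S x *\<^sub>R u x)) \<in> borel_measurable lebesgue"
    by measurable
  also have "(\<lambda>x. indicator K x *\<^sub>R (indicator S x *\<^sub>R u x)) = (\<lambda>x. indicator K x *\<^sub>R u x)"
    using K(2) by (auto simp: indicator_def fun_eq_iff)
  finally have m[measurable]: "(\<lambda>x. indicator K x *\<^sub>R u x) \<in> borel_measurable lebesgue" .
  from borel_version[OF m] obtain f' where [measurable]: "f' \<in> borel_measurable borel"
    and f': "AE x in lborel. indicator K x *\<^sub>R u x = f' x" by metis
  show ?thesis
  proof (rule that[of "\<lambda>x. indicator K x *\<^sub>R f' x"])
    show "AE x in lborel. x \<in> K \<longrightarrow> indicator K x *\<^sub>R f' x = u x"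
      using f' by eventually_elim auto
    have "integrable lebesgue (\<lambda>x. norm (indicator K x *\<^sub>R u x) powr q) \<longleftrightarrow>
      integrable lborel (\<lambda>x. norm (indicator K x *\<^sub>R f' x) powr q)"
    proof (rule integrable_lebesgue_lborel(1))
      show "AE x in lborel. norm (indicator K x *\<^sub>R u x) powr q = norm (indicator K x *\<^sub>R f' x) powr q"
        using f' by eventually_elim (auto simp: indicator_def)
    qed measurable
    moreover have "(\<lambda>x. norm (indicator K x *\<^sub>R u x) powr q) = (\<lambda>x. indicator K x *\<^sub>R (norm (u x) powr q))"
      using \<open>0 < q\<close> by (auto simp: fun_eq_iff indicator_def)
    moreover have "set_integrable lebesgue K (\<lambda>x. norm (u x) powr q)"
      using u K by (auto simp: Lp_loc_def)
    ultimately show "integrable lborel (\<lambda>x. norm (indicator K x *\<^sub>R f' x) powr q)"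
      by (simp add: set_integrable_def)
  qed auto
qed

text \<open>
  The weak gradient identity for Borel representatives, which have to agree with \<open>u\<close> and \<open>g\<close> only on a closed set
  that contains the support of the test function.
\<close>

lemma weak_gradient_identity:
  assumes wg: "is_weak_gradient S u g" and phi: "\<phi> \<in> Cc_infinity S" "C1_grad \<phi> D"
    and K: "closed K" "\<And>x. x \<notin> K \<Longrightarrow> \<phi> x = 0" "K \<subseteq> S"
    and [measurable]: "u0 \<in> borel_measurable borel" "g0 \<in> borel_measurable borel"
    and u0: "AE x in lborel. x \<in> K \<longrightarrow> u0 x = u x"
    and g0: "AE x in lborel. x \<in> K \<longrightarrow> g0 x = g x" and i: "i \<in> Basis"
  shows "(LINT x|lborel. u0 x * (D x \<bullet> i)) = - (LINT x|lborel. (g0 x \<bullet> i) * \<phi> x)"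
proof -
  note [measurable] = C1_grad_measurable[OF phi(2)]
  have [measurable]: "\<phi> \<in> borel_measurable lebesgue" "D \<in> borel_measurable lebesgue"
    by (rule measurable_completion; simp)+
  have D0: "D x = 0" if "x \<notin> K" for x by (rule C1_grad_support[OF phi(2) K(1,2) that])
  have [measurable]: "(\<lambda>x. indicator S x *\<^sub>R u x) \<in> borel_measurable lebesgue"
    "(\<lambda>x. indicator S x *\<^sub>R g x) \<in> borel_measurable lebesgue"
    using wg by (auto simp: is_weak_gradient_def Lp_loc_def set_borel_measurable_def)
  have e1: "(\<lambda>x. indicator S x *\<^sub>R (u x * frechet_derivative \<phi> (at x) i)) =
      (\<lambda>x. (indicator S x *\<^sub>R u x) * (D x \<bullet> i))"
    by (simp add: C1_grad_frechet_derivative[OF phi(2)] fun_eq_iff)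
  have e2: "(\<lambda>x. indicator S x *\<^sub>R ((g x \<bullet> i) * \<phi> x)) = (\<lambda>x. ((indicator S x *\<^sub>R g x) \<bullet> i) * \<phi> x)"
    by (simp add: fun_eq_iff)
  have "(LINT x:S|lebesgue. u x * frechet_derivative \<phi> (at x) i) = (LINT x|lborel. u0 x * (D x \<bullet> i))"
    unfolding set_lebesgue_integral_def e1
  proof (rule integrable_lebesgue_lborel(2))
    show "AE x in lborel. indicator S x *\<^sub>R u x * (D x \<bullet> i) = u0 x * (D x \<bullet> i)"
      using u0
    proof eventually_elim
      case (elim x)
      then show ?case using K(3) D0[of x] by (cases "x \<in> K") auto
    qed
  qed measurable
  moreover have "(LINT x:S|lebesgue. (g x \<bullet> i) * \<phi> x) = (LINT x|lborel. (g0 x \<bullet> i) * \<phi> x)"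
    unfolding set_lebesgue_integral_def e2
  proof (rule integrable_lebesgue_lborel(2))
    show "AE x in lborel. ((indicator S x *\<^sub>R g x) \<bullet> i) * \<phi> x = (g0 x \<bullet> i) * \<phi> x"
      using g0
    proof eventually_elim
      case (elim x)
      then show ?case using K(2)[of x] K(3) by (cases "x \<in> K") auto
    qed
  qed measurable
  moreover have "(LINT x:S|lebesgue. u x * frechet_derivative \<phi> (at x) i) =
        - (LINT x:S|lebesgue. (g x \<bullet> i) * \<phi> x)"
    using wg phi(1) i by (simp add: is_weak_gradient_def)
  ultimately show ?thesis by simp
qed

lemma mollify_inner:
  fixes f :: "'a::euclidean_space \<Rightarrow> 'b::euclidean_space"
  assumes "integrable lborel f"
  shows "mollify e f x \<bullet> i = (LINT y|lborel. (f y \<bullet> i) * mollifier e (x - y))"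
  using integral_inner_left[of i lborel "\<lambda>y. mollifier e (x - y) *\<^sub>R f y"] mollify_integrand[OF assms, of e x]
  by (simp add: mollify_def mult.commute)

text \<open>
  The fundamental lemma of the calculus of variations: mollifications converge to the function in \<open>L\<^sup>1\<close>.
\<close>

lemma mollify_eq_zero_imp_AE_zero:
  fixes w :: "'a::euclidean_space \<Rightarrow> 'b::euclidean_space"
  assumes w: "integrable lborel w" and [measurable]: "B \<in> sets borel" and "0 < \<rho>"
    and z: "\<And>e x. 0 < e \<Longrightarrow> e < \<rho> \<Longrightarrow> x \<in> B \<Longrightarrow> mollify e w x = 0"
  shows "AE x in lborel. x \<in> B \<longrightarrow> w x = 0"
proof -
  have iB: "integrable lborel (\<lambda>x. indicator B x * norm (w x))"
    using integrable_bounded_scaleR[OF integrable_norm[OF w], of "indicator B" 1] by simp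
  have "(LINT x|lborel. indicator B x * norm (w x)) \<le> \<epsilon>" if eps: "0 < \<epsilon>" for \<epsilon>
  proof -
    obtain d where d: "0 < d" "\<And>e. 0 < e \<Longrightarrow> e < d \<Longrightarrow>
      integrable lborel (\<lambda>x. mollify e w x - w x) \<and> (LINT x|lborel. norm (mollify e w x - w x)) \<le> \<epsilon>"
      using mollify_L1[OF w eps] by metis
    define e where "e = min d \<rho> / 2"
    have e: "0 < e" "e < d" "e < \<rho>" using d(1) \<open>0 < \<rho>\<close> by (auto simp: e_def)
    have "(LINT x|lborel. indicator B x * norm (w x)) \<le> (LINT x|lborel. norm (mollify e w x - w x))"
      by (rule integral_mono)
         (use iB d(2)[OF e(1,2)] z[OF e(1,3)] in \<open>auto simp: indicator_def\<close>)
    then show ?thesis using d(2)[OF e(1,2)] by simp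
  qed
  then have "(LINT x|lborel. indicator B x * norm (w x)) \<le> 0" by (rule dense_ge)
  moreover have "0 \<le> (LINT x|lborel. indicator B x * norm (w x))" by simp
  ultimately have "(LINT x|lborel. indicator B x * norm (w x)) = 0" by simp
  then have "AE x in lborel. indicator B x * norm (w x) = 0"
    using integral_nonneg_eq_0_iff_AE[OF iB] by simp
  then show ?thesis by eventually_elim (auto simp: indicator_def split: if_splits)
qed

lemma integrable_powr_1:
  fixes u0 :: "'a \<Rightarrow> 'b::euclidean_space"
  assumes "integrable M (\<lambda>x. norm (u0 x) powr 1)" "u0 \<in> borel_measurable M"
  shows "integrable M u0"
  using assms by (simp add: integrable_norm_iff)

text \<open>
  Mollifiers of small radius centred in the smaller ball are admissible test functions, so the mollified
  difference of the two gradients vanishes there.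
\<close>

lemma weak_gradient_unique_ball:
  assumes 1: "is_weak_gradient S u g1" and 2: "is_weak_gradient S u g2"
    and ab: "0 < a" "a < b" "cball c b \<subseteq> S"
  shows "AE x in lborel. x \<in> ball c a \<longrightarrow> g1 x = g2 x"
proof -
  let ?K = "cball c b"
  have L: "Lp_loc 1 S u" "Lp_loc 1 S g1" "Lp_loc 1 S g2"
    using 1 2 by (auto simp: is_weak_gradient_def)
  obtain u0 where u0: "u0 \<in> borel_measurable borel" "\<And>x. x \<notin> ?K \<Longrightarrow> u0 x = 0"
    "AE x in lborel. x \<in> ?K \<longrightarrow> u0 x = u x" "integrable lborel (\<lambda>x. norm (u0 x) powr 1)"
    by (rule Lp_loc_borel_restriction[OF L(1) compact_cball ab(3) zero_less_one]) blast
  obtain h1 where h1: "h1 \<in> borel_measurable borel" "\<And>x. x \<notin> ?K \<Longrightarrow> h1 x = 0"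
    "AE x in lborel. x \<in> ?K \<longrightarrow> h1 x = g1 x" "integrable lborel (\<lambda>x. norm (h1 x) powr 1)"
    by (rule Lp_loc_borel_restriction[OF L(2) compact_cball ab(3) zero_less_one]) blast
  obtain h2 where h2: "h2 \<in> borel_measurable borel" "\<And>x. x \<notin> ?K \<Longrightarrow> h2 x = 0"
    "AE x in lborel. x \<in> ?K \<longrightarrow> h2 x = g2 x" "integrable lborel (\<lambda>x. norm (h2 x) powr 1)"
    by (rule Lp_loc_borel_restriction[OF L(3) compact_cball ab(3) zero_less_one]) blast
  have i: "integrable lborel h1" "integrable lborel h2"
    using h1 h2 by (auto intro: integrable_powr_1)
  have "AE x in lborel. x \<in> ball c a \<longrightarrow> h1 x - h2 x = 0"
  proof (rule mollify_eq_zero_imp_AE_zero)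
    show "integrable lborel (\<lambda>x. h1 x - h2 x)" using i by simp
    show "0 < b - a" using ab by simp
    fix e x assume e: "0 < e" "e < b - a" and x: "x \<in> ball c a"
    have sub: "cball x e \<subseteq> ?K"
      using e x by (intro subset_trans[OF cball_subset_cball_iff[THEN iffD2] order_refl]) (auto simp: dist_commute)
    have Cc: "(\<lambda>y. mollifier e (x - y)) \<in> Cc_infinity S"
      by (rule mollifier_Cc_infinity) (use e sub ab in auto)
    obtain D where D: "C1_grad (\<lambda>y. mollifier e (x - y)) D"
      using Cc Cc_infinity_C1_grad by blast
    have z: "mollifier e (x - y) = 0" if "y \<notin> ?K" for y
      using that sub e by (intro mollifier_support) auto
    have "mollify e (\<lambda>x. h1 x - h2 x) x = 0"
    proof (rule euclidean_eqI)
      fix i :: 'a assume "i \<in> Basis"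
      note id = weak_gradient_identity[OF _ Cc D closed_cball _ ab(3) u0(1) _ u0(3) _ this]
      have "(LINT y|lborel. (h1 y \<bullet> i) * mollifier e (x - y)) = (LINT y|lborel. (h2 y \<bullet> i) * mollifier e (x - y))"
        using id[OF 1 z h1(1,3)] id[OF 2 z h2(1,3)] by simp
      then have "mollify e h1 x \<bullet> i = mollify e h2 x \<bullet> i"
        by (simp add: mollify_inner[OF i(1)] mollify_inner[OF i(2)])
      moreover have "mollify e (\<lambda>x. h1 x - h2 x) x = mollify e h1 x - mollify e h2 x"
        using mollify_integrand[OF i(1)] mollify_integrand[OF i(2)]
        by (simp add: mollify_def scaleR_diff_right)
      ultimately show "mollify e (\<lambda>x. h1 x - h2 x) x \<bullet> i = 0 \<bullet> i"
        by (simp add: inner_diff_left)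
    qed
    then show "mollify e (\<lambda>x. h1 x - h2 x) x = 0" .
  qed auto
  with h1(3) h2(3) show ?thesis
    by eventually_elim (use ab in auto)
qed

text \<open>
  An open set is a countable union of balls that have a larger concentric closed ball in it.
\<close>

lemma weak_gradient_unique:
  assumes 1: "is_weak_gradient S u g1" and 2: "is_weak_gradient S u g2" and S: "open S"
  shows "AE x in lborel. x \<in> S \<longrightarrow> g1 x = g2 x"
proof -
  define F where "F = {B. \<exists>c a b. B = ball c a \<and> 0 < a \<and> a < b \<and> cball c b \<subseteq> S}"
  obtain F' where F': "F' \<subseteq> F" "countable F'" "\<Union>F' = \<Union>F"
    by (rule Lindelof[of F]) (auto simp: F_def)
  have "S \<subseteq> \<Union>F"
  proof
    fix x assume "x \<in> S"
    then obtain b where "0 < b" "cball x b \<subseteq> S" using S open_contains_cball by blast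
    then have "ball x (b/2) \<in> F" unfolding F_def by (intro CollectI exI[of _ x] exI[of _ "b/2"] exI[of _ b]) auto
    with \<open>0 < b\<close> show "x \<in> \<Union>F" by (intro UnionI[of "ball x (b/2)"]) auto
  qed
  have "AE x in lborel. \<forall>B\<in>F'. x \<in> B \<longrightarrow> g1 x = g2 x"
    unfolding AE_ball_countable[OF F'(2)]
  proof
    fix B assume "B \<in> F'"
    then obtain c a b where "B = ball c a" "0 < a" "a < b" "cball c b \<subseteq> S" using F'(1) by (auto simp: F_def)
    then show "AE x in lborel. x \<in> B \<longrightarrow> g1 x = g2 x" using weak_gradient_unique_ball[OF 1 2] by auto
  qed
  then show ?thesis
    by eventually_elim (use \<open>S \<subseteq> \<Union>F\<close> F'(3) in blast)
qed

text \<open>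
  What is known about one weak gradient holds, almost everywhere, for the one selected by
  \<open>weak_gradient\<close>.
\<close>

lemma weak_gradient_represents:
  assumes "is_weak_gradient S u g" "open S"
  shows "is_weak_gradient S u (weak_gradient S u)"
    "AE x in lborel. x \<in> S \<longrightarrow> weak_gradient S u x = g x"
proof -
  show w: "is_weak_gradient S u (weak_gradient S u)"
    using someI[of "is_weak_gradient S u", OF assms(1)] by (simp add: weak_gradient_def)
  show "AE x in lborel. x \<in> S \<longrightarrow> weak_gradient S u x = g x"
    by (rule weak_gradient_unique[OF w assms])
qed

lemma mollify_C1_grad:
  fixes f :: "'a::euclidean_space \<Rightarrow> real"
  assumes "C1_grad (mollifier e) D" "0 < e" "integrable lborel f"
  shows "C1_grad (mollify e f) (\<lambda>x. LINT y|lborel. f y *\<^sub>R D (x - y))"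
  using convolution_C1_grad[OF assms(1) compact_cball[of 0 e] mollifier_support(1)[OF assms(2)] assms(3)]
  by (simp add: mollify_def[abs_def])

text \<open>
  The hypothesis is the weak gradient identity for the test function \<open>y \<mapsto> mollifier e (x - y)\<close>, whose gradient
  is \<open>- D (x - y)\<close>; it moves the derivative from the kernel to \<open>f\<close>.
\<close>

lemma mollify_gradient_eq:
  fixes f :: "'a::euclidean_space \<Rightarrow> real"
  assumes D: "C1_grad (mollifier e) D" and "0 < e" and f: "integrable lborel f" and g: "integrable lborel g"
    and id: "\<And>i. i \<in> Basis \<Longrightarrow> (LINT y|lborel. f y * (- D (x - y) \<bullet> i)) =
        - (LINT y|lborel. (g y \<bullet> i) * mollifier e (x - y))"
  shows "(LINT y|lborel. f y *\<^sub>R D (x - y)) = mollify e g x"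
proof (rule euclidean_eqI)
  fix i :: 'a assume i: "i \<in> Basis"
  have DK: "D x = 0" if "x \<notin> cball 0 e" for x
    by (rule C1_grad_support[OF D closed_cball _ that]) (rule mollifier_support[OF \<open>0 < e\<close>])
  have cD: "continuous_on UNIV D" using D by (simp add: C1_grad_def)
  note [measurable] = C1_grad_measurable[OF D]
  obtain B' where B': "\<And>x. norm (D x) \<le> B'"
    using bounded_of_compact_support[OF cD compact_cball DK] by metis
  have "integrable lborel (\<lambda>y. f y *\<^sub>R D (x - y))"
    by (rule integrable_scaleR_bounded[OF f, of _ B']) (use B' in auto)
  with integral_inner_left[of i lborel "\<lambda>y. f y *\<^sub>R D (x - y)"]
  have "(LINT y|lborel. f y *\<^sub>R D (x - y)) \<bullet> i = (LINT y|lborel. f y * (D (x - y) \<bullet> i))" by simp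
  also have "\<dots> = (LINT y|lborel. (g y \<bullet> i) * mollifier e (x - y))" using id[OF i] by simp
  finally show "(LINT y|lborel. f y *\<^sub>R D (x - y)) \<bullet> i = mollify e g x \<bullet> i"
    by (simp add: mollify_inner[OF g])
qed

text \<open>
  The functions \<open>U n\<close> with gradients \<open>G n\<close> approximate \<open>u0\<close> almost everywhere and \<open>g0\<close> in \<open>L\<^sup>1\<close> of the set \<open>B\<close>.
  Nonnegativity is part of the notion because \<open>U n\<close> is composed with functions that are regular on the half line
  only, namely \<open>(t + d)\<^sup>1\<^sup>-\<^sup>p\<close> and \<open>ln (t + d)\<close>.
\<close>

definition C1_approx ::
    "'a::euclidean_space set \<Rightarrow> ('a \<Rightarrow> real) \<Rightarrow> ('a \<Rightarrow> 'a) \<Rightarrow>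
     (nat \<Rightarrow> 'a \<Rightarrow> real) \<Rightarrow> (nat \<Rightarrow> 'a \<Rightarrow> 'a) \<Rightarrow> bool" where
  "C1_approx B u0 g0 U G \<longleftrightarrow> (\<forall>n::nat. C1_grad (U n) (G n)) \<and>
     (AE x in lborel. (\<lambda>n. U n x) \<longlonglongrightarrow> u0 x) \<and>
     (\<forall>n. integrable lborel (\<lambda>x. indicator B x *\<^sub>R (G n x - g0 x))) \<and>
     (\<lambda>n. LINT x|lborel. indicator B x * norm (G n x - g0 x)) \<longlonglongrightarrow> 0 \<and>
     ((\<forall>x. 0 \<le> u0 x) \<longrightarrow> (\<forall>n x. 0 \<le> U n x))"

text \<open>
  The mollification of \<open>u0\<close> has gradient the mollification of \<open>g0\<close> at all points of the smaller ball, once the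
  radius of the mollifier is at most \<open>b - a\<close>.
\<close>

lemma weak_gradient_C1_approx:
  assumes wg: "is_weak_gradient S u g" and ab: "a < b" "cball c b \<subseteq> S"
    and u0: "integrable lborel u0" "AE x in lborel. x \<in> cball c b \<longrightarrow> u0 x = u x"
    and g0: "integrable lborel g0" "AE x in lborel. x \<in> cball c b \<longrightarrow> g0 x = g x"
  obtains U G where "C1_approx (cball c a) u0 g0 U G"
proof -
  have [measurable]: "u0 \<in> borel_measurable borel" "g0 \<in> borel_measurable borel" using u0(1) g0(1) by auto
  define e0 where "e0 n = (b - a) * inverse (real (Suc n))" for n
  have e0: "e0 \<longlonglongrightarrow> 0" "0 < e0 n" "e0 n \<le> b - a" for n
  proof -
    have "(\<lambda>n. (b - a) * inverse (real (Suc n))) \<longlonglongrightarrow> (b - a) * 0"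
      by (intro tendsto_mult tendsto_const LIMSEQ_inverse_real_of_nat)
    then show "e0 \<longlonglongrightarrow> 0" by (simp add: e0_def[abs_def])
    show "0 < e0 n" using ab by (simp add: e0_def)
    have "(b - a) * inverse (real (Suc n)) \<le> (b - a) * 1"
      using ab by (intro mult_left_mono) (auto simp: inverse_eq_divide)
    then show "e0 n \<le> b - a" by (simp add: e0_def)
  qed
  have "\<exists>r::nat\<Rightarrow>nat. strict_mono r \<and> (AE x in lborel. (\<lambda>n. mollify (e0 (r n)) u0 x - u0 x) \<longlonglongrightarrow> 0)"
    by (rule tendsto_L1_AE_subseq)
       (use mollify_L1_tendsto[OF u0(1) e0(1,2)] mollify_integrable[OF u0(1) e0(2)] u0(1) in auto)
  then obtain r :: "nat \<Rightarrow> nat" where r: "strict_mono r"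
    "AE x in lborel. (\<lambda>n. mollify (e0 (r n)) u0 x - u0 x) \<longlonglongrightarrow> 0" by blast
  define e where "e n = e0 (r n)" for n
  have e: "e \<longlonglongrightarrow> 0" "0 < e n" "e n \<le> b - a" for n
    using LIMSEQ_subseq_LIMSEQ[OF e0(1) r(1)] e0(2,3) by (auto simp: e_def[abs_def] comp_def)
  have "\<forall>n. \<exists>D. C1_grad (mollifier (e n) :: 'a \<Rightarrow> real) D" using mollifier_C1_grad by metis
  then obtain D where D: "\<And>n. C1_grad (mollifier (e n) :: 'a \<Rightarrow> real) (D n)" by metis
  define G where "G n x = (LINT y|lborel. u0 y *\<^sub>R D n (x - y))" for n x
  have C: "C1_grad (mollify (e n) u0) (G n)" for n
    unfolding G_def[abs_def] by (rule mollify_C1_grad[OF D e(2) u0(1)])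
  have G: "G n x = mollify (e n) g0 x" if x: "x \<in> cball c a" for n x
    unfolding G_def
  proof (rule mollify_gradient_eq[OF D e(2) u0(1) g0(1)])
    fix i :: 'a assume i: "i \<in> Basis"
    have sub: "cball x (e n) \<subseteq> cball c b"
      using e(3)[of n] x by (auto simp: cball_subset_cball_iff dist_commute)
    show "(LINT y|lborel. u0 y * (- D n (x - y) \<bullet> i)) = - (LINT y|lborel. (g0 y \<bullet> i) * mollifier (e n) (x - y))"
    proof (rule weak_gradient_identity[OF wg _ C1_grad_reflect[OF D] closed_cball _ ab(2) _ _ u0(2) g0(2) i])
      show "(\<lambda>y. mollifier (e n) (x - y)) \<in> Cc_infinity S"
        by (rule mollifier_Cc_infinity) (use e(2) sub ab in auto)
      show "mollifier (e n) (x - y) = 0" if "y \<notin> cball c b" for y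
        using that sub e(2) by (intro mollifier_support) auto
    qed auto
  qed
  have i: "integrable lborel (\<lambda>x. mollify (e n) g0 x - g0 x)" for n
    using mollify_integrable[OF g0(1) e(2)] g0(1) by simp
  have eq: "(\<lambda>x. indicator (cball c a) x *\<^sub>R (G n x - g0 x)) =
     (\<lambda>x. indicator (cball c a) x *\<^sub>R (mollify (e n) g0 x - g0 x))" for n
    using G by (auto simp: indicator_def fun_eq_iff)
  have i1: "integrable lborel (\<lambda>x. indicator (cball c a) x *\<^sub>R (G n x - g0 x))" for n
    unfolding eq by (rule integrable_bounded_scaleR[OF i, of _ 1]) (auto simp: indicator_def[abs_def])
  have "(\<lambda>n. LINT x|lborel. indicator (cball c a) x * norm (G n x - g0 x)) \<longlonglongrightarrow> 0"
  proof (rule tendsto_sandwich[OF _ _ tendsto_const mollify_L1_tendsto[OF g0(1) e(1,2)]])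
    show "\<forall>\<^sub>F n in sequentially. 0 \<le> (LINT x|lborel. indicator (cball c a) x * norm (G n x - g0 x))"
      by (auto intro!: always_eventually integral_nonneg_AE)
    show "\<forall>\<^sub>F n in sequentially. (LINT x|lborel. indicator (cball c a) x * norm (G n x - g0 x))
      \<le> (LINT x|lborel. norm (mollify (e n) g0 x - g0 x))"
    proof (intro always_eventually allI integral_mono')
      show "integrable lborel (\<lambda>x. norm (mollify (e n) g0 x - g0 x))" for n using i by simp
      show "indicator (cball c a) x * norm (G n x - g0 x) \<le> norm (mollify (e n) g0 x - g0 x)" for n x
        using G[of x n] by (auto simp: indicator_def)
    qed auto
  qed
  moreover have "AE x in lborel. (\<lambda>n. mollify (e n) u0 x) \<longlonglongrightarrow> u0 x"
    using r(2) by eventually_elim (simp add: e_def LIM_zero_iff)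
  moreover have "0 \<le> mollify (e n) u0 x" if "\<forall>x. 0 \<le> u0 x" for n x
    unfolding mollify_def using that mollifier_nonneg[OF e(2), where 'a='a]
    by (intro integral_nonneg_AE) auto
  ultimately show ?thesis
    using C i1 by (intro that[of "\<lambda>n. mollify (e n) u0" G]) (auto simp: C1_approx_def)
qed

section \<open>Chain rule and Sobolev functions with zero boundary values\<close>

lemma C1_grad_compose:
  assumes U: "C1_grad U G" "\<And>x. 0 \<le> U x"
    and H: "\<And>t. 0 \<le> t \<Longrightarrow> (H has_real_derivative H' t) (at t)" "continuous_on {0..} H'"
  shows "C1_grad (\<lambda>x. H (U x)) (\<lambda>x. H' (U x) *\<^sub>R G x)"
proof -
  have "((\<lambda>x. H (U x)) has_derivative (\<lambda>h. (H' (U x) *\<^sub>R G x) \<bullet> h)) (at x)" for x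
  proof -
    have "(U has_derivative (\<lambda>h. G x \<bullet> h)) (at x)" using U(1) by (simp add: C1_grad_def)
    moreover have "(H has_derivative (\<lambda>h. H' (U x) * h)) (at (U x))"
      using H(1)[OF U(2)] by (simp add: has_field_derivative_def)
    ultimately show ?thesis by (rule has_derivative_eq_rhs[OF has_derivative_compose]) simp
  qed
  moreover have "continuous_on UNIV (\<lambda>x. H' (U x) *\<^sub>R G x)"
    using U(2) C1_grad_continuous[OF U(1)] U(1)
    by (intro continuous_on_scaleR continuous_on_compose2[OF H(2)]) (auto simp: C1_grad_def)
  ultimately show ?thesis by (simp add: C1_grad_def)
qed

lemma tendsto_compose_nonneg:
  fixes H' :: "real \<Rightarrow> real"
  assumes "continuous_on {0..} H'" "X \<longlonglongrightarrow> t" "\<And>n. 0 \<le> X n"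
  shows "(\<lambda>n. H' (X n)) \<longlonglongrightarrow> H' t"
proof -
  have "0 \<le> t" using assms(2,3) by (intro LIMSEQ_le_const) auto
  then show ?thesis
    using continuous_on_tendsto_compose[OF assms(1,2)] assms(3) by auto
qed

lemma measurable_compose_nonneg:
  fixes H' :: "real \<Rightarrow> real"
  assumes H: "continuous_on {0..} H'" and [measurable]: "U \<in> borel_measurable borel" and "\<And>x. 0 \<le> U x"
  shows "(\<lambda>x. H' (U x)) \<in> borel_measurable borel"
proof -
  have [measurable]: "(\<lambda>t. indicator {0..} t *\<^sub>R H' t) \<in> borel_measurable borel"
    by (rule borel_measurable_continuous_on_indicator) (use H in auto)
  have "(\<lambda>x. indicator {0..} (U x) *\<^sub>R H' (U x)) \<in> borel_measurable borel" by measurable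
  with assms(3) show ?thesis by simp
qed

text \<open>
  For \<open>U n\<close> in place of \<open>u0\<close> this is integration by parts for a continuously differentiable function. In the limit, the
  terms without \<open>G n - g0\<close> converge by dominated convergence, and the remaining term is bounded by the \<open>L\<^sup>1\<close>
  distance of the gradients because \<open>\<theta>\<close> and \<open>H'\<close> are bounded.
\<close>

lemma chain_rule_limit:
  fixes B :: "'a::euclidean_space set"
  assumes ap: "C1_approx B u0 g0 U G" and B[measurable]: "B \<in> sets borel"
    and u0: "u0 \<in> borel_measurable borel" "\<And>x. 0 \<le> u0 x" and g0: "integrable lborel g0"
    and H: "\<And>t. 0 \<le> t \<Longrightarrow> (H has_real_derivative H' t) (at t)" "continuous_on {0..} H'"
    and M: "\<And>t. 0 \<le> t \<Longrightarrow> \<bar>H t\<bar> \<le> M" "\<And>t. 0 \<le> t \<Longrightarrow> \<bar>H' t\<bar> \<le> M"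
    and theta: "C1_grad \<theta> D" and K: "compact K" "K \<subseteq> B" "\<And>x. x \<notin> K \<Longrightarrow> \<theta> x = 0"
  shows "(LINT x|lborel. H (u0 x) * (D x \<bullet> i) + \<theta> x * H' (u0 x) * (g0 x \<bullet> i)) = 0"
proof -
  have C: "C1_grad (U n) (G n)" "0 \<le> U n x" for n x using ap u0(2) by (auto simp: C1_approx_def)
  have cH: "continuous_on {0..} H"
    using H(1) by (auto intro!: continuous_at_imp_continuous_on dest: DERIV_isCont)
  have [measurable]: "U n \<in> borel_measurable borel" "G n \<in> borel_measurable borel" for n
    using C1_grad_measurable[OF C(1)] by auto
  have [measurable]: "u0 \<in> borel_measurable borel" "g0 \<in> borel_measurable borel" using u0 g0 by auto
  have [measurable]: "\<theta> \<in> borel_measurable borel" "D \<in> borel_measurable borel"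
    using C1_grad_measurable[OF theta] by auto
  have [measurable]: "(\<lambda>x. H (U n x)) \<in> borel_measurable borel" "(\<lambda>x. H' (U n x)) \<in> borel_measurable borel"
     "(\<lambda>x. H (u0 x)) \<in> borel_measurable borel" "(\<lambda>x. H' (u0 x)) \<in> borel_measurable borel" for n
    by (rule measurable_compose_nonneg[OF cH] measurable_compose_nonneg[OF H(2)]; simp add: C(2) u0)+
  have [measurable]: "K \<in> sets borel" using K(1) by (simp add: compact_imp_closed)
  have M0: "0 \<le> M" using M(1)[of 0] by simp
  have D0: "D x = 0" if "x \<notin> K" for x by (rule C1_grad_support[OF theta compact_imp_closed[OF K(1)] K(3) that])
  have cD: "continuous_on UNIV D" using theta by (simp add: C1_grad_def)
  obtain c1 where c1: "0 < c1" "\<And>x. norm (\<theta> x) \<le> c1"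
    using bounded_of_compact_support[OF C1_grad_continuous[OF theta] K(1,3)] by metis
  have iD: "integrable lborel (\<lambda>x. D x \<bullet> i)"
    by (rule integrable_compact_support[OF _ K(1)]) (use cD D0 in \<open>auto intro!: continuous_intros\<close>)
  have conv: "AE x in lborel. (\<lambda>n. U n x) \<longlonglongrightarrow> u0 x" using ap by (simp add: C1_approx_def)
  have zero: "(LINT x|lborel. H (U n x) * (D x \<bullet> i) + \<theta> x * H' (U n x) * (G n x \<bullet> i)) = 0" for n
  proof -
    have "C1_grad (\<lambda>x. \<theta> x * H (U n x)) (\<lambda>x. H (U n x) *\<^sub>R D x + \<theta> x *\<^sub>R (H' (U n x) *\<^sub>R G n x))"
      by (intro C1_grad_mult theta C1_grad_compose C H)
    from integral_C1_grad_zero[OF this K(1), of i] K(3) show ?thesis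
      by (simp add: inner_add_left mult.assoc)
  qed
  define A where "A n x = H (U n x) * (D x \<bullet> i) + \<theta> x * H' (U n x) * (g0 x \<bullet> i)" for n x
  define A0 where "A0 x = H (u0 x) * (D x \<bullet> i) + \<theta> x * H' (u0 x) * (g0 x \<bullet> i)" for x
  define w where "w x = M * \<bar>D x \<bullet> i\<bar> + c1 * M * (norm (g0 x) * norm i)" for x
  have iw: "integrable lborel w" unfolding w_def using iD g0 by auto
  have bnd: "\<bar>H t * (D x \<bullet> i) + \<theta> x * H' t * (g0 x \<bullet> i)\<bar> \<le> w x" if t: "0 \<le> t" for t x
  proof -
    have "\<bar>H t * (D x \<bullet> i)\<bar> \<le> M * \<bar>D x \<bullet> i\<bar>"
      unfolding abs_mult by (intro mult_right_mono M t) auto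
    moreover have "\<bar>\<theta> x * H' t * (g0 x \<bullet> i)\<bar> \<le> c1 * M * (norm (g0 x) * norm i)"
      unfolding abs_mult using c1 M0 M(2)[OF t]
      by (intro mult_mono mult_nonneg_nonneg Cauchy_Schwarz_ineq2) auto
    ultimately show ?thesis unfolding w_def by linarith
  qed
  have [measurable]: "A n \<in> borel_measurable lborel" "A0 \<in> borel_measurable lborel" for n
    unfolding A_def[abs_def] A0_def[abs_def] by measurable
  have bA: "\<bar>A n x\<bar> \<le> w x" "\<bar>A0 x\<bar> \<le> w x" for n x
    unfolding A_def A0_def by (intro bnd C u0)+
  have iA: "integrable lborel (A n)" "integrable lborel A0" for n
  proof -
    have "norm (A n x) \<le> norm (w x)" "norm (A0 x) \<le> norm (w x)" for x
      using bA(1)[of n x] bA(2)[of x] by auto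
    then show "integrable lborel (A n)" "integrable lborel A0"
      by (auto intro!: Bochner_Integration.integrable_bound[OF iw] AE_I2)
  qed
  have l1: "(\<lambda>n. LINT x|lborel. A n x) \<longlonglongrightarrow> (LINT x|lborel. A0 x)"
  proof (rule integral_dominated_convergence[where w=w])
    show "AE x in lborel. (\<lambda>n. A n x) \<longlonglongrightarrow> A0 x"
      using conv
    proof eventually_elim
      case (elim x)
      show ?case unfolding A_def A0_def
        by (intro tendsto_add tendsto_mult tendsto_const tendsto_compose_nonneg[OF cH elim]
            tendsto_compose_nonneg[OF H(2) elim] C)
    qed
  qed (use iw bA in auto)
  define c where "c = c1 * M * norm i"
  have c0: "0 \<le> c" using c1 M0 by (simp add: c_def)
  have iG: "integrable lborel (\<lambda>x. indicator B x * norm (G n x - g0 x))" for n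
  proof -
    have "integrable lborel (\<lambda>x. norm (indicator B x *\<^sub>R (G n x - g0 x)))"
      using ap by (intro integrable_norm) (simp add: C1_approx_def)
    then show ?thesis by simp
  qed
  define E where "E n x = \<theta> x * H' (U n x) * ((G n x - g0 x) \<bullet> i)" for n x
  have [measurable]: "E n \<in> borel_measurable lborel" for n unfolding E_def[abs_def] by measurable
  have bE: "\<bar>E n x\<bar> \<le> c * (indicator B x * norm (G n x - g0 x))" for n x
  proof (cases "x \<in> K")
    case True
    have "\<bar>E n x\<bar> \<le> (c1 * M) * (norm (G n x - g0 x) * norm i)"
      unfolding E_def abs_mult using c1 M0 M(2)[OF C(2)]
      by (intro mult_mono mult_nonneg_nonneg Cauchy_Schwarz_ineq2) auto
    with True K(2) show ?thesis by (auto simp: c_def algebra_simps)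
  next
    case False
    then show ?thesis using K(3) c0 by (simp add: E_def)
  qed
  have iE: "integrable lborel (E n)" for n
    by (rule Bochner_Integration.integrable_bound[of _ "\<lambda>x. c * (indicator B x * norm (G n x - g0 x))"])
       (use iG bE c0 in \<open>auto intro!: AE_I2 simp: abs_mult\<close>)
  have l2: "(\<lambda>n. LINT x|lborel. E n x) \<longlonglongrightarrow> 0"
  proof (rule Lim_null_comparison)
    show "\<forall>\<^sub>F n in sequentially. norm (LINT x|lborel. E n x) \<le> c * (LINT x|lborel. indicator B x * norm (G n x - g0 x))"
    proof (intro always_eventually allI)
      fix n
      have "norm (LINT x|lborel. E n x) \<le> (LINT x|lborel. c * (indicator B x * norm (G n x - g0 x)))"
        by (rule order_trans[OF integral_norm_bound], rule integral_mono) (use iE iG bE in auto)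
      then show "norm (LINT x|lborel. E n x) \<le> c * (LINT x|lborel. indicator B x * norm (G n x - g0 x))" by simp
    qed
    have "(\<lambda>n. c * (LINT x|lborel. indicator B x * norm (G n x - g0 x))) \<longlonglongrightarrow> c * 0"
      using ap by (intro tendsto_intros) (simp add: C1_approx_def)
    then show "(\<lambda>n. c * (LINT x|lborel. indicator B x * norm (G n x - g0 x))) \<longlonglongrightarrow> 0" by simp
  qed
  have "(LINT x|lborel. A n x) + (LINT x|lborel. E n x) = 0" for n
  proof -
    have "(LINT x|lborel. A n x) + (LINT x|lborel. E n x) = (LINT x|lborel. A n x + E n x)"
      using iA iE by simp
    also have "\<dots> = (LINT x|lborel. H (U n x) * (D x \<bullet> i) + \<theta> x * H' (U n x) * (G n x \<bullet> i))"
      by (intro Bochner_Integration.integral_cong) (auto simp: A_def E_def inner_diff_left algebra_simps)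
    finally show ?thesis using zero by simp
  qed
  then have "(\<lambda>n. 0) \<longlonglongrightarrow> (LINT x|lborel. A0 x) + 0"
    using tendsto_add[OF l1 l2] by simp
  then show ?thesis unfolding A0_def using LIMSEQ_unique[OF tendsto_const] by fastforce
qed

lemma set_integral_lebesgue_lborel:
  fixes f :: "'a::euclidean_space \<Rightarrow> real"
  assumes "f \<in> borel_measurable borel" "\<And>x. x \<notin> S \<Longrightarrow> f x = 0"
  shows "(LINT x:S|lebesgue. f x) = (LINT x|lborel. f x)"
    "set_integrable lebesgue S f \<longleftrightarrow> integrable lborel f"
proof -
  have "(\<lambda>x. indicator S x *\<^sub>R f x) = f" using assms(2) by (auto simp: indicator_def fun_eq_iff)
  then show "(LINT x:S|lebesgue. f x) = (LINT x|lborel. f x)"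
    "set_integrable lebesgue S f \<longleftrightarrow> integrable lborel f"
    using assms(1) by (simp_all add: set_lebesgue_integral_def set_integrable_def integral_completion integrable_completion)
qed

lemma set_integrable_lebesgue_of_lborel:
  fixes f :: "'a::euclidean_space \<Rightarrow> 'b::euclidean_space"
  assumes "integrable lborel f" "S \<in> sets lebesgue"
  shows "set_integrable lebesgue S f"
proof -
  have [measurable]: "f \<in> borel_measurable borel" using assms by auto
  have "integrable lebesgue f" using assms(1) by (subst integrable_completion) auto
  then show ?thesis
    unfolding set_integrable_def using assms(2) by (intro integrable_bounded_scaleR[of _ _ _ 1]) auto
qed

lemma set_borel_measurable_lebesgue_of_borel:
  fixes f :: "'a::euclidean_space \<Rightarrow> 'b::euclidean_space"
  assumes "f \<in> borel_measurable borel" "S \<in> sets lebesgue"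
  shows "set_borel_measurable lebesgue S f"
proof -
  have "f \<in> borel_measurable lebesgue" by (rule measurable_completion) (use assms in simp)
  then show ?thesis unfolding set_borel_measurable_def using assms(2) by measurable
qed

lemma Lp_locI:
  fixes f :: "'a::euclidean_space \<Rightarrow> 'b::euclidean_space"
  assumes [measurable]: "f \<in> borel_measurable borel" and i: "integrable lborel (\<lambda>x. norm (f x) powr q)"
    and S: "S \<in> sets lebesgue"
  shows "Lp_loc q S f" "Lp q S f"
  unfolding Lp_loc_def Lp_def
  using set_borel_measurable_lebesgue_of_borel[OF assms(1) S]
    set_integrable_lebesgue_of_lborel[OF i] S
  by (auto simp: lmeasurable_compact fmeasurableD)

lemma weak_gradient_of_identity:
  fixes v :: "'a::euclidean_space \<Rightarrow> real"
  assumes S: "S \<in> sets lebesgue" and v: "integrable lborel v" "\<And>x. x \<notin> S \<Longrightarrow> v x = 0"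
    and g: "integrable lborel g" "\<And>x. x \<notin> S \<Longrightarrow> g x = 0"
    and id: "\<And>\<phi> D i. C1_grad \<phi> D \<Longrightarrow> i \<in> Basis \<Longrightarrow>
      (LINT x|lborel. v x * (D x \<bullet> i)) = - (LINT x|lborel. (g x \<bullet> i) * \<phi> x)"
  shows "is_weak_gradient S v g"
proof -
  have [measurable]: "v \<in> borel_measurable borel" "g \<in> borel_measurable borel" using v g by auto
  show ?thesis
    unfolding is_weak_gradient_def
  proof (intro conjI ballI)
    show "Lp_loc 1 S v" "Lp_loc 1 S g" using v g S by (auto intro!: Lp_locI)
    fix \<phi> and i :: 'a assume phi: "\<phi> \<in> Cc_infinity S" and i: "i \<in> Basis"
    obtain D where D: "C1_grad \<phi> D" using Cc_infinity_C1_grad[OF phi] by metis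
    note [measurable] = C1_grad_measurable[OF D]
    show "(LINT x:S|lebesgue. v x * frechet_derivative \<phi> (at x) i) = - (LINT x:S|lebesgue. (g x \<bullet> i) * \<phi> x)"
      using id[OF D i] v(2) g(2) by (simp add: C1_grad_frechet_derivative[OF D] set_integral_lebesgue_lborel)
  qed
qed

text \<open>
  The approximating test functions are the mollifications of \<open>v\<close>: their gradients are the mollifications of \<open>g\<close>, and
  the gap between the two radii leaves room for their supports. Convergence in \<open>L\<^sup>p\<close> is applied to the pair \<open>(v, g)\<close>,
  which gives one mollification radius that serves the function and the gradient.
\<close>

lemma W1p_zeroI:
  fixes v :: "'a::euclidean_space \<Rightarrow> real"
  assumes p: "1 < p" and ab: "a < b"
    and v: "integrable lborel v" "\<And>x. x \<notin> cball c a \<Longrightarrow> v x = 0" "integrable lborel (\<lambda>x. norm (v x) powr p)"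
    and g: "integrable lborel g" "\<And>x. x \<notin> cball c a \<Longrightarrow> g x = 0" "integrable lborel (\<lambda>x. norm (g x) powr p)"
    and id: "\<And>\<phi> D i. C1_grad \<phi> D \<Longrightarrow> i \<in> Basis \<Longrightarrow>
      (LINT x|lborel. v x * (D x \<bullet> i)) = - (LINT x|lborel. (g x \<bullet> i) * \<phi> x)"
  shows "v \<in> W1p_zero p (ball c b)"
proof -
  let ?S = "ball c b"
  have [measurable]: "v \<in> borel_measurable borel" "g \<in> borel_measurable borel" using v g by auto
  have sub: "cball c a \<subseteq> ?S" using ab by auto
  have v0: "v x = 0" "g x = 0" if "x \<notin> ?S" for x
  proof -
    have "x \<notin> cball c a" using sub that by blast
    then show "v x = 0" "g x = 0" using v(2) g(2) by blast+
  qed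
  have wg: "is_weak_gradient ?S v g"
    by (rule weak_gradient_of_identity) (use v g v0 id in auto)
  have W: "v \<in> W1p p ?S"
    unfolding W1p_def using wg v g by (auto intro!: Lp_locI)
  have "\<exists>\<phi>\<in>Cc_infinity ?S. W1p_norm p ?S (\<lambda>x. v x - \<phi> x) < e" if e: "0 < e" for e
  proof -
    define F where "F x = (v x, g x)" for x
    have [measurable]: "F \<in> borel_measurable borel" unfolding F_def by measurable
    have nF: "norm (F x) \<le> norm (v x) + norm (g x)" for x
      unfolding F_def by (rule norm_Pair_le)
    have iF: "integrable lborel F"
      by (rule Bochner_Integration.integrable_bound[of _ "\<lambda>x. norm (v x) + norm (g x)"])
         (use v(1) g(1) nF in \<open>auto intro!: AE_I2\<close>)
    have iFp: "integrable lborel (\<lambda>x. norm (F x) powr p)"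
    proof (rule Bochner_Integration.integrable_bound)
      show "integrable lborel (\<lambda>x. 2 powr p * (norm (v x) powr p + norm (g x) powr p))"
        using v(3) g(3) by simp
      show "AE x in lborel. norm (norm (F x) powr p) \<le> norm (2 powr p * (norm (v x) powr p + norm (g x) powr p))"
      proof (intro AE_I2)
        fix x
        have "norm (F x) powr p \<le> (norm (v x) + norm (g x)) powr p"
          using p nF by (intro powr_mono2) auto
        also have "\<dots> \<le> 2 powr p * (norm (v x) powr p + norm (g x) powr p)"
          using p by (intro powr_add_le) auto
        finally show "norm (norm (F x) powr p) \<le> norm (2 powr p * (norm (v x) powr p + norm (g x) powr p))"
          by simp
      qed
    qed measurable
    (* Two integrals, each below e powr p / 4, have to add up to less than e powr p. *)
    have "0 < b - a" "0 < e powr p / 4" using ab e by auto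
    obtain t where
      t: "0 < t" "t < b - a" and it: "integrable lborel (\<lambda>x. norm (mollify t F x - F x) powr p)"
      and lt: "(LINT x|lborel. norm (mollify t F x - F x) powr p) < e powr p / 4"
      by (rule mollify_Lp[OF p iF iFp \<open>0 < b - a\<close> \<open>0 < e powr p / 4\<close>]) blast
    define \<phi> where "\<phi> = mollify t v"
    obtain D where D: "C1_grad (mollifier t :: 'a \<Rightarrow> real) D" using mollifier_C1_grad by metis
    have phi: "C1_grad \<phi> (mollify t g)"
    proof -
      have "C1_grad \<phi> (\<lambda>x. LINT y|lborel. v y *\<^sub>R D (x - y))"
        unfolding \<phi>_def by (rule mollify_C1_grad[OF D t(1) v(1)])
      moreover have "(LINT y|lborel. v y *\<^sub>R D (x - y)) = mollify t g x" for x
        by (rule mollify_gradient_eq[OF D t(1) v(1) g(1)]) (rule id[OF C1_grad_reflect[OF D]])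
      ultimately show ?thesis by simp
    qed
    have F: "mollify t F x = (\<phi> x, mollify t g x)" for x
    proof -
      have i: "integrable lborel (\<lambda>y. mollifier t (x - y) *\<^sub>R F y)" by (rule mollify_integrand[OF iF])
      have "fst (mollify t F x) = \<phi> x" "snd (mollify t F x) = mollify t g x"
        unfolding \<phi>_def mollify_def
        using integral_bounded_linear[OF bounded_linear_fst i] integral_bounded_linear[OF bounded_linear_snd i]
        by (simp_all add: F_def)
      then show ?thesis by (simp add: prod_eq_iff)
    qed
    have phi0: "\<phi> x = 0" if "x \<notin> cball c (a + t)" for x
    proof -
      have "mollifier t (x - y) *\<^sub>R v y = 0" for y
      proof (cases "y \<in> cball c a")
        case True
        then have "y \<notin> cball x t"
          using that dist_triangle[of c x y] by (auto simp: dist_commute)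
        then have "mollifier t (x - y) = 0" by (rule mollifier_support(2)[OF t(1)])
        then show ?thesis by simp
      qed (use v in auto)
      then have "(\<lambda>y. mollifier t (x - y) *\<^sub>R v y) = (\<lambda>_. 0)" by blast
      then have "mollify t v x = (LINT y::'a|lborel. 0)" unfolding mollify_def by (rule arg_cong)
      then show ?thesis by (simp add: \<phi>_def)
    qed
    have subt: "cball c (a + t) \<subseteq> ?S" using t by auto
    have Cc: "\<phi> \<in> Cc_infinity ?S"
    proof -
      have "Ck k \<phi>" for k
        unfolding \<phi>_def mollify_def[abs_def] real_scaleR_def
        by (rule convolution_Ck[OF bump_class_Ck[OF mollifier_bump_class] compact_cball
              mollifier_support(1)[OF t(1)] v(1)])
      then show ?thesis
        unfolding Cc_infinity_def using phi0 subt by (auto intro!: exI[of _ "cball c (a + t)"])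
    qed
    have g0: "mollify t g x = 0" if "x \<notin> cball c (a + t)" for x
      by (rule C1_grad_support[OF phi closed_cball phi0 that])
    have outS: "\<phi> x = 0" "mollify t g x = 0" if "x \<notin> ?S" for x
    proof -
      have "x \<notin> cball c (a + t)" using subt that by blast
      then show "\<phi> x = 0" "mollify t g x = 0" using phi0 g0 by blast+
    qed
    note [measurable] = C1_grad_measurable[OF phi]
    have iphi: "integrable lborel \<phi>" unfolding \<phi>_def by (rule mollify_integrable[OF v(1) t(1)])
    have ig: "integrable lborel (mollify t g)" by (rule mollify_integrable[OF g(1) t(1)])
    have wg2: "is_weak_gradient ?S (\<lambda>x. v x - \<phi> x) (\<lambda>x. g x - mollify t g x)"
    proof (rule weak_gradient_of_identity)
      fix \<theta> :: "'a \<Rightarrow> real" and D :: "'a \<Rightarrow> 'a" and i :: 'a assume th: "C1_grad \<theta> D" and i: "i \<in> Basis"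
      note [measurable] = C1_grad_measurable[OF th]
      have cD: "continuous_on UNIV D" using th by (simp add: C1_grad_def)
      note cth = C1_grad_continuous[OF th] and cphi = C1_grad_continuous[OF phi]
      have cg: "continuous_on UNIV (mollify t g)" using phi by (simp add: C1_grad_def)
      have cDi: "continuous_on UNIV (\<lambda>x. D x \<bullet> i)" by (intro continuous_intros cD)
      have i1: "integrable lborel (\<lambda>x. \<phi> x * (D x \<bullet> i))"
        by (rule integrable_compact_support[OF _ compact_cball[of c "a+t"]])
           (use cphi cD phi0 in \<open>auto intro!: continuous_intros\<close>)
      have i2: "integrable lborel (\<lambda>x. (mollify t g x \<bullet> i) * \<theta> x)"
        by (rule integrable_compact_support[OF _ compact_cball[of c "a+t"]])
           (use cg cth g0 in \<open>auto intro!: continuous_intros\<close>)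
      have i3: "integrable lborel (\<lambda>x. v x * (D x \<bullet> i))"
        using integrable_times_continuous[OF v(1) compact_cball v(2) cDi] by (simp add: mult.commute)
      have i4: "integrable lborel (\<lambda>x. (g x \<bullet> i) * \<theta> x)"
        using integrable_times_continuous[of "\<lambda>x. g x \<bullet> i", OF _ compact_cball[of c a] _ cth] g(1,2)
        by (simp add: mult.commute)
      have "C1_grad (\<lambda>x. \<phi> x * \<theta> x) (\<lambda>x. \<theta> x *\<^sub>R mollify t g x + \<phi> x *\<^sub>R D x)"
        by (rule C1_grad_mult[OF phi th])
      from integral_C1_grad_zero[OF this compact_cball[of c "a+t"], of i] phi0
      have "(LINT x|lborel. (mollify t g x \<bullet> i) * \<theta> x + \<phi> x * (D x \<bullet> i)) = 0"
        by (simp add: inner_add_left mult.commute)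
      then have "(LINT x|lborel. (mollify t g x \<bullet> i) * \<theta> x) + (LINT x|lborel. \<phi> x * (D x \<bullet> i)) = 0"
        using i1 i2 by simp
      then show "(LINT x|lborel. (v x - \<phi> x) * (D x \<bullet> i)) = - (LINT x|lborel. ((g x - mollify t g x) \<bullet> i) * \<theta> x)"
        using i1 i2 i3 i4 id[OF th i] by (simp add: left_diff_distrib inner_diff_left)
    qed (use v g v0 outS iphi ig in auto)
    define w where "w = weak_gradient ?S (\<lambda>x. v x - \<phi> x)"
    have w: "AE x in lborel. x \<in> ?S \<longrightarrow> w x = g x - mollify t g x"
      unfolding w_def by (rule weak_gradient_represents(2)[OF wg2]) simp
    have wL: "(\<lambda>x. indicator ?S x *\<^sub>R w x) \<in> borel_measurable lebesgue"
      using weak_gradient_represents(1)[OF wg2] unfolding w_def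
      by (simp add: is_weak_gradient_def Lp_loc_def set_borel_measurable_def)
    have S0: "(LINT x:?S|lebesgue. \<bar>v x - \<phi> x\<bar> powr p) = (LINT x|lborel. \<bar>v x - \<phi> x\<bar> powr p)"
      by (rule set_integral_lebesgue_lborel) (use v0 outS p in auto)
    have S1: "(LINT x:?S|lebesgue. norm (w x) powr p) = (LINT x|lborel. norm (g x - mollify t g x) powr p)"
    proof -
      have "(\<lambda>x. indicator ?S x *\<^sub>R (norm (w x) powr p)) = (\<lambda>x. norm (indicator ?S x *\<^sub>R w x) powr p)"
        using p by (auto simp: indicator_def fun_eq_iff)
      moreover have "(LINT x|lebesgue. norm (indicator ?S x *\<^sub>R w x) powr p) = (LINT x|lborel. norm (g x - mollify t g x) powr p)"
      proof (rule integrable_lebesgue_lborel(2))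
        show "(\<lambda>x. norm (indicator ?S x *\<^sub>R w x) powr p) \<in> borel_measurable lebesgue"
          using wL by measurable
        show "AE x in lborel. norm (indicator ?S x *\<^sub>R w x) powr p = norm (g x - mollify t g x) powr p"
          using w
        proof eventually_elim
          case (elim x)
          show ?case
          proof (cases "x \<in> ?S")
            case False
            then show ?thesis using v0(2)[OF False] outS(2)[OF False] p by simp
          qed (use elim in simp)
        qed
      qed measurable
      ultimately show ?thesis by (simp add: set_lebesgue_integral_def)
    qed
    have n: "\<bar>v x - \<phi> x\<bar> powr p \<le> norm (mollify t F x - F x) powr p"
      "norm (g x - mollify t g x) powr p \<le> norm (mollify t F x - F x) powr p" for x
      using p norm_fst_le[of "\<phi> x - v x" "mollify t g x - g x"] norm_snd_le[of "mollify t g x - g x" "\<phi> x - v x"]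
      by (auto intro!: powr_mono2 simp: F F_def norm_minus_commute)
    have "(LINT x|lborel. \<bar>v x - \<phi> x\<bar> powr p) \<le> (LINT x|lborel. norm (mollify t F x - F x) powr p)"
      "(LINT x|lborel. norm (g x - mollify t g x) powr p) \<le> (LINT x|lborel. norm (mollify t F x - F x) powr p)"
      by (rule integral_mono'[OF it]; simp add: n)+
    then have sum: "(LINT x|lborel. \<bar>v x - \<phi> x\<bar> powr p) + (LINT x|lborel. norm (g x - mollify t g x) powr p) < e powr p"
      using lt \<open>0 < e powr p / 4\<close> by linarith
    have "W1p_norm p ?S (\<lambda>x. v x - \<phi> x) < (e powr p) powr (1 / p)"
      unfolding W1p_norm_def w_def[symmetric] S0 S1
      using sum p by (intro powr_less_mono2 add_nonneg_nonneg integral_nonneg_AE) auto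
    also have "\<dots> = e" using e p by (simp add: powr_powr)
    finally show ?thesis using Cc by blast
  qed
  with W v0 show ?thesis by (auto simp: W1p_zero_def)
qed

section \<open>A Poincare inequality for pairs of points\<close>

text \<open>
  The change of variables has Jacobian \<open>t\<^sup>N\<close>, which is at least \<open>2\<^sup>-\<^sup>N\<close>.
\<close>

lemma nn_integral_affine_le:
  fixes \<Phi> :: "'a::euclidean_space \<Rightarrow> ennreal"
  assumes [measurable]: "\<Phi> \<in> borel_measurable borel" and t: "1 / 2 \<le> t"
  shows "(\<integral>\<^sup>+x. \<Phi> (a + t *\<^sub>R x) \<partial>lborel) \<le> 2 ^ DIM('a) * (\<integral>\<^sup>+x. \<Phi> x \<partial>lborel)"
proof -
  have "t \<noteq> 0" using t by auto
  have "(\<integral>\<^sup>+x. \<Phi> x \<partial>lborel) = (\<integral>\<^sup>+x. \<Phi> x \<partial>density (distr lborel borel (\<lambda>x. a + t *\<^sub>R x)) (\<lambda>_. ennreal (\<bar>t\<bar>^DIM('a))))"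
    using lborel_affine[OF \<open>t \<noteq> 0\<close>, of a] by (simp add: ennreal_power)
  also have "\<dots> = (\<integral>\<^sup>+x. ennreal (\<bar>t\<bar>^DIM('a)) * \<Phi> (a + t *\<^sub>R x) \<partial>lborel)"
    by (subst nn_integral_density) (auto simp: nn_integral_distr)
  also have "\<dots> = ennreal (\<bar>t\<bar>^DIM('a)) * (\<integral>\<^sup>+x. \<Phi> (a + t *\<^sub>R x) \<partial>lborel)"
    by (rule nn_integral_cmult) measurable
  finally have eq: "(\<integral>\<^sup>+x. \<Phi> x \<partial>lborel) = ennreal (\<bar>t\<bar>^DIM('a)) * (\<integral>\<^sup>+x. \<Phi> (a + t *\<^sub>R x) \<partial>lborel)" .
  have "1 \<le> (2 * t) ^ DIM('a)" using t by (intro one_le_power) auto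
  also have "(2 * t) ^ DIM('a) = 2 ^ DIM('a) * \<bar>t\<bar> ^ DIM('a)" using t by (simp add: power_mult_distrib)
  finally have "ennreal 1 \<le> ennreal (2 ^ DIM('a) * \<bar>t\<bar> ^ DIM('a))" by (rule ennreal_leI)
  also have "\<dots> = 2 ^ DIM('a) * ennreal (\<bar>t\<bar> ^ DIM('a))"
    by (simp add: ennreal_mult flip: ennreal_power)
  finally have "1 * (\<integral>\<^sup>+x. \<Phi> (a + t *\<^sub>R x) \<partial>lborel) \<le>
      (2 ^ DIM('a) * ennreal (\<bar>t\<bar> ^ DIM('a))) * (\<integral>\<^sup>+x. \<Phi> (a + t *\<^sub>R x) \<partial>lborel)"
    by (intro mult_right_mono) auto
  then show ?thesis by (simp add: eq mult.assoc)
qed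

text \<open>
  The midpoint is used because on the half of the segment next to \<open>x\<close>, for fixed \<open>y\<close> and \<open>t\<close>, the map
  \<open>x \<mapsto> y + t (x - y)\<close> contracts at most by the factor \<open>1 / 2\<close>.
\<close>

lemma C1_grad_segment:
  fixes f :: "'a::euclidean_space \<Rightarrow> real"
  assumes f: "C1_grad f D"
  shows "ennreal \<bar>f x - f ((1/2) *\<^sub>R (x + y))\<bar> \<le>
    (\<integral>\<^sup>+t. ennreal (norm (x - y) * norm (D (y + t *\<^sub>R (x - y)))) * indicator {1/2..1} t \<partial>lborel)"
proof -
  let ?F = "\<lambda>t. f (y + t *\<^sub>R (x - y))"
  let ?F' = "\<lambda>t. D (y + t *\<^sub>R (x - y)) \<bullet> (x - y)"
  have d: "(?F has_vector_derivative ?F' t) (at t within {1/2..1})" for t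
  proof -
    have "((\<lambda>t. y + t *\<^sub>R (x - y)) has_derivative (\<lambda>h. h *\<^sub>R (x - y))) (at t)"
      by (auto intro!: derivative_eq_intros)
    moreover have "(f has_derivative (\<lambda>h. D (y + t *\<^sub>R (x - y)) \<bullet> h)) (at (y + t *\<^sub>R (x - y)))"
      using f by (simp add: C1_grad_def)
    ultimately have "(?F has_derivative (\<lambda>h. D (y + t *\<^sub>R (x - y)) \<bullet> (h *\<^sub>R (x - y)))) (at t)"
      by (rule has_derivative_compose)
    then show ?thesis
      unfolding has_vector_derivative_def by (rule has_derivative_at_withinI[THEN has_derivative_eq_rhs]) simp
  qed
  have c: "continuous_on {1/2..1} ?F'"
  proof -
    have "continuous_on {1/2..1} (\<lambda>t. D (y + t *\<^sub>R (x - y)))"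
      by (rule continuous_on_compose2[of UNIV D]) (use f in \<open>auto simp: C1_grad_def intro!: continuous_intros\<close>)
    then show ?thesis by (intro continuous_intros)
  qed
  have I: "has_bochner_integral lborel (\<lambda>t. indicator {1/2..1} t *\<^sub>R ?F' t) (?F 1 - ?F (1/2))"
    by (rule has_bochner_integral_FTC_Icc) (use d c in auto)
  have m: "?F (1/2) = f ((1/2) *\<^sub>R (x + y))"
  proof -
    have "(1/2) *\<^sub>R (x + y) = (1/2) *\<^sub>R ((y + y) + (x - y))" by simp
    also have "\<dots> = (1/2) *\<^sub>R (y + y) + (1/2) *\<^sub>R (x - y)" by (rule scaleR_add_right)
    also have "(1/2) *\<^sub>R (y + y) = y" by (rule scaleR_half_double)
    finally show ?thesis by simp
  qed
  have "ennreal (norm (LINT t|lborel. indicator {1/2..1} t *\<^sub>R ?F' t)) \<le>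
     (\<integral>\<^sup>+t. norm (indicator {1/2..1} t *\<^sub>R ?F' t) \<partial>lborel)"
    using I by (intro integral_norm_bound_ennreal) (simp add: has_bochner_integral_iff)
  also have "\<dots> \<le> (\<integral>\<^sup>+t. ennreal (norm (x - y) * norm (D (y + t *\<^sub>R (x - y)))) * indicator {1/2..1} t \<partial>lborel)"
  proof (rule nn_integral_mono)
    fix t
    have "norm (?F' t) \<le> norm (x - y) * norm (D (y + t *\<^sub>R (x - y)))"
      using Cauchy_Schwarz_ineq2[of "D (y + t *\<^sub>R (x - y))" "x - y"] by (simp add: mult.commute)
    then show "ennreal (norm (indicator {1/2..1} t *\<^sub>R ?F' t)) \<le>
       ennreal (norm (x - y) * norm (D (y + t *\<^sub>R (x - y)))) * indicator {1/2..1} t"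
      by (auto simp: indicator_def intro!: ennreal_leI)
  qed
  also have "(LINT t|lborel. indicator {1/2..1} t *\<^sub>R ?F' t) = f x - f ((1/2) *\<^sub>R (x + y))"
    using I m by (simp add: has_bochner_integral_iff)
  finally show ?thesis by simp
qed

text \<open>
  After integration along segments, Tonelli's theorem brings the integral over \<open>x\<close> inside, where
  \<open>nn_integral_affine_le\<close> applies for fixed \<open>y\<close> and \<open>t\<close>; convexity of the ball keeps the segments in it.
\<close>

lemma poincare_half:
  fixes f :: "'a::euclidean_space \<Rightarrow> real"
  assumes f: "C1_grad f D" and B: "B = ball c \<rho>" and "0 < \<rho>"
  shows "(\<integral>\<^sup>+x. \<integral>\<^sup>+y. ennreal \<bar>f x - f ((1/2) *\<^sub>R (x + y))\<bar> * (indicator B x * indicator B y) \<partial>lborel \<partial>lborel)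
    \<le> ennreal \<rho> * 2 ^ DIM('a) * emeasure lborel B * (\<integral>\<^sup>+z. ennreal (norm (D z)) * indicator B z \<partial>lborel)"
proof -
  note [measurable] = C1_grad_measurable[OF f]
  have [measurable]: "B \<in> sets borel" using B by simp
  define \<Phi> where "\<Phi> z = ennreal (norm (D z)) * indicator B z" for z
  have [measurable]: "\<Phi> \<in> borel_measurable borel" unfolding \<Phi>_def by measurable
  let ?J = "\<lambda>x y t. ennreal (2 * \<rho>) * \<Phi> ((1 - t) *\<^sub>R y + t *\<^sub>R x) * (indicator {1/2..1::real} t * indicator B y)"
  have "(\<integral>\<^sup>+x. \<integral>\<^sup>+y. ennreal \<bar>f x - f ((1/2) *\<^sub>R (x + y))\<bar> * (indicator B x * indicator B y) \<partial>lborel \<partial>lborel)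
    \<le> (\<integral>\<^sup>+x. \<integral>\<^sup>+y. \<integral>\<^sup>+t. ?J x y t \<partial>lborel \<partial>lborel \<partial>lborel)"
  proof (intro nn_integral_mono)
    fix x y :: 'a
    show "ennreal \<bar>f x - f ((1/2) *\<^sub>R (x + y))\<bar> * (indicator B x * indicator B y) \<le> (\<integral>\<^sup>+t. ?J x y t \<partial>lborel)"
    proof (cases "x \<in> B \<and> y \<in> B")
      case True
      have "ennreal \<bar>f x - f ((1/2) *\<^sub>R (x + y))\<bar> * (indicator B x * indicator B y) = ennreal \<bar>f x - f ((1/2) *\<^sub>R (x + y))\<bar>"
        using True by simp
      also have "\<dots> \<le> (\<integral>\<^sup>+t. ennreal (norm (x - y) * norm (D (y + t *\<^sub>R (x - y)))) * indicator {1/2..1} t \<partial>lborel)"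
        by (rule C1_grad_segment[OF f])
      also have "\<dots> \<le> (\<integral>\<^sup>+t. ?J x y t \<partial>lborel)"
      proof (rule nn_integral_mono)
        fix t :: real
        show "ennreal (norm (x - y) * norm (D (y + t *\<^sub>R (x - y)))) * indicator {1/2..1} t \<le> ?J x y t"
        proof (cases "t \<in> {1/2..1}")
          case t: True
          have z: "y + t *\<^sub>R (x - y) = (1 - t) *\<^sub>R y + t *\<^sub>R x" by (simp add: algebra_simps)
          have "(1 - t) *\<^sub>R y + t *\<^sub>R x \<in> B"
            using True t unfolding B by (intro convexD[OF convex_ball]) auto
          moreover have "norm (x - y) \<le> 2 * \<rho>"
            using True dist_triangle2[of x y c] unfolding B by (simp add: dist_norm norm_minus_commute)
          ultimately show ?thesis
            using t True \<open>0 < \<rho>\<close> unfolding z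
            by (auto simp: \<Phi>_def ennreal_mult[symmetric] intro!: ennreal_leI mult_right_mono)
        qed simp
      qed
      finally show ?thesis .
    qed auto
  qed
  also have "\<dots> = (\<integral>\<^sup>+y. \<integral>\<^sup>+x. \<integral>\<^sup>+t. ?J x y t \<partial>lborel \<partial>lborel \<partial>lborel)"
    by (rule lborel_pair.Fubini') measurable
  also have "\<dots> = (\<integral>\<^sup>+y. \<integral>\<^sup>+t. \<integral>\<^sup>+x. ?J x y t \<partial>lborel \<partial>lborel \<partial>lborel)"
    by (rule nn_integral_cong, rule lborel_pair.Fubini') measurable
  also have "\<dots> \<le> (\<integral>\<^sup>+y. \<integral>\<^sup>+t. ennreal (2 * \<rho>) * (2 ^ DIM('a) * (\<integral>\<^sup>+z. \<Phi> z \<partial>lborel)) *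
      (indicator {1/2..1::real} t * indicator B (y::'a)) \<partial>lborel \<partial>lborel)"
  proof (intro nn_integral_mono)
    fix y :: 'a and t :: real
    show "(\<integral>\<^sup>+x. ?J x y t \<partial>lborel) \<le> ennreal (2 * \<rho>) * (2 ^ DIM('a) * (\<integral>\<^sup>+z. \<Phi> z \<partial>lborel)) *
      (indicator {1/2..1::real} t * indicator B y)"
    proof (cases "t \<in> {1/2..1}")
      case True
      have "(\<integral>\<^sup>+x. ?J x y t \<partial>lborel) = ennreal (2 * \<rho>) * (\<integral>\<^sup>+x. \<Phi> ((1 - t) *\<^sub>R y + t *\<^sub>R x) \<partial>lborel) *
         (indicator {1/2..1::real} t * indicator B y)"
        by (simp add: nn_integral_cmult nn_integral_multc)
      then show ?thesis
        using nn_integral_affine_le[of \<Phi> t "(1 - t) *\<^sub>R y"] True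
        by (auto intro!: mult_right_mono mult_left_mono)
    qed auto
  qed
  also have "\<dots> = ennreal (2 * \<rho>) * (2 ^ DIM('a) * (\<integral>\<^sup>+z. \<Phi> z \<partial>lborel)) * (ennreal (1/2) * emeasure lborel B)"
    by (simp add: nn_integral_cmult nn_integral_multc)
  also have "\<dots> = (ennreal (2 * \<rho>) * ennreal (1/2)) * 2 ^ DIM('a) * emeasure lborel B * (\<integral>\<^sup>+z. \<Phi> z \<partial>lborel)"
    by (simp only: ac_simps)
  also have "ennreal (2 * \<rho>) * ennreal (1/2) = ennreal \<rho>"
    using \<open>0 < \<rho>\<close> by (subst ennreal_mult[symmetric]) auto
  finally show ?thesis by (simp add: \<Phi>_def)
qed

text \<open>
  The triangle inequality through the midpoint of \<open>x\<close> and \<open>y\<close> gives two terms with the same integral by symmetry.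
\<close>

lemma poincare_C1:
  fixes f :: "'a::euclidean_space \<Rightarrow> real"
  assumes f: "C1_grad f D" and B: "B = ball c \<rho>" and "0 < \<rho>"
  shows "(\<integral>\<^sup>+x. \<integral>\<^sup>+y. ennreal \<bar>f x - f y\<bar> * (indicator B x * indicator B y) \<partial>lborel \<partial>lborel)
    \<le> 2 * (ennreal \<rho> * 2 ^ DIM('a) * emeasure lborel B * (\<integral>\<^sup>+z. ennreal (norm (D z)) * indicator B z \<partial>lborel))"
proof -
  note [measurable] = C1_grad_measurable[OF f]
  have [measurable]: "B \<in> sets borel" using B by simp
  let ?h = "\<lambda>x y. ennreal \<bar>f x - f ((1/2) *\<^sub>R (x + y))\<bar> * (indicator B x * indicator B y)"
  have "(\<integral>\<^sup>+x. \<integral>\<^sup>+y. ennreal \<bar>f x - f y\<bar> * (indicator B x * indicator B y) \<partial>lborel \<partial>lborel)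
    \<le> (\<integral>\<^sup>+x. \<integral>\<^sup>+y. ?h x y + ?h y x \<partial>lborel \<partial>lborel)"
  proof (intro nn_integral_mono)
    fix x y
    have "\<bar>f x - f y\<bar> \<le> \<bar>f x - f ((1/2) *\<^sub>R (x + y))\<bar> + \<bar>f y - f ((1/2) *\<^sub>R (y + x))\<bar>"
      unfolding add.commute[of y x] by linarith
    then have "ennreal \<bar>f x - f y\<bar> \<le> ennreal \<bar>f x - f ((1/2) *\<^sub>R (x + y))\<bar> + ennreal \<bar>f y - f ((1/2) *\<^sub>R (y + x))\<bar>"
      by (simp add: ennreal_leI flip: ennreal_plus)
    then show "ennreal \<bar>f x - f y\<bar> * (indicator B x * indicator B y) \<le> ?h x y + ?h y x"
      by (auto simp: indicator_def)
  qed
  also have "\<dots> = (\<integral>\<^sup>+x. \<integral>\<^sup>+y. ?h x y \<partial>lborel \<partial>lborel) + (\<integral>\<^sup>+x. \<integral>\<^sup>+y. ?h y x \<partial>lborel \<partial>lborel)"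
    by (simp add: nn_integral_add)
  also have "(\<integral>\<^sup>+x. \<integral>\<^sup>+y. ?h y x \<partial>lborel \<partial>lborel) = (\<integral>\<^sup>+y. \<integral>\<^sup>+x. ?h y x \<partial>lborel \<partial>lborel)"
    by (rule lborel_pair.Fubini') measurable
  also have "(\<integral>\<^sup>+x. \<integral>\<^sup>+y. ?h x y \<partial>lborel \<partial>lborel) + \<dots> = 2 * (\<integral>\<^sup>+x. \<integral>\<^sup>+y. ?h x y \<partial>lborel \<partial>lborel)"
    by (simp add: mult_2)
  also have "\<dots> \<le> 2 * (ennreal \<rho> * 2 ^ DIM('a) * emeasure lborel B * (\<integral>\<^sup>+z. ennreal (norm (D z)) * indicator B z \<partial>lborel))"
    by (intro mult_left_mono poincare_half[OF assms]) auto
  finally show ?thesis .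
qed

text \<open>
  Fatou's lemma is used on the left and convergence in \<open>L\<^sup>1\<close> of \<open>H'(U n) G n\<close>, for bounded \<open>H'\<close>, on the right. The
  case of interest is \<open>H t = ln (t + d)\<close>.
\<close>

lemma poincare_limit:
  fixes u0 :: "'a::euclidean_space \<Rightarrow> real"
  assumes ap: "C1_approx K u0 g0 U G" and [measurable]: "K \<in> sets borel"
    and u0: "u0 \<in> borel_measurable borel" "\<And>x. 0 \<le> u0 x" and g0: "integrable lborel g0"
    and H: "\<And>t. 0 \<le> t \<Longrightarrow> (H has_real_derivative H' t) (at t)" "continuous_on {0..} H'"
    and M: "\<And>t. 0 \<le> t \<Longrightarrow> \<bar>H' t\<bar> \<le> M"
    and B: "B = ball c \<rho>" "0 < \<rho>" "B \<subseteq> K"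
  shows "(\<integral>\<^sup>+x. \<integral>\<^sup>+y. ennreal \<bar>H (u0 x) - H (u0 y)\<bar> * (indicator B x * indicator B y) \<partial>lborel \<partial>lborel)
    \<le> ennreal (2 * \<rho> * 2 ^ DIM('a) * measure lborel B * (LINT x|lborel. indicator B x * (\<bar>H' (u0 x)\<bar> * norm (g0 x))))"
proof -
  have C: "C1_grad (U n) (G n)" "0 \<le> U n x" for n x using ap u0(2) by (auto simp: C1_approx_def)
  have cH: "continuous_on {0..} H"
    using H(1) by (auto intro!: continuous_at_imp_continuous_on dest: DERIV_isCont)
  have [measurable]: "U n \<in> borel_measurable borel" "G n \<in> borel_measurable borel" for n
    using C1_grad_measurable[OF C(1)] by auto
  have [measurable]: "u0 \<in> borel_measurable borel" "g0 \<in> borel_measurable borel" using u0 g0 by auto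
  have [measurable]: "(\<lambda>x. H (U n x)) \<in> borel_measurable borel" "(\<lambda>x. H' (U n x)) \<in> borel_measurable borel"
     "(\<lambda>x. H (u0 x)) \<in> borel_measurable borel" "(\<lambda>x. H' (u0 x)) \<in> borel_measurable borel" for n
    by (rule measurable_compose_nonneg[OF cH] measurable_compose_nonneg[OF H(2)]; simp add: C(2) u0)+
  have [measurable]: "B \<in> sets borel" using B by simp
  have M0: "0 \<le> M" using M[of 0] by simp
  have conv: "AE x in lborel. (\<lambda>n. U n x) \<longlonglongrightarrow> u0 x" using ap by (simp add: C1_approx_def)
  let ?L = "\<lambda>n x y. ennreal \<bar>H (U n x) - H (U n y)\<bar> * (indicator B x * indicator B y)"
  let ?Lim = "\<lambda>x y. ennreal \<bar>H (u0 x) - H (u0 y)\<bar> * (indicator B x * indicator B y)"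
  define a where "a n = (LINT x|lborel. indicator B x * (\<bar>H' (U n x)\<bar> * norm (g0 x)))" for n
  define a0 where "a0 = (LINT x|lborel. indicator B x * (\<bar>H' (u0 x)\<bar> * norm (g0 x)))"
  define b where "b n = M * (LINT x|lborel. indicator K x * norm (G n x - g0 x))" for n
  have dom: "norm (indicator B x * (\<bar>H' t\<bar> * norm (g0 x))) \<le> M * norm (g0 x)" if "0 \<le> t" for x t
    using M[OF that] M0 by (auto simp: indicator_def abs_mult intro!: mult_right_mono)
  have ia: "integrable lborel (\<lambda>x. indicator B x * (\<bar>H' (U n x)\<bar> * norm (g0 x)))" for n
    by (rule Bochner_Integration.integrable_bound[of _ "\<lambda>x. M * norm (g0 x)"])
       (use g0 dom[OF C(2)] M0 in \<open>auto intro!: AE_I2\<close>)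
  have la: "a \<longlonglongrightarrow> a0"
    unfolding a_def[abs_def] a0_def
  proof (rule integral_dominated_convergence[where w="\<lambda>x. M * norm (g0 x)"])
    show "AE x in lborel. (\<lambda>n. indicator B x * (\<bar>H' (U n x)\<bar> * norm (g0 x))) \<longlonglongrightarrow> indicator B x * (\<bar>H' (u0 x)\<bar> * norm (g0 x))"
      using conv
    proof eventually_elim
      case (elim x)
      show ?case
        by (intro tendsto_mult tendsto_const tendsto_rabs tendsto_compose_nonneg[OF H(2) elim] C)
    qed
    show "AE x in lborel. norm (indicator B x * (\<bar>H' (U n x)\<bar> * norm (g0 x))) \<le> M * norm (g0 x)" for n
      using dom[OF C(2)] by (intro AE_I2)
  qed (use g0 in auto)
  have lb: "b \<longlonglongrightarrow> M * 0"
    unfolding b_def[abs_def] using ap by (intro tendsto_mult tendsto_const) (simp add: C1_approx_def)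
  have iG: "integrable lborel (\<lambda>x. indicator K x * norm (G n x - g0 x))" for n
  proof -
    have "integrable lborel (\<lambda>x. norm (indicator K x *\<^sub>R (G n x - g0 x)))"
      using ap by (intro integrable_norm) (simp add: C1_approx_def)
    then show ?thesis by simp
  qed
  define k where "k = 2 * \<rho> * 2 ^ DIM('a) * measure lborel B"
  have k0: "0 \<le> k" using B by (simp add: k_def)
  have ek: "2 * (ennreal \<rho> * 2 ^ DIM('a) * emeasure lborel B * X) = ennreal k * X" for X
  proof -
    have "emeasure lborel B = ennreal (measure lborel B)"
      by (rule emeasure_eq_ennreal_measure) (use emeasure_lborel_ball_finite[of c \<rho>] B in auto)
    then show ?thesis
      using B(2) by (simp add: k_def ennreal_mult mult.assoc flip: ennreal_power)
  qed
  have step: "(\<integral>\<^sup>+x. \<integral>\<^sup>+y. ?L n x y \<partial>lborel \<partial>lborel) \<le> ennreal (k * (a n + b n))" for n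
  proof -
    have "(\<integral>\<^sup>+x. \<integral>\<^sup>+y. ?L n x y \<partial>lborel \<partial>lborel) \<le>
      ennreal k * (\<integral>\<^sup>+z. ennreal (norm (H' (U n z) *\<^sub>R G n z)) * indicator B z \<partial>lborel)"
      using poincare_C1[OF C1_grad_compose[OF C H] B(1,2)] unfolding ek .
    also have "(\<integral>\<^sup>+z. ennreal (norm (H' (U n z) *\<^sub>R G n z)) * indicator B z \<partial>lborel) \<le>
      (\<integral>\<^sup>+z. ennreal (indicator B z * (\<bar>H' (U n z)\<bar> * norm (g0 z)) + M * (indicator K z * norm (G n z - g0 z))) \<partial>lborel)"
    proof (rule nn_integral_mono)
      fix z
      show "ennreal (norm (H' (U n z) *\<^sub>R G n z)) * indicator B z \<le>
        ennreal (indicator B z * (\<bar>H' (U n z)\<bar> * norm (g0 z)) + M * (indicator K z * norm (G n z - g0 z)))"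
      proof (cases "z \<in> B")
        case True
        have "\<bar>H' (U n z)\<bar> * norm (G n z) \<le> \<bar>H' (U n z)\<bar> * (norm (g0 z) + norm (G n z - g0 z))"
          by (intro mult_left_mono norm_triangle_sub) auto
        also have "\<dots> \<le> \<bar>H' (U n z)\<bar> * norm (g0 z) + M * norm (G n z - g0 z)"
          using M[OF C(2)] by (auto simp: distrib_left intro!: mult_right_mono)
        finally show ?thesis using True B(3) by (auto intro!: ennreal_leI)
      qed auto
    qed
    also have "\<dots> = ennreal (LINT z|lborel. indicator B z * (\<bar>H' (U n z)\<bar> * norm (g0 z)) + M * (indicator K z * norm (G n z - g0 z)))"
      by (rule nn_integral_eq_integral) (use ia iG M0 in auto)
    also have "(LINT z|lborel. indicator B z * (\<bar>H' (U n z)\<bar> * norm (g0 z)) + M * (indicator K z * norm (G n z - g0 z))) = a n + b n"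
      using ia iG by (simp add: a_def b_def)
    finally show ?thesis
      using k0 by (simp add: mult_left_mono ennreal_mult')
  qed
  have "(\<integral>\<^sup>+x. \<integral>\<^sup>+y. ?Lim x y \<partial>lborel \<partial>lborel) \<le> (\<integral>\<^sup>+x. liminf (\<lambda>n. \<integral>\<^sup>+y. ?L n x y \<partial>lborel) \<partial>lborel)"
  proof (rule nn_integral_mono_AE)
    show "AE x in lborel. (\<integral>\<^sup>+y. ?Lim x y \<partial>lborel) \<le> liminf (\<lambda>n. \<integral>\<^sup>+y. ?L n x y \<partial>lborel)"
      using conv
    proof eventually_elim
      case x: (elim x)
      have "(\<integral>\<^sup>+y. ?Lim x y \<partial>lborel) \<le> (\<integral>\<^sup>+y. liminf (\<lambda>n. ?L n x y) \<partial>lborel)"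
      proof (rule nn_integral_mono_AE)
        show "AE y in lborel. ?Lim x y \<le> liminf (\<lambda>n. ?L n x y)"
          using conv
        proof eventually_elim
          case y: (elim y)
          have "(\<lambda>n. ennreal \<bar>H (U n x) - H (U n y)\<bar>) \<longlonglongrightarrow> ennreal \<bar>H (u0 x) - H (u0 y)\<bar>"
            by (intro tendsto_ennrealI tendsto_rabs tendsto_diff tendsto_compose_nonneg[OF cH x]
                tendsto_compose_nonneg[OF cH y] C)
          then have "(\<lambda>n. ?L n x y) \<longlonglongrightarrow> ?Lim x y"
            by (auto simp: indicator_def)
          then show ?case by (simp add: lim_imp_Liminf)
        qed
      qed
      also have "\<dots> \<le> liminf (\<lambda>n. \<integral>\<^sup>+y. ?L n x y \<partial>lborel)"
        by (rule nn_integral_liminf) measurable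
      finally show ?case .
    qed
  qed
  also have "\<dots> \<le> liminf (\<lambda>n. \<integral>\<^sup>+x. \<integral>\<^sup>+y. ?L n x y \<partial>lborel \<partial>lborel)"
    by (rule nn_integral_liminf) measurable
  also have "\<dots> \<le> liminf (\<lambda>n. ennreal (k * (a n + b n)))"
    by (intro Liminf_mono always_eventually allI step)
  also have "(\<lambda>n. ennreal (k * (a n + b n))) \<longlonglongrightarrow> ennreal (k * (a0 + M * 0))"
    by (intro tendsto_ennrealI tendsto_mult tendsto_const tendsto_add la lb)
  then have "liminf (\<lambda>n. ennreal (k * (a n + b n))) = ennreal (k * a0)"
    by (simp add: lim_imp_Liminf)
  finally show ?thesis by (simp add: k_def a0_def)
qed

section \<open>Pointwise bounds for the nonlocal integrand\<close>

lemma powr_convex: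
  fixes p :: real
  assumes "1 < p" "0 \<le> l" "l \<le> 1" "0 \<le> X" "0 \<le> Y"
  shows "(l * X + (1 - l) * Y) powr p \<le> l * X powr p + (1 - l) * Y powr p"
proof -
  define m where "m = l * X + (1 - l) * Y"
  have m: "0 \<le> m" using assms by (simp add: m_def)
  have "l * (m powr p + p * m powr (p - 1) * (X - m)) + (1 - l) * (m powr p + p * m powr (p - 1) * (Y - m))
     \<le> l * X powr p + (1 - l) * Y powr p"
    using assms m by (intro add_mono mult_left_mono powr_above_tangent) auto
  moreover have "l * (m powr p + p * m powr (p - 1) * (X - m)) + (1 - l) * (m powr p + p * m powr (p - 1) * (Y - m))
     = m powr p + p * m powr (p - 1) * (l * X + (1 - l) * Y - m)"
    by (simp add: algebra_simps)
  ultimately show ?thesis by (simp add: m_def)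
qed

lemma abs_powr_mult_diff:
  fixes a b :: real
  assumes "b < a" shows "\<bar>a - b\<bar> powr (p - 2) * (a - b) = (a - b) powr (p - 1)"
  using assms powr_add[of "a - b" "p - 2" 1] by simp

text \<open>
  With \<open>l = (a - b) / a\<close> write \<open>\<tau> = l ((\<tau> - \<tau>') / l) + (1 - l) (\<tau>' / (1 - l))\<close> and use the convexity
  of the \<open>p\<close>-th power. Multiplied by \<open>(a - b)\<^sup>p\<^sup>-\<^sup>1 a\<^sup>1\<^sup>-\<^sup>p\<close> this becomes the claim, since \<open>1 - l = b / a\<close>. If
  \<open>\<tau> \<le> \<tau>'\<close>, the left-hand side is not positive.
\<close>

lemma discrete_picone_ordered:
  fixes p a b \<tau> \<tau>' :: real
  assumes p: "1 < p" and ab: "0 < b" "b < a" and t: "0 \<le> \<tau>" "0 \<le> \<tau>'"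
  shows "\<bar>a - b\<bar> powr (p - 2) * (a - b) * (\<tau> powr p * a powr (1 - p) - \<tau>' powr p * b powr (1 - p)) \<le> \<bar>\<tau> - \<tau>'\<bar> powr p"
proof (cases "\<tau> \<le> \<tau>'")
  case True
  have "\<tau> powr p * a powr (1 - p) \<le> \<tau>' powr p * b powr (1 - p)"
    using p ab t True by (intro mult_mono powr_mono2 powr_mono2') auto
  then have "\<bar>a - b\<bar> powr (p - 2) * (a - b) * (\<tau> powr p * a powr (1 - p) - \<tau>' powr p * b powr (1 - p)) \<le> 0"
    using ab by (intro mult_nonneg_nonpos) auto
  then show ?thesis by (meson order_trans powr_ge_zero)
next
  case False
  define l where "l = (a - b) / a"
  have l: "0 < l" "l < 1" "1 - l = b / a" using ab by (auto simp: l_def field_simps)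
  define \<delta> where "\<delta> = \<tau> - \<tau>'"
  have d: "0 < \<delta>" using False by (simp add: \<delta>_def)
  have eq: "l * (\<delta> / l) + (1 - l) * (\<tau>' / (1 - l)) = \<tau>" using l ab by (simp add: \<delta>_def)
  have "(l * (\<delta> / l) + (1 - l) * (\<tau>' / (1 - l))) powr p \<le> l * (\<delta> / l) powr p + (1 - l) * (\<tau>' / (1 - l)) powr p"
    by (rule powr_convex[OF p]) (use l(1,2) d t in auto)
  then have "\<tau> powr p \<le> l * (\<delta> / l) powr p + (1 - l) * (\<tau>' / (1 - l)) powr p"
    unfolding eq .
  also have "l * (\<delta> / l) powr p = l powr (1 - p) * \<delta> powr p"
    using l d by (simp add: powr_divide powr_diff field_simps)
  also have "(1 - l) * (\<tau>' / (1 - l)) powr p = (1 - l) powr (1 - p) * \<tau>' powr p"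
    using l t by (simp add: powr_divide powr_diff field_simps)
  finally have le: "\<tau> powr p \<le> l powr (1 - p) * \<delta> powr p + (1 - l) powr (1 - p) * \<tau>' powr p" .
  have e1: "l powr (p - 1) * a powr (p - 1) = (a - b) powr (p - 1)"
    using ab l by (simp add: powr_mult[symmetric] l_def)
  have e2: "(1 - l) powr (1 - p) * a powr (1 - p) = b powr (1 - p)"
    using ab by (simp add: powr_mult[symmetric] l(3))
  have e3: "(a - b) powr (p - 1) * a powr (1 - p) * l powr (1 - p) = 1"
  proof -
    have "(a - b) powr (p - 1) * a powr (1 - p) * l powr (1 - p) =
      (l powr (p - 1) * l powr (1 - p)) * (a powr (p - 1) * a powr (1 - p))"
      by (simp add: e1[symmetric])
    also have "\<dots> = 1" using l ab by (simp flip: powr_add)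
    finally show ?thesis .
  qed
  have "(a - b) powr (p - 1) * (\<tau> powr p * a powr (1 - p)) \<le>
     (a - b) powr (p - 1) * ((l powr (1 - p) * \<delta> powr p + (1 - l) powr (1 - p) * \<tau>' powr p) * a powr (1 - p))"
    using le by (intro mult_left_mono mult_right_mono) auto
  also have "\<dots> = ((a - b) powr (p - 1) * a powr (1 - p) * l powr (1 - p)) * \<delta> powr p +
     (a - b) powr (p - 1) * (\<tau>' powr p * ((1 - l) powr (1 - p) * a powr (1 - p)))"
    by (simp only: ring_distribs ac_simps)
  also have "\<dots> = \<delta> powr p + (a - b) powr (p - 1) * (\<tau>' powr p * b powr (1 - p))"
    by (simp only: e2 e3 mult_1_left)
  finally show ?thesis
    unfolding abs_powr_mult_diff[OF ab(2)] using d by (simp add: right_diff_distrib \<delta>_def)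
qed

text \<open>
  The discrete Picone inequality. Both sides are symmetric under exchange of \<open>(a, \<tau>)\<close> and \<open>(b, \<tau>')\<close>, so the
  ordered case suffices.
\<close>

lemma discrete_picone:
  fixes p a b \<tau> \<tau>' :: real
  assumes p: "1 < p" and ab: "0 < a" "0 < b" and t: "0 \<le> \<tau>" "0 \<le> \<tau>'"
  shows "\<bar>a - b\<bar> powr (p - 2) * (a - b) * (\<tau> powr p * a powr (1 - p) - \<tau>' powr p * b powr (1 - p)) \<le> \<bar>\<tau> - \<tau>'\<bar> powr p"
proof -
  consider "b < a" | "a = b" | "a < b" by linarith
  then show ?thesis
  proof cases
    case 1
    then show ?thesis by (rule discrete_picone_ordered[OF p ab(2) _ t])
  next
    case 3
    from discrete_picone_ordered[OF p ab(1) this t(2,1)] show ?thesis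
      by (simp add: abs_minus_commute algebra_simps)
  qed simp
qed

text \<open>
  Only \<open>b < a\<close> matters, and then \<open>(a - b) / (a + d) \<le> 1 + b\<^sub>- / d\<close>. Here \<open>a\<close> and \<open>b\<close> are the values of \<open>u\<close> at a
  point of the support of the cutoff function and at a distant point.
\<close>

lemma tail_interaction_bound:
  fixes p a b d \<tau> :: real
  assumes p: "1 < p" and "0 \<le> a" "0 < d" "0 \<le> \<tau>" "\<tau> \<le> 1"
  shows "\<bar>a - b\<bar> powr (p - 2) * (a - b) * (\<tau> powr p * (a + d) powr (1 - p)) \<le>
     2 powr p * (1 + d powr (1 - p) * max (- b) 0 powr (p - 1))"
proof (cases "b < a")
  case True
  let ?m = "max (- b) 0"
  have "(a - b) powr (p - 1) * (a + d) powr (1 - p) = ((a - b) / (a + d)) powr (p - 1)"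
    using assms True by (simp add: powr_divide powr_diff field_simps)
  also have "\<dots> \<le> (1 + ?m / d) powr (p - 1)"
  proof (rule powr_mono2)
    have "(a - b) / (a + d) \<le> (a + d + ?m) / (a + d)" using assms by (intro divide_right_mono) auto
    also have "\<dots> = 1 + ?m / (a + d)" using assms by (simp add: field_simps)
    also have "\<dots> \<le> 1 + ?m / d" using assms by (intro add_left_mono divide_left_mono mult_pos_pos) auto
    finally show "(a - b) / (a + d) \<le> 1 + ?m / d" .
  qed (use assms True in auto)
  also have "\<dots> \<le> 2 powr (p - 1) * (1 powr (p - 1) + (?m / d) powr (p - 1))"
    using assms by (intro powr_add_le) auto
  also have "\<dots> \<le> 2 powr p * (1 powr (p - 1) + (?m / d) powr (p - 1))"
    using p by (intro mult_right_mono) auto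
  also have "(?m / d) powr (p - 1) = d powr (1 - p) * ?m powr (p - 1)"
    using assms by (simp add: powr_divide powr_diff field_simps)
  finally have le: "(a - b) powr (p - 1) * (a + d) powr (1 - p) \<le> 2 powr p * (1 + d powr (1 - p) * ?m powr (p - 1))"
    by simp
  have "\<tau> powr p \<le> 1" using assms powr_mono2[of p \<tau> 1] by simp
  then have "\<tau> powr p * ((a - b) powr (p - 1) * (a + d) powr (1 - p)) \<le> 1 * ((a - b) powr (p - 1) * (a + d) powr (1 - p))"
    by (intro mult_right_mono) auto
  moreover have "\<bar>a - b\<bar> powr (p - 2) * (a - b) * (\<tau> powr p * (a + d) powr (1 - p)) =
     \<tau> powr p * ((a - b) powr (p - 1) * (a + d) powr (1 - p))"
    unfolding abs_powr_mult_diff[OF True] by (simp only: ac_simps)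
  ultimately show ?thesis using le by linarith
next
  case False
  have "\<bar>a - b\<bar> powr (p - 2) * (a - b) * (\<tau> powr p * (a + d) powr (1 - p)) \<le> 0"
    using False by (intro mult_nonpos_nonneg mult_nonneg_nonpos) auto
  also have "0 \<le> 2 powr p * (1 + d powr (1 - p) * max (- b) 0 powr (p - 1))" by simp
  finally show ?thesis .
qed

text \<open>
  For \<open>a = N + s p\<close> with \<open>0 < s < 1\<close> the first factor makes the singularity at the origin integrable, and it dominates
  \<open>|\<eta> x - \<eta> y|\<^sup>p\<close> for \<open>z = x - y\<close>. At \<open>z = 0\<close> the value is \<open>0\<close>.
\<close>

definition trunc_kernel :: "real \<Rightarrow> real \<Rightarrow> real \<Rightarrow> 'a::euclidean_space \<Rightarrow> real" where
  "trunc_kernel p r a z = min 1 (norm z / r) powr p / norm z powr a"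

text \<open>
  The first summand accounts for the difference of the cutoff function between nearby points and for the constant in
  \<open>1 + (u\<^sub>- / d)\<^sup>p\<^sup>-\<^sup>1\<close> at distant ones. The second accounts for the other term there, with \<open>w\<close> for the power
  \<open>p - 1\<close> of the negative part \<open>u\<^sub>-\<close>; the factor \<open>2\<^sup>a\<close> comes from
  \<open>|y - x0| \<le> 2 |x - y|\<close>.
\<close>

definition nonlocal_majorant ::
  "real \<Rightarrow> real \<Rightarrow> real \<Rightarrow> real \<Rightarrow> real \<Rightarrow> 'a::euclidean_space \<Rightarrow> ('a \<Rightarrow> real) \<Rightarrow> 'a \<Rightarrow> 'a \<Rightarrow> real" where
  "nonlocal_majorant p r R a d x0 w x y =
     2 powr p * (indicator (ball x0 (8 * r)) x * trunc_kernel p r a (x - y) +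
       2 powr a * d powr (1 - p) * (indicator (ball x0 (8 * r)) x *
          (indicator (- ball x0 R) y * (w y / norm (y - x0) powr a))))"

text \<open>
  If \<open>y\<close> is in the ball of radius \<open>8 r\<close> too, this is the discrete Picone inequality for \<open>u + d\<close>. If not, then \<open>v y = 0\<close>, and
  either \<open>v x = 0\<close> or \<open>x\<close> lies in the ball of radius \<open>7 r\<close>, so that \<open>|x - y| \<ge> r\<close> and the truncation in the kernel
  is inactive.
\<close>

lemma nonlocal_pointwise_half:
  fixes u u0 \<eta> :: "'a::euclidean_space \<Rightarrow> real"
  assumes p: "1 < p" and r: "0 < r" "16 * r < R" and d: "0 < d" and a: "0 \<le> a"
    and eta: "\<And>x. 0 \<le> \<eta> x" "\<And>x. \<eta> x \<le> 1" "\<And>x y. \<bar>\<eta> x - \<eta> y\<bar> \<le> norm (x - y) / r"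
      "\<And>x. x \<notin> ball x0 (7 * r) \<Longrightarrow> \<eta> x = 0"
    and u0: "\<And>x. 0 \<le> u0 x"
    and Px: "x \<in> ball x0 (8 * r) \<Longrightarrow> u0 x = u x"
    and Py: "y \<in> ball x0 (8 * r) \<Longrightarrow> u0 y = u y" "y \<in> ball x0 R \<Longrightarrow> 0 \<le> u y"
    and v: "\<And>x. v x = \<eta> x powr p * (u0 x + d) powr (1 - p)"
    and x: "x \<in> ball x0 (8 * r)"
  shows "\<bar>u x - u y\<bar> powr (p - 2) * (u x - u y) * (v x - v y) / norm (x - y) powr a
      \<le> nonlocal_majorant p r R a d x0 (\<lambda>y. neg_part u y powr (p - 1)) x y"
proof -
  let ?N = "norm (x - y) powr a"
  let ?F = "\<bar>u x - u y\<bar> powr (p - 2) * (u x - u y) * (v x - v y)"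
  let ?w = "neg_part u y powr (p - 1)"
  let ?T = "indicator (- ball x0 R) y * (?w / norm (y - x0) powr a)"
  have k0: "0 \<le> trunc_kernel p r a (x - y)" by (simp add: trunc_kernel_def)
  have T0: "0 \<le> 2 powr a * d powr (1 - p) * ?T" by simp
  have maj: "nonlocal_majorant p r R a d x0 (\<lambda>y. neg_part u y powr (p - 1)) x y =
      2 powr p * (trunc_kernel p r a (x - y) + 2 powr a * d powr (1 - p) * ?T)"
    using x by (simp add: nonlocal_majorant_def)
  have p2: "1 \<le> 2 powr p" using p by (simp add: ge_one_powr_ge_zero)
  show ?thesis
  proof (cases "y \<in> ball x0 (8 * r)")
    case True
    have "?F \<le> \<bar>\<eta> x - \<eta> y\<bar> powr p"
      using discrete_picone[OF p, of "u0 x + d" "u0 y + d" "\<eta> x" "\<eta> y"] u0[of x] u0[of y] d eta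
      by (simp add: v Px[OF x] Py(1)[OF True] add_nonneg_pos)
    also have "\<dots> \<le> min 1 (norm (x - y) / r) powr p"
    proof (rule powr_mono2)
      have "\<bar>\<eta> x - \<eta> y\<bar> \<le> 1" using eta(1,2)[of x] eta(1,2)[of y] by linarith
      then show "\<bar>\<eta> x - \<eta> y\<bar> \<le> min 1 (norm (x - y) / r)" using eta(3)[of x y] by simp
    qed (use p in auto)
    finally have "?F / ?N \<le> trunc_kernel p r a (x - y)"
      unfolding trunc_kernel_def by (intro divide_right_mono) auto
    also have "\<dots> \<le> trunc_kernel p r a (x - y) + 2 powr a * d powr (1 - p) * ?T" using T0 by linarith
    also have "\<dots> \<le> 2 powr p * (trunc_kernel p r a (x - y) + 2 powr a * d powr (1 - p) * ?T)"
      using mult_right_mono[OF p2, of "trunc_kernel p r a (x - y) + 2 powr a * d powr (1 - p) * ?T"] k0 T0 by simp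
    finally show ?thesis unfolding maj .
  next
    case y: False
    have vy: "v y = 0" using eta(4)[of y] y r by (simp add: v)
    show ?thesis
    proof (cases "x \<in> ball x0 (7 * r)")
      case False
      then have "v x = 0" using eta(4)[of x] by (simp add: v)
      then show ?thesis unfolding maj vy using k0 T0 by simp
    next
      case x7: True
      have dxy: "dist y x0 \<le> norm (x - y) + 7 * r"
        using x7 dist_triangle[of y x0 x] by (simp add: dist_norm norm_minus_commute)
      have Nr: "r \<le> norm (x - y)" using y dxy by (simp add: dist_commute)
      then have pos: "0 < norm (x - y)" using r by linarith
      have k: "trunc_kernel p r a (x - y) = 1 / ?N"
        using Nr r by (simp add: trunc_kernel_def min_def field_simps)
      have "?F \<le> 2 powr p * (1 + d powr (1 - p) * ?w)"
        using tail_interaction_bound[OF p u0 d eta(1) eta(2), of x "u y" x]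
        by (simp add: v[of x] vy Px[OF x] neg_part_def)
      then have "?F / ?N \<le> 2 powr p * (1 + d powr (1 - p) * ?w) / ?N"
        by (intro divide_right_mono) auto
      also have "\<dots> = 2 powr p * (trunc_kernel p r a (x - y) + d powr (1 - p) * (?w / ?N))"
        by (simp add: k add_divide_distrib ring_distribs)
      also have "\<dots> \<le> 2 powr p * (trunc_kernel p r a (x - y) + 2 powr a * d powr (1 - p) * ?T)"
      proof -
        have "?w / ?N \<le> 2 powr a * ?T"
        proof (cases "y \<in> ball x0 R")
          case True
          then show ?thesis using Py(2)[OF True] by (simp add: neg_part_def)
        next
          case False
          have n: "norm (y - x0) = dist y x0" by (simp add: dist_norm)
          have R: "16 * r < norm (y - x0)" using False r by (simp add: dist_norm norm_minus_commute)
          have "norm (y - x0) / 2 \<le> norm (x - y)" using dxy R n r by linarith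
          then have "(norm (y - x0) / 2) powr a \<le> ?N" using a by (intro powr_mono2) auto
          then have "?w / ?N \<le> ?w / (norm (y - x0) / 2) powr a"
            using R r by (intro divide_left_mono mult_pos_pos) auto
          also have "\<dots> = 2 powr a * (?w / norm (y - x0) powr a)" by (simp add: powr_divide)
          finally show ?thesis using False by simp
        qed
        then have "d powr (1 - p) * (?w / ?N) \<le> d powr (1 - p) * (2 powr a * ?T)"
          by (intro mult_left_mono) auto
        then show ?thesis by (intro mult_left_mono add_left_mono) (auto simp: ac_simps)
      qed
      finally show ?thesis unfolding maj .
    qed
  qed
qed

text \<open>
  The integrand is symmetric in \<open>(x, y)\<close> and vanishes if both points are outside the support of the cutoff
  function.
\<close>

lemma nonlocal_pointwise:
  fixes u u0 \<eta> :: "'a::euclidean_space \<Rightarrow> real"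
  assumes p: "1 < p" and r: "0 < r" "16 * r < R" and d: "0 < d" and a: "0 \<le> a"
    and eta: "\<And>x. 0 \<le> \<eta> x" "\<And>x. \<eta> x \<le> 1" "\<And>x y. \<bar>\<eta> x - \<eta> y\<bar> \<le> norm (x - y) / r"
      "\<And>x. x \<notin> ball x0 (7 * r) \<Longrightarrow> \<eta> x = 0"
    and u0: "\<And>x. 0 \<le> u0 x"
    and Px: "x \<in> ball x0 (8 * r) \<Longrightarrow> u0 x = u x" "x \<in> ball x0 R \<Longrightarrow> 0 \<le> u x"
    and Py: "y \<in> ball x0 (8 * r) \<Longrightarrow> u0 y = u y" "y \<in> ball x0 R \<Longrightarrow> 0 \<le> u y"
    and v: "\<And>x. v x = \<eta> x powr p * (u0 x + d) powr (1 - p)"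
  shows "\<bar>u x - u y\<bar> powr (p - 2) * (u x - u y) * (v x - v y) / norm (x - y) powr a
      \<le> nonlocal_majorant p r R a d x0 (\<lambda>y. neg_part u y powr (p - 1)) x y +
        nonlocal_majorant p r R a d x0 (\<lambda>y. neg_part u y powr (p - 1)) y x"
proof -
  let ?F = "\<lambda>x y. \<bar>u x - u y\<bar> powr (p - 2) * (u x - u y) * (v x - v y) / norm (x - y) powr a"
  let ?G = "nonlocal_majorant p r R a d x0 (\<lambda>y. neg_part u y powr (p - 1))"
  have G0: "0 \<le> ?G x y" for x y
    unfolding nonlocal_majorant_def trunc_kernel_def
    by (intro mult_nonneg_nonneg add_nonneg_nonneg divide_nonneg_nonneg) auto
  have sym: "?F x y = ?F y x"
    by (simp add: abs_minus_commute norm_minus_commute algebra_simps)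
  consider "x \<in> ball x0 (8 * r)" | "y \<in> ball x0 (8 * r)" | "x \<notin> ball x0 (8 * r)" "y \<notin> ball x0 (8 * r)" by blast
  then show ?thesis
  proof cases
    case 1
    have "?F x y \<le> ?G x y"
      by (rule nonlocal_pointwise_half[OF p r d a eta u0 Px(1) Py v 1])
    then show ?thesis using G0[of y x] by linarith
  next
    case 2
    have "?F y x \<le> ?G y x"
      by (rule nonlocal_pointwise_half[OF p r d a eta u0 Py(1) Px v 2])
    then show ?thesis using G0[of x y] sym by linarith
  next
    case 3
    then have "v x = 0" "v y = 0" using eta(4)[of x] eta(4)[of y] r by (auto simp: v)
    then show ?thesis using G0[of y x] G0[of x y] by simp
  qed
qed

section \<open>The truncated kernel\<close>

lemma radial_kernel_integral:
  fixes p r s :: real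
  assumes p: "1 < p" and r: "0 < r" and s: "0 < s" "s < 1"
  shows "(\<integral>\<^sup>+\<tau>. ennreal (min 1 (\<tau> / r) powr p * \<tau> powr (- (s * p) - 1)) * indicator {0<..} \<tau> \<partial>lborel)
     \<le> ennreal (r powr (- (s * p)) * (1 / (p - s * p) + 1 / (s * p)))"
proof -
  have sp: "0 < s * p" "s * p < p" using s p by auto
  let ?f = "\<lambda>\<tau>. r powr (- p) * \<tau> powr (p - s * p - 1)"
  let ?g = "\<lambda>\<tau>. \<tau> powr (- (s * p) - 1)"
  have "((\<lambda>\<tau>. \<tau> powr (p - s * p - 1)) has_integral (r powr (p - s * p - 1 + 1) / (p - s * p - 1 + 1))) {0..r}"
    by (rule has_integral_powr_from_0) (use sp r in auto)
  then have "((\<lambda>\<tau>. \<tau> powr (p - s * p - 1)) has_integral (r powr (p - s * p) / (p - s * p))) {0..r}"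
    by simp
  then have If: "(?f has_integral (r powr (- p) * (r powr (p - s * p) / (p - s * p)))) {0..r}"
    by (rule has_integral_mult_right)
  have Ig: "(?g has_integral (- (r powr (- (s * p) - 1 + 1)) / (- (s * p) - 1 + 1))) {r..}"
    by (rule has_integral_powr_to_inf) (use sp r in auto)
  have "(\<integral>\<^sup>+\<tau>. ennreal (min 1 (\<tau> / r) powr p * \<tau> powr (- (s * p) - 1)) * indicator {0<..} \<tau> \<partial>lborel) \<le>
    (\<integral>\<^sup>+\<tau>. ennreal (?f \<tau>) * indicator {0..r} \<tau> + ennreal (?g \<tau>) * indicator {r..} \<tau> \<partial>lborel)"
  proof (rule nn_integral_mono)
    fix \<tau> :: real
    show "ennreal (min 1 (\<tau> / r) powr p * \<tau> powr (- (s * p) - 1)) * indicator {0<..} \<tau> \<le>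
       ennreal (?f \<tau>) * indicator {0..r} \<tau> + ennreal (?g \<tau>) * indicator {r..} \<tau>"
    proof (cases "0 < \<tau>")
      case t: True
      show ?thesis
      proof (cases "\<tau> < r")
        case True
        have "min 1 (\<tau> / r) powr p * \<tau> powr (- (s * p) - 1) = ?f \<tau>"
        proof -
          have "min 1 (\<tau> / r) powr p = \<tau> powr p * r powr (- p)"
            using True t r by (simp add: min_def powr_divide powr_minus_divide)
          moreover have "\<tau> powr p * \<tau> powr (- (s * p) - 1) = \<tau> powr (p - s * p - 1)"
            by (subst powr_add[symmetric]) (simp add: algebra_simps)
          ultimately show ?thesis by (simp add: ac_simps)
        qed
        then show ?thesis using True t by simp
      next
        case False
        then have "min 1 (\<tau> / r) = 1" using r by (simp add: min_def field_simps)
        then show ?thesis using False t by simp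
      qed
    qed simp
  qed
  also have "\<dots> = (\<integral>\<^sup>+\<tau>. ennreal (?f \<tau>) * indicator {0..r} \<tau> \<partial>lborel) + (\<integral>\<^sup>+\<tau>. ennreal (?g \<tau>) * indicator {r..} \<tau> \<partial>lborel)"
    by (rule nn_integral_add) measurable
  also have "\<dots> = ennreal (r powr (- p) * (r powr (p - s * p) / (p - s * p))) +
      ennreal (- (r powr (- (s * p) - 1 + 1)) / (- (s * p) - 1 + 1))"
    using nn_integral_has_integral_lebesgue'[OF _ If] nn_integral_has_integral_lebesgue'[OF _ Ig] by simp
  also have "\<dots> = ennreal (r powr (- p) * (r powr (p - s * p) / (p - s * p)) + r powr (- (s * p)) / (s * p))"
  proof -
    have "0 \<le> r powr (- p) * (r powr (p - s * p) / (p - s * p))" "0 \<le> r powr (- (s * p)) / (s * p)"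
      using sp s by (auto intro!: mult_nonneg_nonneg divide_nonneg_nonneg simp del: zero_le_mult_iff)
    moreover have "- (r powr (- (s * p) - 1 + 1)) / (- (s * p) - 1 + 1) = r powr (- (s * p)) / (s * p)" by simp
    ultimately show ?thesis by (simp only: ennreal_plus)
  qed
  also have "r powr (- p) * (r powr (p - s * p) / (p - s * p)) = r powr (- (s * p)) / (p - s * p)"
    using r by (simp flip: powr_add)
  finally show ?thesis by (simp add: field_simps)
qed

lemma trunc_kernel_measurable[measurable]: "trunc_kernel p r a \<in> borel_measurable borel"
  unfolding trunc_kernel_def[abs_def] by measurable

text \<open>
  A layer cake computation. The kernel at \<open>|z| = t\<close>, divided by \<open>t\<close>, is at most \<open>\<Psi> \<tau>\<close> for every \<open>\<tau>\<close> in \<open>[t, 2 t]\<close>, an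
  interval of length \<open>t\<close>; so the kernel is at most the integral of \<open>\<Psi>\<close> over \<open>\<tau> \<ge> |z|\<close>. By Tonelli's theorem the
  integral over \<open>z\<close> becomes the volume of the ball of radius \<open>\<tau>\<close>, and a one-dimensional integral remains.
\<close>

lemma trunc_kernel_integral:
  fixes p r s :: real
  assumes p: "1 < p" and r: "0 < r" and s: "0 < s" "s < 1"
  shows "(\<integral>\<^sup>+z. ennreal (trunc_kernel p r (real DIM('a) + s * p) (z::'a::euclidean_space)) \<partial>lborel)
    \<le> ennreal (2 powr (real DIM('a) + s * p + 1) * unit_ball_vol (real DIM('a)) *
         (r powr (- (s * p)) * (1 / (p - s * p) + 1 / (s * p))))"
proof -
  define a where "a = real DIM('a) + s * p"
  have a0: "0 < a" using s p by (simp add: a_def add_pos_pos)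
  define \<Psi> where "\<Psi> \<tau> = 2 powr (a + 1) * (min 1 (\<tau> / r) powr p * \<tau> powr (- a - 1))" for \<tau>
  have [measurable]: "\<Psi> \<in> borel_measurable borel" unfolding \<Psi>_def[abs_def] by measurable
  define V where "V = unit_ball_vol (real DIM('a))"
  have V0: "0 < V" unfolding V_def by simp
  have "(\<integral>\<^sup>+z. ennreal (trunc_kernel p r a (z::'a)) \<partial>lborel) \<le>
    (\<integral>\<^sup>+z. \<integral>\<^sup>+\<tau>. ennreal (\<Psi> \<tau>) * indicator {norm (z::'a)..} \<tau> * indicator {0<..} \<tau> \<partial>lborel \<partial>lborel)"
  proof (rule nn_integral_mono)
    fix z :: 'a
    show "ennreal (trunc_kernel p r a z) \<le> (\<integral>\<^sup>+\<tau>. ennreal (\<Psi> \<tau>) * indicator {norm z..} \<tau> * indicator {0<..} \<tau> \<partial>lborel)"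
    proof (cases "z = 0")
      case True
      then show ?thesis using p by (simp add: trunc_kernel_def)
    next
      case False
      define t where "t = norm z"
      have t: "0 < t" using False by (simp add: t_def)
      have "ennreal (trunc_kernel p r a z) = ennreal (trunc_kernel p r a z / t) * ennreal t"
        using t by (simp add: ennreal_mult'[symmetric] trunc_kernel_def)
      also have "\<dots> = (\<integral>\<^sup>+\<tau>. ennreal (trunc_kernel p r a z / t) * indicator {t..2 * t} \<tau> \<partial>lborel)"
        using t by (simp add: nn_integral_cmult_indicator)
      also have "\<dots> \<le> (\<integral>\<^sup>+\<tau>. ennreal (\<Psi> \<tau>) * indicator {norm z..} \<tau> * indicator {0<..} \<tau> \<partial>lborel)"
      proof (rule nn_integral_mono)
        fix \<tau> :: real
        show "ennreal (trunc_kernel p r a z / t) * indicator {t..2 * t} \<tau> \<le> ennreal (\<Psi> \<tau>) * indicator {norm z..} \<tau> * indicator {0<..} \<tau>"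
        proof (cases "\<tau> \<in> {t..2 * t}")
          case True
          have "trunc_kernel p r a z / t = min 1 (t / r) powr p * t powr (- a - 1)"
            using t by (simp add: trunc_kernel_def t_def[symmetric] powr_diff powr_minus_divide)
          also have "\<dots> \<le> min 1 (\<tau> / r) powr p * (\<tau> / 2) powr (- a - 1)"
            using True t a0 r p
            by (intro mult_mono powr_mono2 powr_mono2' min.mono divide_right_mono) auto
          also have "(\<tau> / 2) powr (- a - 1) = 2 powr (a + 1) * \<tau> powr (- a - 1)"
          proof -
            have "(\<tau> / 2) powr (- a - 1) = \<tau> powr (- a - 1) / 2 powr (- a - 1)"
              by (rule powr_divide)
            also have "(2::real) powr (- a - 1) = 1 / 2 powr (a + 1)"
              using powr_minus_divide[of 2 "a + 1"] by (simp only: minus_add_distrib diff_conv_add_uminus)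
            finally show ?thesis by simp
          qed
          finally have "trunc_kernel p r a z / t \<le> \<Psi> \<tau>" by (simp add: \<Psi>_def ac_simps)
          moreover have "0 < \<tau>" using True t by auto
          ultimately show ?thesis using True by (simp add: t_def ennreal_leI)
        qed simp
      qed
      finally show ?thesis .
    qed
  qed
  also have "\<dots> = (\<integral>\<^sup>+z. \<integral>\<^sup>+\<tau>. ennreal (\<Psi> \<tau>) * indicator {0<..} \<tau> * indicator {x. norm (fst x) \<le> snd x} (z::'a, \<tau>) \<partial>lborel \<partial>lborel)"
    by (intro nn_integral_cong) (auto simp: indicator_def)
  also have "\<dots> = (\<integral>\<^sup>+\<tau>. \<integral>\<^sup>+z. ennreal (\<Psi> \<tau>) * indicator {0<..} \<tau> * indicator {x. norm (fst x) \<le> snd x} (z::'a, \<tau>) \<partial>lborel \<partial>lborel)"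
    by (rule lborel_pair.Fubini') measurable
  also have "\<dots> = (\<integral>\<^sup>+\<tau>. ennreal (2 powr (a + 1) * V) *
      (ennreal (min 1 (\<tau> / r) powr p * \<tau> powr (- (s * p) - 1)) * indicator {0<..} \<tau>) \<partial>lborel)"
  proof (rule nn_integral_cong)
    fix \<tau> :: real
    have "(\<integral>\<^sup>+z. ennreal (\<Psi> \<tau>) * indicator {0<..} \<tau> * indicator {x. norm (fst x) \<le> snd x} (z::'a, \<tau>) \<partial>lborel)
      = (\<integral>\<^sup>+z. ennreal (\<Psi> \<tau>) * indicator {0<..} \<tau> * indicator (cball 0 \<tau>) (z::'a) \<partial>lborel)"
      by (intro nn_integral_cong) (auto simp: indicator_def)
    also have "\<dots> = ennreal (\<Psi> \<tau>) * indicator {0<..} \<tau> * emeasure lborel (cball (0::'a) \<tau>)"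
      by (rule nn_integral_cmult_indicator) simp
    also have "\<dots> = ennreal (2 powr (a + 1) * V) *
      (ennreal (min 1 (\<tau> / r) powr p * \<tau> powr (- (s * p) - 1)) * indicator {0<..} \<tau>)"
    proof (cases "0 < \<tau>")
      case True
      have "\<tau> ^ DIM('a) = \<tau> powr real DIM('a)" using True by (simp add: powr_realpow)
      then have "\<tau> powr (- a - 1) * \<tau> ^ DIM('a) = \<tau> powr (- (s * p) - 1)"
        by (simp add: a_def flip: powr_add)
      then have "\<Psi> \<tau> * (V * \<tau> ^ DIM('a)) = 2 powr (a + 1) * V * (min 1 (\<tau> / r) powr p * \<tau> powr (- (s * p) - 1))"
        by (simp add: \<Psi>_def ac_simps)
      then show ?thesis
        using True V0 by (simp add: emeasure_cball V_def[symmetric] ennreal_mult'[symmetric] \<Psi>_def ennreal_mult''[symmetric])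
    qed simp
    finally show "(\<integral>\<^sup>+z. ennreal (\<Psi> \<tau>) * indicator {0<..} \<tau> * indicator {x. norm (fst x) \<le> snd x} (z::'a, \<tau>) \<partial>lborel) =
      ennreal (2 powr (a + 1) * V) * (ennreal (min 1 (\<tau> / r) powr p * \<tau> powr (- (s * p) - 1)) * indicator {0<..} \<tau>)" .
  qed
  also have "\<dots> = ennreal (2 powr (a + 1) * V) *
     (\<integral>\<^sup>+\<tau>. ennreal (min 1 (\<tau> / r) powr p * \<tau> powr (- (s * p) - 1)) * indicator {0<..} \<tau> \<partial>lborel)"
    by (rule nn_integral_cmult) measurable
  also have "\<dots> \<le> ennreal (2 powr (a + 1) * V) * ennreal (r powr (- (s * p)) * (1 / (p - s * p) + 1 / (s * p)))"
    by (intro mult_left_mono radial_kernel_integral assms) simp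
  also have "\<dots> = ennreal (2 powr (a + 1) * V * (r powr (- (s * p)) * (1 / (p - s * p) + 1 / (s * p))))"
    using V0 by (intro ennreal_mult'[symmetric]) simp
  finally show ?thesis by (simp add: a_def V_def)
qed

section \<open>The nonlocal energy of the test function\<close>

text \<open>
  A Bochner integral is \<open>0\<close> for functions that are not integrable, which keeps the inequality true for them. It reduces
  upper bounds for the nonlocal form to bounds for integrals of nonnegative functions.
\<close>

lemma ennreal_integral_le_nn_integral: "ennreal (integral\<^sup>L M f) \<le> (\<integral>\<^sup>+x. ennreal (f x) \<partial>M)"
proof (cases "integrable M f")
  case True
  have "integral\<^sup>L M f \<le> (LINT x|M. max 0 (f x))"
    using True by (intro integral_mono) auto
  then have "ennreal (integral\<^sup>L M f) \<le> ennreal (LINT x|M. max 0 (f x))" by (rule ennreal_leI)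
  also have "\<dots> = (\<integral>\<^sup>+x. ennreal (max 0 (f x)) \<partial>M)"
    using True by (intro nn_integral_eq_integral[symmetric]) auto
  also have "\<dots> = (\<integral>\<^sup>+x. ennreal (f x) \<partial>M)"
  proof (rule nn_integral_cong)
    fix x show "ennreal (max 0 (f x)) = ennreal (f x)"
      by (cases "0 \<le> f x") (auto simp: max_def ennreal_neg)
  qed
  finally show ?thesis .
next
  case False
  then show ?thesis by (simp add: not_integrable_integral_eq)
qed

lemma AE_lborel_prod:
  fixes P :: "'a::euclidean_space \<Rightarrow> bool"
  assumes "AE x in lborel. P x"
  shows "AE z in lborel. P (fst z) \<and> P (snd (z :: 'a \<times> 'a))"
proof -
  obtain N where N: "N \<in> null_sets lborel" "{x. \<not> P x} \<subseteq> N"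
    using assms by (auto simp: eventually_ae_filter)
  have "N \<times> UNIV \<in> null_sets (lborel \<Otimes>\<^sub>M (lborel::'a measure))" "UNIV \<times> N \<in> null_sets ((lborel::'a measure) \<Otimes>\<^sub>M lborel)"
    using N(1) by (intro lborel.times_in_null_sets1 lborel.times_in_null_sets2; simp)+
  then have "N \<times> UNIV \<union> UNIV \<times> N \<in> null_sets (lborel :: ('a \<times> 'a) measure)"
    unfolding lborel_prod by (rule null_sets.Un)
  then show ?thesis
    by (rule AE_I') (use N(2) in auto)
qed

text \<open>
  Tonelli's theorem; the integral of the kernel in \<open>y\<close> does not depend on \<open>x\<close>, and the two orders of the arguments
  contribute equally.
\<close>

lemma nonlocal_majorant_integral:
  fixes w :: "'a::euclidean_space \<Rightarrow> real"
  assumes [measurable]: "w \<in> borel_measurable borel" and w: "\<And>y. 0 \<le> w y"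
  shows "(\<integral>\<^sup>+z. ennreal (nonlocal_majorant p r R a d x0 w (fst z) (snd z) + nonlocal_majorant p r R a d x0 w (snd z) (fst z)) \<partial>lborel)
    = 2 * (ennreal (2 powr p) * emeasure lborel (ball x0 (8 * r)) *
       ((\<integral>\<^sup>+z. ennreal (trunc_kernel p r a (z::'a)) \<partial>lborel) +
        ennreal (2 powr a * d powr (1 - p)) * (\<integral>\<^sup>+y. ennreal (w y / norm (y - x0) powr a) * indicator (- ball x0 R) y \<partial>lborel)))"
proof -
  let ?G = "nonlocal_majorant p r R a d x0 w"
  let ?B = "ball x0 (8 * r)"
  let ?T = "\<lambda>y. ennreal (w y / norm (y - x0) powr a) * indicator (- ball x0 R) y"
  have k0: "0 \<le> trunc_kernel p r a z" for z :: 'a by (simp add: trunc_kernel_def)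
  have G0: "0 \<le> ?G x y" for x y
    unfolding nonlocal_majorant_def using k0 w by (intro mult_nonneg_nonneg add_nonneg_nonneg divide_nonneg_nonneg) auto
  have [measurable]: "(\<lambda>x. ?G (f x) (g x)) \<in> borel_measurable M"
    if [measurable]: "f \<in> borel_measurable M" "g \<in> borel_measurable M" for f g and M :: "'c measure"
  proof -
    have "(\<lambda>x. trunc_kernel p r a (f x - g x)) \<in> borel_measurable M"
      by (rule measurable_compose[OF _ trunc_kernel_measurable]) (intro borel_measurable_diff that)
    moreover have "(\<lambda>x. indicator ?B (f x) :: real) \<in> borel_measurable M"
      by (rule measurable_compose[OF that(1) borel_measurable_indicator]) simp
    moreover have "(\<lambda>x. indicator (- ball x0 R) (g x) :: real) \<in> borel_measurable M"
      by (rule measurable_compose[OF that(2) borel_measurable_indicator]) simp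
    moreover have "(\<lambda>x. w (g x) / norm (g x - x0) powr a) \<in> borel_measurable M"
      by (rule measurable_compose[OF that(2), of "\<lambda>y. w y / norm (y - x0) powr a"]) measurable
    ultimately show ?thesis
      unfolding nonlocal_majorant_def
      by (intro borel_measurable_times borel_measurable_add borel_measurable_const)
  qed
  have eG: "ennreal (?G x y) = ennreal (2 powr p) * indicator ?B x *
      (ennreal (trunc_kernel p r a (x - y)) + ennreal (2 powr a * d powr (1 - p)) * ?T y)" for x y
  proof (cases "x \<in> ?B")
    case True
    let ?t = "indicator (- ball x0 R) y * (w y / norm (y - x0) powr a)"
    have "0 \<le> ?t" using w[of y] by simp
    have "ennreal (A * (k + c * t)) = ennreal A * (ennreal k + ennreal c * ennreal t)"
      if "0 \<le> A" "0 \<le> k" "0 \<le> c" "0 \<le> t" for A k c t :: real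
      using that by (simp add: ennreal_mult ennreal_plus)
    from this[OF _ k0 _ \<open>0 \<le> ?t\<close>]
    have "ennreal (2 powr p * (trunc_kernel p r a (x - y) + 2 powr a * d powr (1 - p) * ?t)) =
      ennreal (2 powr p) * (ennreal (trunc_kernel p r a (x - y)) + ennreal (2 powr a * d powr (1 - p)) * ennreal ?t)"
      by simp
    moreover have "ennreal ?t = ?T y" by (simp add: indicator_def)
    ultimately show ?thesis using True by (simp add: nonlocal_majorant_def)
  qed (simp add: nonlocal_majorant_def)
  have half: "(\<integral>\<^sup>+x. \<integral>\<^sup>+y. ennreal (?G x y) \<partial>lborel \<partial>lborel) =
      ennreal (2 powr p) * emeasure lborel ?B * ((\<integral>\<^sup>+z. ennreal (trunc_kernel p r a (z::'a)) \<partial>lborel) +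
        ennreal (2 powr a * d powr (1 - p)) * (\<integral>\<^sup>+y. ?T y \<partial>lborel))" (is "_ = _ * _ * ?X")
  proof -
    have "(\<integral>\<^sup>+y. ennreal (?G x y) \<partial>lborel) = ennreal (2 powr p) * indicator ?B x * ?X" for x
    proof -
      have "(\<integral>\<^sup>+y. ennreal (?G x y) \<partial>lborel) = ennreal (2 powr p) * indicator ?B x *
        ((\<integral>\<^sup>+y. ennreal (trunc_kernel p r a (x - y)) \<partial>lborel) + (\<integral>\<^sup>+y. ennreal (2 powr a * d powr (1 - p)) * ?T y \<partial>lborel))"
        unfolding eG by (subst nn_integral_cmult) (auto simp: nn_integral_add)
      also have "(\<integral>\<^sup>+y. ennreal (trunc_kernel p r a (x - y)) \<partial>lborel) = (\<integral>\<^sup>+y. ennreal (trunc_kernel p r a (y::'a)) \<partial>lborel)"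
        by (rule nn_integral_reflect[of "\<lambda>y. ennreal (trunc_kernel p r a y)"]) measurable
      also have "(\<integral>\<^sup>+y. ennreal (2 powr a * d powr (1 - p)) * ?T y \<partial>lborel) = ennreal (2 powr a * d powr (1 - p)) * (\<integral>\<^sup>+y. ?T y \<partial>lborel)"
        by (rule nn_integral_cmult) measurable
      finally show ?thesis .
    qed
    then have "(\<integral>\<^sup>+x. \<integral>\<^sup>+y. ennreal (?G x y) \<partial>lborel \<partial>lborel) = (\<integral>\<^sup>+x. (ennreal (2 powr p) * ?X) * indicator ?B x \<partial>lborel)"
      by (simp add: ac_simps)
    also have "\<dots> = (ennreal (2 powr p) * ?X) * emeasure lborel ?B"
      by (rule nn_integral_cmult_indicator) simp
    finally show ?thesis by (simp only: ac_simps)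
  qed
  have "(\<integral>\<^sup>+z. ennreal (?G (fst z) (snd z) + ?G (snd z) (fst z)) \<partial>lborel) =
    (\<integral>\<^sup>+z. ennreal (?G (fst z) (snd z) + ?G (snd z) (fst z)) \<partial>(lborel \<Otimes>\<^sub>M lborel))"
    by (simp only: lborel_prod)
  also have "\<dots> = (\<integral>\<^sup>+x. \<integral>\<^sup>+y. ennreal (?G x y + ?G y x) \<partial>lborel \<partial>lborel)"
    by (subst lborel.nn_integral_fst[symmetric]) auto
  also have "\<dots> = (\<integral>\<^sup>+x. \<integral>\<^sup>+y. ennreal (?G x y) \<partial>lborel \<partial>lborel) + (\<integral>\<^sup>+x. \<integral>\<^sup>+y. ennreal (?G y x) \<partial>lborel \<partial>lborel)"
    using G0 by (simp add: nn_integral_add)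
  also have "(\<integral>\<^sup>+x. \<integral>\<^sup>+y. ennreal (?G y x) \<partial>lborel \<partial>lborel) = (\<integral>\<^sup>+y. \<integral>\<^sup>+x. ennreal (?G y x) \<partial>lborel \<partial>lborel)"
    by (rule lborel_pair.Fubini') measurable
  finally show ?thesis unfolding half by (simp add: mult_2)
qed

text \<open>
  The inner integral in \<open>tail_integral\<close>, as a function of \<open>s\<close>.
\<close>

definition tail_slice :: "real \<Rightarrow> ('a::euclidean_space \<Rightarrow> real) \<Rightarrow> 'a \<Rightarrow> real \<Rightarrow> real \<Rightarrow> ennreal" where
  "tail_slice p u x0 R s = (\<integral>\<^sup>+y\<in>- ball x0 R. ennreal (\<bar>u y\<bar> powr (p - 1) /
            norm (y - x0) powr (real DIM('a) + s * p)) \<partial>lebesgue)"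

text \<open>
  The pointwise bound holds for almost every pair. The power of \<open>u\<^sub>-\<close> in it is replaced by a Borel function before
  Tonelli's theorem is applied, and restored in the tail integral afterwards.
\<close>

lemma nonlocal_form_slice_bound:
  fixes u u0 \<eta> :: "'a::euclidean_space \<Rightarrow> real"
  assumes p: "1 < p" and r: "0 < r" "16 * r < R" and d: "0 < d" and s: "0 < s" "s < 1"
    and eta: "\<And>x. 0 \<le> \<eta> x" "\<And>x. \<eta> x \<le> 1" "\<And>x y. \<bar>\<eta> x - \<eta> y\<bar> \<le> norm (x - y) / r"
      "\<And>x. x \<notin> ball x0 (7 * r) \<Longrightarrow> \<eta> x = 0"
    and u: "u \<in> borel_measurable lebesgue"
    and u0: "\<And>x. 0 \<le> u0 x" "AE x in lborel. x \<in> ball x0 (8 * r) \<longrightarrow> u0 x = u x"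
    and pos: "AE x in lborel. x \<in> ball x0 R \<longrightarrow> 0 \<le> u x"
    and v: "\<And>x. v x = \<eta> x powr p * (u0 x + d) powr (1 - p)"
  shows "ennreal (nonlocal_form p s u v) \<le>
    2 * (ennreal (2 powr p) * emeasure lborel (ball x0 (8 * r)) *
       (ennreal (2 powr (real DIM('a) + s * p + 1) * unit_ball_vol (real DIM('a)) *
         (r powr (- (s * p)) * (1 / (p - s * p) + 1 / (s * p)))) +
        ennreal (2 powr (real DIM('a) + s * p) * d powr (1 - p)) * tail_slice p (neg_part u) x0 R s))"
proof -
  define a where "a = real DIM('a) + s * p"
  have a: "0 \<le> a" using s p by (simp add: a_def)
  let ?w = "\<lambda>y. neg_part u y powr (p - 1)"
  have "neg_part u \<in> borel_measurable lebesgue" unfolding neg_part_def[abs_def] using u by measurable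
  then have "?w \<in> borel_measurable lebesgue" by measurable
  from borel_version[OF this] obtain w1 where w1[measurable]: "w1 \<in> borel_measurable borel" "AE y in lborel. ?w y = w1 y"
    by metis
  define w where "w y = max 0 (w1 y)" for y
  have [measurable]: "w \<in> borel_measurable borel" unfolding w_def[abs_def] by measurable
  have w0: "0 \<le> w y" for y by (simp add: w_def)
  have ww: "AE y in lborel. ?w y = w y"
    using w1(2)
  proof eventually_elim
    case (elim y)
    have "0 \<le> ?w y" by simp
    then show ?case unfolding w_def elim by simp
  qed
  have "AE x in lborel. (x \<in> ball x0 (8 * r) \<longrightarrow> u0 x = u x) \<and> (x \<in> ball x0 R \<longrightarrow> 0 \<le> u x) \<and> ?w x = w x"
    using u0(2) pos ww by eventually_elim blast
  note ae = AE_lborel_prod[OF this]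
  let ?F = "\<lambda>z. case z of (x, y) \<Rightarrow> \<bar>u x - u y\<bar> powr (p - 2) * (u x - u y) * (v x - v y) / norm (x - y) powr a"
  have "ennreal (nonlocal_form p s u v) \<le> (\<integral>\<^sup>+z. ennreal (?F z) \<partial>lebesgue)"
    unfolding nonlocal_form_def a_def[symmetric] by (rule ennreal_integral_le_nn_integral)
  also have "\<dots> = (\<integral>\<^sup>+z. ennreal (?F z) \<partial>lborel)" by (rule nn_integral_completion)
  also have "\<dots> \<le> (\<integral>\<^sup>+z. ennreal (nonlocal_majorant p r R a d x0 w (fst z) (snd z) + nonlocal_majorant p r R a d x0 w (snd z) (fst z)) \<partial>lborel)"
  proof (rule nn_integral_mono_AE)
    show "AE z in lborel. ennreal (?F z) \<le> ennreal (nonlocal_majorant p r R a d x0 w (fst z) (snd z) + nonlocal_majorant p r R a d x0 w (snd z) (fst z))"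
      using ae
    proof eventually_elim
      case (elim z)
      obtain x y where z: "z = (x, y)" by force
      have "?F z \<le> nonlocal_majorant p r R a d x0 ?w x y + nonlocal_majorant p r R a d x0 ?w y x"
        unfolding z prod.case
        by (rule nonlocal_pointwise[OF p r d a eta u0(1) _ _ _ _ v]) (use elim in \<open>simp_all add: z\<close>)
      also have "\<dots> = nonlocal_majorant p r R a d x0 w x y + nonlocal_majorant p r R a d x0 w y x"
        using elim by (simp add: nonlocal_majorant_def z)
      finally show ?case by (simp add: z ennreal_leI)
    qed
  qed
  also have "\<dots> = 2 * (ennreal (2 powr p) * emeasure lborel (ball x0 (8 * r)) *
       ((\<integral>\<^sup>+z. ennreal (trunc_kernel p r a (z::'a)) \<partial>lborel) +
        ennreal (2 powr a * d powr (1 - p)) * (\<integral>\<^sup>+y. ennreal (w y / norm (y - x0) powr a) * indicator (- ball x0 R) y \<partial>lborel)))"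
    by (rule nonlocal_majorant_integral) (use w0 in auto)
  also have "(\<integral>\<^sup>+y. ennreal (w y / norm (y - x0) powr a) * indicator (- ball x0 R) y \<partial>lborel) = tail_slice p (neg_part u) x0 R s"
    unfolding tail_slice_def nn_integral_completion a_def[symmetric]
  proof (rule nn_integral_cong_AE)
    show "AE y in lborel. ennreal (w y / norm (y - x0) powr a) * indicator (- ball x0 R) y =
      ennreal (\<bar>neg_part u y\<bar> powr (p - 1) / norm (y - x0) powr a) * indicator (- ball x0 R) y"
      using ww by eventually_elim (simp add: neg_part_def)
  qed
  finally show ?thesis
    by (rule order_trans) (unfold a_def, intro mult_left_mono add_right_mono trunc_kernel_integral p r s, auto)
qed

text \<open>
  The constant is \<open>s (1 - s)\<close> times a continuous function on \<open>[0, 1]\<close>. The factor \<open>s (1 - s)\<close> compensates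
  \<open>1 / (p - s p) + 1 / (s p)\<close> in the bound for the kernel integral.
\<close>

lemma frac_const_bound:
  assumes p: "1 < p" and N: "0 < N"
  shows "continuous_on {0..1} (\<lambda>s. frac_const N s p)"
    "\<exists>M>0. \<forall>s\<in>{0<..<1}. 0 \<le> frac_const N s p \<and> frac_const N s p \<le> M * (s * (1 - s))"
proof -
  define q where "q s = (p / 2 * 2 powr (2 * s - 1)) / pi powr ((real N - 1) / 2) *
     (Gamma ((real N + p * s) / 2) / (Gamma ((p + 1) / 2) * Gamma (2 - s)))" for s
  have fq: "frac_const N s p = s * (1 - s) * q s" for s
    by (simp add: frac_const_def q_def field_simps)
  have G: "0 < Gamma ((real N + p * s) / 2)" "0 < Gamma (2 - s)" if "s \<in> {0..1}" for s
    using that p N by (auto intro!: Gamma_real_pos add_pos_nonneg divide_pos_pos)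
  have Gp: "0 < Gamma ((p + 1) / 2)" using p by (intro Gamma_real_pos) auto
  have c1: "continuous_on {0..1} (\<lambda>s. Gamma ((real N + p * s) / 2))"
    by (rule continuous_on_compose2[OF continuous_on_Gamma[of "{0<..}"]])
       (use p N in \<open>auto intro!: continuous_intros add_pos_nonneg elim!: nonpos_Ints_cases\<close>)
  have c2: "continuous_on {0..1} (\<lambda>s::real. Gamma (2 - s))"
    by (rule continuous_on_compose2[OF continuous_on_Gamma[of "{0<..}"]])
       (auto intro!: continuous_intros elim!: nonpos_Ints_cases)
  have cq: "continuous_on {0..1} q"
    unfolding q_def[abs_def]
  proof (intro continuous_on_mult continuous_on_divide continuous_on_const c1 c2 ballI)
    show "continuous_on {0..1} (\<lambda>s. 2 powr (2 * s - 1) :: real)" by (intro continuous_intros) auto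
    show "Gamma ((p + 1) / 2) * Gamma (2 - s) \<noteq> 0" if "s \<in> {0..1}" for s
      using G(2)[OF that] Gp by simp
  qed auto
  show "continuous_on {0..1} (\<lambda>s. frac_const N s p)"
    unfolding fq by (intro continuous_intros cq)
  have "compact (q ` {0..1})" by (rule compact_continuous_image[OF cq]) simp
  then obtain M where M: "0 < M" "\<And>s. s \<in> {0..1} \<Longrightarrow> \<bar>q s\<bar> \<le> M"
    using compact_imp_bounded[of "q ` {0..1}"] unfolding bounded_pos by auto
  show "\<exists>M>0. \<forall>s\<in>{0<..<1}. 0 \<le> frac_const N s p \<and> frac_const N s p \<le> M * (s * (1 - s))"
  proof (intro exI[of _ M] conjI ballI M(1))
    fix s :: real assume s: "s \<in> {0<..<1}"
    have "0 \<le> q s" unfolding q_def using G[of s] Gp s p by (intro mult_nonneg_nonneg divide_nonneg_nonneg) auto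
    then show "0 \<le> frac_const N s p" unfolding fq using s by (intro mult_nonneg_nonneg) auto
    have "q s \<le> M" using M(2)[of s] s by auto
    then have "(s * (1 - s)) * q s \<le> (s * (1 - s)) * M" using s by (intro mult_left_mono) auto
    then show "frac_const N s p \<le> M * (s * (1 - s))" unfolding fq by (simp add: mult.commute)
  qed
qed

text \<open>
  The complement of the support is covered by countably many relatively open null sets.
\<close>

lemma AE_in_measure_support:
  assumes sets: "sets \<mu> = sets (restrict_space borel {0..1::real})"
  shows "AE s in \<mu>. s \<in> measure_support \<mu>"
proof -
  have sp: "space \<mu> = {0..1}" using sets_eq_imp_space_eq[OF sets] by simp
  define F where "F = {U::real set. open U \<and> emeasure \<mu> (U \<inter> {0..1}) = 0}"
  obtain F' where F': "F' \<subseteq> F" "countable F'" "\<Union>F' = \<Union>F"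
    by (rule Lindelof[of F]) (auto simp: F_def)
  have "(\<Union>U\<in>F'. U \<inter> {0..1}) \<in> null_sets \<mu>"
  proof (rule null_sets_UN'[OF F'(2)])
    fix U assume "U \<in> F'"
    then have U: "open U" "emeasure \<mu> (U \<inter> {0..1}) = 0" using F'(1) by (auto simp: F_def)
    have "U \<inter> {0..1} \<in> sets \<mu>" unfolding sets sets_restrict_space by (rule image_eqI[of _ _ U]) (use U(1) in auto)
    with U(2) show "U \<inter> {0..1} \<in> null_sets \<mu>" by auto
  qed
  then show ?thesis
  proof (rule AE_I')
    show "{s \<in> space \<mu>. s \<notin> measure_support \<mu>} \<subseteq> (\<Union>U\<in>F'. U \<inter> {0..1})"
    proof
      fix s assume "s \<in> {s \<in> space \<mu>. s \<notin> measure_support \<mu>}"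
      then obtain U where "s \<in> {0..1}" "open U" "s \<in> U" "emeasure \<mu> (U \<inter> {0..1}) = 0"
        by (auto simp: measure_support_def sp not_less)
      then have "s \<in> \<Union>F" "s \<in> {0..1}" by (auto simp: F_def)
      then show "s \<in> (\<Union>U\<in>F'. U \<inter> {0..1})" unfolding F'(3)[symmetric] by auto
    qed
  qed
qed

lemma tail_slice_measurable:
  fixes u :: "'a::euclidean_space \<Rightarrow> real"
  assumes sets: "sets \<mu> = sets (restrict_space borel {0..1::real})" and u: "u \<in> borel_measurable lebesgue"
  shows "tail_slice p u x0 R \<in> borel_measurable \<mu>"
proof -
  from borel_version[OF u] obtain w where w[measurable]: "w \<in> borel_measurable borel" "AE y in lborel. u y = w y"
    by metis
  have [measurable]: "(\<lambda>s. s) \<in> borel_measurable \<mu>"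
    by (subst measurable_cong_sets[OF sets refl]) (rule measurable_restrict_space1, simp)
  have "(\<lambda>s. \<integral>\<^sup>+y. ennreal (\<bar>w y\<bar> powr (p - 1) / norm (y - x0) powr (real DIM('a) + s * p)) * indicator (- ball x0 R) y \<partial>lborel)
    \<in> borel_measurable \<mu>" by measurable
  also have "(\<lambda>s. \<integral>\<^sup>+y. ennreal (\<bar>w y\<bar> powr (p - 1) / norm (y - x0) powr (real DIM('a) + s * p)) * indicator (- ball x0 R) y \<partial>lborel)
    = tail_slice p u x0 R"
  proof
    fix s
    show "(\<integral>\<^sup>+y. ennreal (\<bar>w y\<bar> powr (p - 1) / norm (y - x0) powr (real DIM('a) + s * p)) * indicator (- ball x0 R) y \<partial>lborel)
      = tail_slice p u x0 R s"
      unfolding tail_slice_def nn_integral_completion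
    proof (rule nn_integral_cong_AE)
      show "AE y in lborel. ennreal (\<bar>w y\<bar> powr (p - 1) / norm (y - x0) powr (real DIM('a) + s * p)) * indicator (- ball x0 R) y =
        ennreal (\<bar>u y\<bar> powr (p - 1) / norm (y - x0) powr (real DIM('a) + s * p)) * indicator (- ball x0 R) y"
        using w(2) by eventually_elim simp
    qed
  qed
  finally show ?thesis .
qed

lemma frac_const_measurable:
  assumes sets: "sets \<mu> = sets (restrict_space borel {0..1::real})" and p: "1 < p" and N: "0 < N"
  shows "(\<lambda>s. frac_const N s p) \<in> borel_measurable \<mu>"
  by (subst measurable_cong_sets[OF sets refl])
     (rule borel_measurable_continuous_on_restrict[OF frac_const_bound(1)[OF p N]])

text \<open>
  Let \<open>t\<close> be the tail integral, which carries the weight \<open>R\<^sup>s\<^sup>p\<close>. For \<open>s\<close> in the support, the assumption on \<open>d\<close> says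
  \<open>(r / R)\<^sup>s\<^sup>p t \<le> (2 d)\<^sup>p\<^sup>-\<^sup>1\<close>, whence \<open>1 = (r / R)\<^sup>s\<^sup>p r\<^sup>-\<^sup>s\<^sup>p R\<^sup>s\<^sup>p \<le> ((2 d)\<^sup>p\<^sup>-\<^sup>1 / t) r\<^sup>-\<^sup>p R\<^sup>s\<^sup>p\<close>. Inserting this bound for the
  missing weight turns the integral into a multiple of \<open>t\<close>, and \<open>t\<close> cancels.
\<close>

lemma tail_bounded_by_shift:
  fixes u :: "'a::euclidean_space \<Rightarrow> real"
  assumes p: "1 < p" and sets: "sets \<mu> = sets (restrict_space borel {0..1::real})"
    and u: "u \<in> borel_measurable lebesgue" and fin: "tail_integral \<mu> p u x0 R < \<infinity>"
    and r: "0 < r" "r \<le> 1" "r < R" and d: "0 < d"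
    and dT: "\<And>s. s \<in> measure_support \<mu> \<Longrightarrow> (r / R) powr (s * p / (p - 1)) * enn2real (Tail \<mu> p u x0 R) \<le> 2 * d"
  shows "(\<integral>\<^sup>+s\<in>{0<..<1}. ennreal (frac_const DIM('a) s p) * tail_slice p u x0 R s \<partial>\<mu>)
     \<le> ennreal (r powr (- p) * (2 * d) powr (p - 1))"
proof -
  define t where "t = enn2real (tail_integral \<mu> p u x0 R)"
  have t0: "0 \<le> t" by (simp add: t_def)
  have tI: "tail_integral \<mu> p u x0 R = ennreal t" using fin by (simp add: t_def)
  have Tail: "enn2real (Tail \<mu> p u x0 R) = t powr (1 / (p - 1))"
    using fin by (simp add: Tail_def t_def)
  note [measurable] = tail_slice_measurable[OF sets u, of p x0 R] frac_const_measurable[OF sets p DIM_positive[where 'a='a]]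
  have [measurable]: "(\<lambda>s. s) \<in> borel_measurable \<mu>"
    by (subst measurable_cong_sets[OF sets refl]) (rule measurable_restrict_space1, simp)
  let ?c = "\<lambda>s. frac_const DIM('a) s p"
  have c0: "0 \<le> ?c s" if "s \<in> {0<..<1}" for s
    using frac_const_bound(2)[OF p DIM_positive[where 'a='a]] that by blast
  define J where "J s = ennreal (?c s * R powr (s * p)) * tail_slice p u x0 R s * indicator {0<..<1} s" for s
  have [measurable]: "J \<in> borel_measurable \<mu>" unfolding J_def[abs_def] by measurable
  have IJ: "(\<integral>\<^sup>+s. J s \<partial>\<mu>) = ennreal t"
    unfolding tI[symmetric] tail_integral_def tail_slice_def[symmetric] J_def ..
  have key: "(r / R) powr (s * p) * t \<le> (2 * d) powr (p - 1)" if "s \<in> measure_support \<mu>" for s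
  proof -
    have "((r / R) powr (s * p / (p - 1)) * t powr (1 / (p - 1))) powr (p - 1) \<le> (2 * d) powr (p - 1)"
      using dT[OF that] p by (intro powr_mono2) (auto simp: Tail)
    moreover have "((r / R) powr (s * p / (p - 1)) * t powr (1 / (p - 1))) powr (p - 1) = (r / R) powr (s * p) * t"
      using p t0 r by (simp add: powr_mult powr_powr)
    ultimately show ?thesis by simp
  qed
  show ?thesis
  proof (cases "t = 0")
    case True
    then have "AE s in \<mu>. J s = 0" using IJ by (simp add: nn_integral_0_iff_AE)
    then have "AE s in \<mu>. ennreal (?c s) * tail_slice p u x0 R s * indicator {0<..<1} s = 0"
    proof eventually_elim
      case (elim s)
      have "0 < R powr (s * p)" using r by simp
      then show ?case
        using elim c0[of s] by (auto simp: J_def indicator_def ennreal_eq_0_iff mult_le_0_iff split: if_splits)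
    qed
    then have "(\<integral>\<^sup>+s\<in>{0<..<1}. ennreal (?c s) * tail_slice p u x0 R s \<partial>\<mu>) = 0"
      by (simp add: nn_integral_0_iff_AE)
    then show ?thesis by simp
  next
    case False
    define K where "K = r powr (- p) * (2 * d) powr (p - 1) / t"
    have K0: "0 \<le> K" using t0 by (simp add: K_def)
    have "(\<integral>\<^sup>+s\<in>{0<..<1}. ennreal (?c s) * tail_slice p u x0 R s \<partial>\<mu>) \<le> (\<integral>\<^sup>+s. ennreal K * J s \<partial>\<mu>)"
    proof (rule nn_integral_mono_AE)
      show "AE s in \<mu>. ennreal (?c s) * tail_slice p u x0 R s * indicator {0<..<1} s \<le> ennreal K * J s"
        using AE_in_measure_support[OF sets]
      proof eventually_elim
        case (elim s)
        show ?case
        proof (cases "s \<in> {0<..<1}")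
          case True
          have "1 = (r / R) powr (s * p) * (r powr (- (s * p)) * R powr (s * p))"
            using r by (simp add: powr_divide powr_minus_divide)
          also have "\<dots> \<le> ((2 * d) powr (p - 1) / t) * (r powr (- p) * R powr (s * p))"
          proof (intro mult_mono)
            show "(r / R) powr (s * p) \<le> (2 * d) powr (p - 1) / t"
              using key[OF elim] False t0 by (simp add: field_simps)
            show "r powr (- (s * p)) \<le> r powr (- p)"
              using r True p by (intro powr_mono') auto
          qed (use t0 in auto)
          also have "\<dots> = K * R powr (s * p)" by (simp add: K_def)
          finally have "?c s * 1 \<le> ?c s * (K * R powr (s * p))" by (intro mult_left_mono c0 True)
          then have "ennreal (?c s) \<le> ennreal K * ennreal (?c s * R powr (s * p))"
            using K0 c0[OF True] by (simp add: ennreal_mult[symmetric] ac_simps ennreal_leI)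
          then show ?thesis using True by (simp add: J_def mult.assoc[symmetric] mult_right_mono)
        qed simp
      qed
    qed
    also have "\<dots> = ennreal K * ennreal t" unfolding IJ[symmetric] by (rule nn_integral_cmult) measurable
    also have "\<dots> = ennreal (r powr (- p) * (2 * d) powr (p - 1))"
      using K0 t0 False by (simp add: ennreal_mult[symmetric] K_def)
    finally show ?thesis .
  qed
qed

text \<open>
  The constant produced by the next estimate, where \<open>m\<close> is the total mass of the measure and \<open>M\<close> bounds the normalizing
  constants by \<open>M s (1 - s)\<close>.
\<close>

definition nonlocal_const :: "nat \<Rightarrow> real \<Rightarrow> real \<Rightarrow> real \<Rightarrow> real" where
  "nonlocal_const N p M m = 2 * 2 powr p * unit_ball_vol (real N) * 8 ^ N *
     (2 powr (real N + p + 1) * unit_ball_vol (real N) * (M / p) * m + 2 powr (real N + p) * 2 powr (p - 1))"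

lemma nonlocal_const_pos: "1 < p \<Longrightarrow> 0 < M \<Longrightarrow> 0 \<le> m \<Longrightarrow> 0 < nonlocal_const N p M m"
  unfolding nonlocal_const_def by (intro mult_pos_pos add_nonneg_pos mult_nonneg_nonneg) auto

text \<open>
  For each \<open>s\<close> the nonlocal form is bounded by a kernel integral and a tail integral. Multiplied by the normalizing
  constant, the first is at most a constant times \<open>r\<^sup>N\<^sup>-\<^sup>p\<close>, because \<open>r \<le> 1\<close>. The second carries the factor
  \<open>d\<^sup>1\<^sup>-\<^sup>p\<close>, which cancels against the bound for its integral over \<open>s\<close>.
\<close>

lemma nonlocal_energy_bound:
  fixes u u0 \<eta> :: "'a::euclidean_space \<Rightarrow> real" and \<mu> :: "real measure"
  assumes p: "1 < p" and sets: "sets \<mu> = sets (restrict_space borel {0..1})" and fin: "finite_measure \<mu>"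
    and M: "0 < M" "\<And>s. s \<in> {0<..<1} \<Longrightarrow> 0 \<le> frac_const DIM('a) s p"
      "\<And>s. s \<in> {0<..<1} \<Longrightarrow> frac_const DIM('a) s p \<le> M * (s * (1 - s))"
    and r: "0 < r" "r \<le> 1" "16 * r < R" and d: "0 < d"
    and eta: "\<And>x. 0 \<le> \<eta> x" "\<And>x. \<eta> x \<le> 1" "\<And>x y. \<bar>\<eta> x - \<eta> y\<bar> \<le> norm (x - y) / r"
      "\<And>x. x \<notin> ball x0 (7 * r) \<Longrightarrow> \<eta> x = 0"
    and u: "u \<in> borel_measurable lebesgue"
    and u0: "\<And>x. 0 \<le> u0 x" "AE x in lborel. x \<in> ball x0 (8 * r) \<longrightarrow> u0 x = u x"
      "AE x in lborel. x \<in> ball x0 R \<longrightarrow> 0 \<le> u x"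
    and v: "\<And>x. v x = \<eta> x powr p * (u0 x + d) powr (1 - p)"
    and tf: "tail_integral \<mu> p (neg_part u) x0 R < \<infinity>"
    and dT: "\<And>s. s \<in> measure_support \<mu> \<Longrightarrow> (r / R) powr (s * p / (p - 1)) * enn2real (Tail \<mu> p (neg_part u) x0 R) \<le> 2 * d"
  shows "(LINT s:{0<..<1}|\<mu>. frac_const DIM('a) s p * nonlocal_form p s u v)
    \<le> nonlocal_const DIM('a) p M (measure \<mu> (space \<mu>)) * r powr (real DIM('a) - p)"
proof -
  define N where "N = real DIM('a)"
  define V where "V = unit_ball_vol N"
  have V0: "0 < V" by (simp add: V_def N_def)
  define m where "m = measure \<mu> (space \<mu>)"
  have m: "emeasure \<mu> (space \<mu>) = ennreal m" "0 \<le> m"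
    using finite_measure.emeasure_eq_measure[OF fin] by (simp_all add: m_def)
  define A0 where "A0 = 2 * 2 powr p * V * 8 ^ DIM('a)"
  have A0: "0 < A0" using V0 by (simp add: A0_def)
  define C where "C = A0 * (2 powr (N + p + 1) * V * (M / p) * m + 2 powr (N + p) * 2 powr (p - 1))"
  have C: "C = nonlocal_const DIM('a) p M m"
    by (simp add: C_def A0_def nonlocal_const_def V_def N_def)
  have C0: "0 < C" unfolding C by (rule nonlocal_const_pos[OF p M(1) m(2)])
  let ?c = "\<lambda>s. frac_const DIM('a) s p"
  let ?T = "tail_slice p (neg_part u) x0 R"
  have nu: "neg_part u \<in> borel_measurable lebesgue" unfolding neg_part_def[abs_def] using u by measurable
  note [measurable] = tail_slice_measurable[OF sets nu, of p x0 R] frac_const_measurable[OF sets p DIM_positive[where 'a='a]]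
  have [measurable]: "(\<lambda>s. s) \<in> borel_measurable \<mu>"
    by (subst measurable_cong_sets[OF sets refl]) (rule measurable_restrict_space1, simp)
  define A where "A = A0 * r ^ DIM('a)"
  have A: "0 \<le> A" using A0 r by (simp add: A_def)
  define Q where "Q = 2 powr (N + p + 1) * V * (r powr (- p) * (M / p))"
  have Q: "0 \<le> Q" using V0 M(1) p by (simp add: Q_def)
  define K where "K = 2 powr (N + p) * d powr (1 - p)"
  have K: "0 \<le> K" by (simp add: K_def)
  have slice: "ennreal (?c s * nonlocal_form p s u v) \<le> ennreal (A * Q) + ennreal (A * K) * (ennreal (?c s) * ?T s)"
    if s: "s \<in> {0<..<1}" for s
  proof -
    define \<kappa> where "\<kappa> = 2 powr (N + s * p + 1) * V * (r powr (- (s * p)) * (1 / (p - s * p) + 1 / (s * p)))"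
    have sp: "0 < s * p" "s * p < p" using s p by auto
    have \<kappa>0: "0 \<le> \<kappa>" unfolding \<kappa>_def using V0 sp s by (intro mult_nonneg_nonneg add_nonneg_nonneg) auto
    have c0: "0 \<le> ?c s" by (rule M(2)[OF s])
    have "?c s * (1 / (p - s * p) + 1 / (s * p)) \<le> M / p"
    proof -
      have "1 / (p - s * p) + 1 / (s * p) = 1 / (p * (s * (1 - s)))"
        using s p by (simp add: field_simps)
      moreover have "?c s * (1 / (p * (s * (1 - s)))) \<le> (M * (s * (1 - s))) * (1 / (p * (s * (1 - s))))"
        using s p by (intro mult_right_mono M(3)) auto
      moreover have "(M * (s * (1 - s))) * (1 / (p * (s * (1 - s)))) = M / p" using s p by simp
      ultimately show ?thesis by simp
    qed
    moreover have "2 powr (N + s * p + 1) * V * r powr (- (s * p)) \<le> 2 powr (N + p + 1) * V * r powr (- p)"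
    proof (intro mult_mono)
      show "2 powr (N + s * p + 1) \<le> 2 powr (N + p + 1)" using sp s by (intro powr_mono) auto
      show "r powr (- (s * p)) \<le> r powr (- p)" using sp s r by (intro powr_mono') auto
    qed (use V0 in auto)
    ultimately have "(2 powr (N + s * p + 1) * V * r powr (- (s * p))) * (?c s * (1 / (p - s * p) + 1 / (s * p)))
       \<le> (2 powr (N + p + 1) * V * r powr (- p)) * (M / p)"
    proof (intro mult_mono'[of "2 powr (N + s * p + 1) * V * r powr (- (s * p))"])
      show "0 \<le> ?c s * (1 / (p - s * p) + 1 / (s * p))"
        using c0 s p by (intro mult_nonneg_nonneg add_nonneg_nonneg divide_nonneg_nonneg) auto
    qed (use V0 in simp_all)
    then have \<kappa>Q: "?c s * \<kappa> \<le> Q" by (simp add: \<kappa>_def Q_def ac_simps)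
    have "ennreal (nonlocal_form p s u v) \<le>
      2 * (ennreal (2 powr p) * emeasure lborel (ball x0 (8 * r)) *
       (ennreal \<kappa> + ennreal (2 powr (N + s * p) * d powr (1 - p)) * ?T s))"
      unfolding \<kappa>_def N_def V_def using s
      by (intro nonlocal_form_slice_bound[OF p r(1) r(3) d _ _ eta u u0 v]) auto
    also have "2 * (ennreal (2 powr p) * emeasure lborel (ball x0 (8 * r)) *
       (ennreal \<kappa> + ennreal (2 powr (N + s * p) * d powr (1 - p)) * ?T s)) =
      (2 * (ennreal (2 powr p) * emeasure lborel (ball x0 (8 * r)))) *
       (ennreal \<kappa> + ennreal (2 powr (N + s * p) * d powr (1 - p)) * ?T s)"
      by (simp only: mult.assoc)
    also have "2 * (ennreal (2 powr p) * emeasure lborel (ball x0 (8 * r))) = ennreal A"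
    proof -
      have e: "ennreal 2 * (ennreal a * ennreal b) = ennreal (2 * (a * b))" if "0 \<le> a" "0 \<le> b" for a b
        using that by (simp add: ennreal_mult)
      have "ennreal 2 * (ennreal (2 powr p) * ennreal (V * (8 * r) ^ DIM('a))) = ennreal A"
        using V0 r by (subst e) (auto simp: A_def A0_def power_mult_distrib ac_simps)
      then show ?thesis using r by (simp add: emeasure_ball V_def N_def)
    qed
    also have "ennreal \<kappa> + ennreal (2 powr (N + s * p) * d powr (1 - p)) * ?T s \<le> ennreal \<kappa> + ennreal K * ?T s"
      unfolding K_def using sp s by (intro add_left_mono mult_right_mono ennreal_leI powr_mono) auto
    finally have "ennreal (nonlocal_form p s u v) \<le> ennreal A * (ennreal \<kappa> + ennreal K * ?T s)"
      by (simp add: mult_left_mono)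
    then have "ennreal (?c s) * ennreal (nonlocal_form p s u v) \<le> ennreal (?c s) * (ennreal A * (ennreal \<kappa> + ennreal K * ?T s))"
      by (rule mult_left_mono) simp
    also have "\<dots> = ennreal (A * (?c s * \<kappa>)) + ennreal (A * K) * (ennreal (?c s) * ?T s)"
      using A K c0 \<kappa>0 by (simp add: ennreal_mult distrib_left ac_simps)
    also have "\<dots> \<le> ennreal (A * Q) + ennreal (A * K) * (ennreal (?c s) * ?T s)"
      using \<kappa>Q A by (intro add_right_mono ennreal_leI mult_left_mono) auto
    finally show ?thesis using c0 by (simp add: ennreal_mult')
  qed
  have "ennreal (LINT s:{0<..<1}|\<mu>. ?c s * nonlocal_form p s u v) \<le>
     (\<integral>\<^sup>+s. ennreal (indicator {0<..<1} s *\<^sub>R (?c s * nonlocal_form p s u v)) \<partial>\<mu>)"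
    unfolding set_lebesgue_integral_def by (rule ennreal_integral_le_nn_integral)
  also have "\<dots> \<le> (\<integral>\<^sup>+s. ennreal (A * Q) + ennreal (A * K) * (ennreal (?c s) * ?T s * indicator {0<..<1} s) \<partial>\<mu>)"
  proof (rule nn_integral_mono)
    fix s
    show "ennreal (indicator {0<..<1} s *\<^sub>R (?c s * nonlocal_form p s u v)) \<le>
      ennreal (A * Q) + ennreal (A * K) * (ennreal (?c s) * ?T s * indicator {0<..<1} s)"
      using slice[of s] by (cases "s \<in> {0<..<1}") auto
  qed
  also have "\<dots> = ennreal (A * Q) * emeasure \<mu> (space \<mu>) + ennreal (A * K) * (\<integral>\<^sup>+s\<in>{0<..<1}. ennreal (?c s) * ?T s \<partial>\<mu>)"
    by (subst nn_integral_add) (auto simp: nn_integral_cmult)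
  also have "\<dots> \<le> ennreal (A * Q) * ennreal m + ennreal (A * K) * ennreal (r powr (- p) * (2 * d) powr (p - 1))"
    unfolding m(1) by (intro add_left_mono mult_left_mono tail_bounded_by_shift p sets nu tf d dT r) (use r in auto)
  also have "\<dots> = ennreal (A * Q * m + A * K * (r powr (- p) * (2 * d) powr (p - 1)))"
    using A Q K m(2) by (simp add: ennreal_mult'[symmetric] ennreal_plus[symmetric] del: ennreal_plus)
  also have "A * Q * m + A * K * (r powr (- p) * (2 * d) powr (p - 1)) = C * r powr (real DIM('a) - p)"
  proof -
    have "r powr (real DIM('a) - p) = r ^ DIM('a) * r powr (- p)"
      using r by (simp add: powr_realpow[symmetric] flip: powr_add)
    moreover have "d powr (1 - p) * (2 * d) powr (p - 1) = 2 powr (p - 1)"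
      using d by (simp add: powr_mult powr_diff)
    then have "K * (2 * d) powr (p - 1) = 2 powr (N + p) * 2 powr (p - 1)"
      by (simp add: K_def mult.assoc)
    then have "A * K * (r powr (- p) * (2 * d) powr (p - 1)) = A * r powr (- p) * (2 powr (N + p) * 2 powr (p - 1))"
      by (metis (no_types, lifting) mult.assoc mult.left_commute)
    ultimately show ?thesis
      by (simp add: A_def Q_def C_def algebra_simps)
  qed
  finally show ?thesis
    using C0 by (simp add: C m_def ennreal_le_iff)
qed

section \<open>The cutoff function\<close>

text \<open>
  At \<open>0\<close> the difference quotient is the power with exponent \<open>p - 1 > 0\<close>, which tends to \<open>0\<close>.
\<close>

lemma max_powr_deriv:
  assumes p: "1 < p"
  shows "((\<lambda>t. max 0 t powr p) has_real_derivative p * max 0 t powr (p - 1)) (at t)"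
proof -
  consider "t < 0" | "t = 0" | "0 < t" by linarith
  then show ?thesis
  proof cases
    case 1
    have "((\<lambda>_. 0) has_real_derivative 0) (at t)" by simp
    then have "((\<lambda>t. max 0 t powr p) has_real_derivative 0) (at t)"
      by (rule DERIV_cong_ev[THEN iffD1, rotated 3])
         (use 1 eventually_nhds_in_open[of "{..<0}" t] in \<open>auto elim!: eventually_mono\<close>)
    with 1 show ?thesis by simp
  next
    case 2
    have eq: "(max 0 h powr p - max 0 0 powr p) / (h - 0) = max 0 h powr (p - 1)" for h :: real
      by (cases "0 < h") (auto simp: powr_diff)
    have "((\<lambda>h. max 0 h) \<longlongrightarrow> max 0 0) (at (0::real))" by (intro tendsto_intros)
    then have "((\<lambda>h. max 0 h powr (p - 1)) \<longlongrightarrow> 0) (at (0::real))"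
      using p by (intro tendsto_zero_powrI[where b="p - 1"]) auto
    then have "((\<lambda>t. max 0 t powr p) has_real_derivative 0) (at 0)"
      unfolding has_field_derivative_iff eq .
    with 2 p show ?thesis by simp
  next
    case 3
    have "((\<lambda>t. t powr p) has_real_derivative p * t powr (p - 1)) (at t)"
      using 3 by (rule has_real_derivative_powr)
    then have "((\<lambda>t. max 0 t powr p) has_real_derivative p * t powr (p - 1)) (at t)"
      by (rule DERIV_cong_ev[THEN iffD1, rotated 3])
         (use 3 eventually_nhds_in_open[of "{0<..}" t] in \<open>auto elim!: eventually_mono\<close>)
    with 3 show ?thesis by simp
  qed
qed

text \<open>
  This function is not differentiable on the boundary of its support, but its \<open>p\<close>-th power is continuously
  differentiable for \<open>p > 1\<close>. The gradient of the power is at most \<open>p \<eta>\<^sup>p\<^sup>-\<^sup>1\<close> times a constant, which is what Young's inequality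
  requires, and on smaller balls the function is bounded below.
\<close>

definition cutoff :: "'a::euclidean_space \<Rightarrow> real \<Rightarrow> 'a \<Rightarrow> real" where
  "cutoff x0 \<rho> x = max 0 (1 - ((x - x0) \<bullet> (x - x0)) / \<rho>\<^sup>2)"

lemma cutoff_bounds: "0 \<le> cutoff x0 \<rho> x" "cutoff x0 \<rho> x \<le> 1"
  by (simp_all add: cutoff_def)

lemma cutoff_zero: "0 < \<rho> \<Longrightarrow> x \<notin> ball x0 \<rho> \<Longrightarrow> cutoff x0 \<rho> x = 0"
  using power_mono[of \<rho> "norm (x - x0)" 2]
  by (simp add: cutoff_def dist_norm norm_minus_commute power2_norm_eq_inner[symmetric])

text \<open>
  The function is \<open>1 - m\<^sup>2 / \<rho>\<^sup>2\<close> for the 1-Lipschitz function \<open>m = min |x - x0| \<rho>\<close>, whose values are in \<open>[0, \<rho>]\<close>.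
\<close>

lemma cutoff_lipschitz:
  assumes "0 < \<rho>"
  shows "\<bar>cutoff x0 \<rho> x - cutoff x0 \<rho> y\<bar> \<le> 2 / \<rho> * norm (x - y)"
proof -
  have eq: "cutoff x0 \<rho> x = 1 - (min (norm (x - x0)) \<rho>)\<^sup>2 / \<rho>\<^sup>2" for x
    using assms power_mono[of \<rho> "norm (x - x0)" 2] power_mono[of "norm (x - x0)" \<rho> 2]
    by (auto simp: cutoff_def min_def max_def power2_norm_eq_inner[symmetric])
  let ?m = "\<lambda>x. min (norm (x - x0)) \<rho>"
  have m: "0 \<le> ?m x" "?m x \<le> \<rho>" for x using assms by auto
  have "\<bar>cutoff x0 \<rho> x - cutoff x0 \<rho> y\<bar> = \<bar>?m y - ?m x\<bar> * \<bar>?m y + ?m x\<bar> / \<rho>\<^sup>2"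
    unfolding eq by (simp add: abs_mult[symmetric] power2_eq_square algebra_simps flip: diff_divide_distrib)
  also have "\<dots> \<le> norm (x - y) * (2 * \<rho>) / \<rho>\<^sup>2"
  proof (intro divide_right_mono mult_mono)
    have "\<bar>?m y - ?m x\<bar> \<le> \<bar>norm (y - x0) - norm (x - x0)\<bar>" by linarith
    also have "\<dots> \<le> norm ((y - x0) - (x - x0))" by (rule norm_triangle_ineq3)
    finally show "\<bar>?m y - ?m x\<bar> \<le> norm (x - y)" by (simp add: norm_minus_commute)
    show "\<bar>?m y + ?m x\<bar> \<le> 2 * \<rho>" using m[of x] m[of y] by linarith
  qed auto
  also have "\<dots> = 2 / \<rho> * norm (x - y)" using assms by (simp add: power2_eq_square)
  finally show ?thesis .
qed

definition cutoff_grad :: "real \<Rightarrow> 'a::euclidean_space \<Rightarrow> real \<Rightarrow> 'a \<Rightarrow> 'a" where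
  "cutoff_grad p x0 \<rho> x = (p * cutoff x0 \<rho> x powr (p - 1) * (- 2 / \<rho>\<^sup>2)) *\<^sub>R (x - x0)"

lemma cutoff_powr_C1_grad:
  assumes p: "1 < p" and \<rho>: "0 < \<rho>"
  shows "C1_grad (\<lambda>x. cutoff x0 \<rho> x powr p) (cutoff_grad p x0 \<rho>)"
proof -
  let ?q = "\<lambda>x. 1 - ((x - x0) \<bullet> (x - x0)) / \<rho>\<^sup>2"
  have "((\<lambda>x. cutoff x0 \<rho> x powr p) has_derivative (\<lambda>h. cutoff_grad p x0 \<rho> x \<bullet> h)) (at x)" for x
  proof -
    have q: "(?q has_derivative (\<lambda>h. - (2 * ((x - x0) \<bullet> h)) / \<rho>\<^sup>2)) (at x)"
    proof -
      have "((\<lambda>x. 1 - inverse (\<rho>\<^sup>2) * ((x - x0) \<bullet> (x - x0))) has_derivative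
         (\<lambda>h. - (inverse (\<rho>\<^sup>2) * (2 * ((x - x0) \<bullet> h))))) (at x)"
        by (auto intro!: derivative_eq_intros simp: inner_commute)
      then show ?thesis by (simp add: divide_inverse mult.commute)
    qed
    have "((\<lambda>t. max 0 t powr p) has_derivative (\<lambda>h. (p * max 0 (?q x) powr (p - 1)) * h)) (at (?q x))"
      using max_powr_deriv[OF p] by (simp add: has_field_derivative_def)
    from has_derivative_compose[OF q this] show ?thesis
      unfolding cutoff_def cutoff_grad_def
      by (rule has_derivative_eq_rhs) (simp add: fun_eq_iff)
  qed
  moreover have "continuous_on UNIV (cutoff_grad p x0 \<rho>)"
  proof -
    have "continuous_on UNIV (\<lambda>x. cutoff x0 \<rho> x powr (p - 1))"
      unfolding cutoff_def using p \<rho>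
      by (intro continuous_on_powr' continuous_intros) auto
    then show ?thesis
      unfolding cutoff_grad_def[abs_def]
      by (intro continuous_on_scaleR continuous_on_mult continuous_on_const continuous_on_diff continuous_on_id)
  qed
  ultimately show ?thesis by (simp add: C1_grad_def)
qed

lemma cutoff_grad_bound:
  assumes p: "1 < p" and "0 < \<rho>"
  shows "norm (cutoff_grad p x0 \<rho> x) \<le> p * cutoff x0 \<rho> x powr (p - 1) * (2 / \<rho>)"
proof (cases "x \<in> ball x0 \<rho>")
  case True
  then have "norm (x - x0) \<le> \<rho>" by (simp add: dist_norm norm_minus_commute)
  then have "(p * cutoff x0 \<rho> x powr (p - 1) * (2 / \<rho>\<^sup>2)) * norm (x - x0) \<le> (p * cutoff x0 \<rho> x powr (p - 1) * (2 / \<rho>\<^sup>2)) * \<rho>"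
    using p by (intro mult_left_mono) auto
  then show ?thesis
    using p assms(2) by (simp add: cutoff_grad_def abs_mult power2_eq_square)
next
  case False
  then have "cutoff x0 \<rho> x = 0" by (rule cutoff_zero[OF assms(2)])
  then show ?thesis using p by (simp add: cutoff_grad_def)
qed

text \<open>
  Either \<open>t\<close> is so large that the left-hand side is below the first term, or \<open>t\<close> is at most a multiple of \<open>c\<close>.
\<close>

lemma young_absorb:
  fixes p c t :: real
  assumes p: "1 < p" and c: "0 \<le> c" and t: "0 \<le> t"
  shows "p * c * t powr (p - 1) \<le> (p - 1) / 2 * t powr p + p * (2 * p / (p - 1)) powr (p - 1) * c powr p"
proof (cases "2 * p / (p - 1) * c \<le> t")
  case True
  then have "p * c \<le> (p - 1) / 2 * t" using p by (simp add: field_simps)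
  then have "p * c * t powr (p - 1) \<le> (p - 1) / 2 * t * t powr (p - 1)" by (intro mult_right_mono) auto
  also have "\<dots> = (p - 1) / 2 * t powr p"
    using t by (cases "t = 0") (auto simp: powr_diff)
  also have "\<dots> \<le> (p - 1) / 2 * t powr p + p * (2 * p / (p - 1)) powr (p - 1) * c powr p" using p by simp
  finally show ?thesis .
next
  case False
  then have "t powr (p - 1) \<le> (2 * p / (p - 1) * c) powr (p - 1)" using p t by (intro powr_mono2) auto
  also have "\<dots> = (2 * p / (p - 1)) powr (p - 1) * c powr (p - 1)" using p c by (intro powr_mult)
  finally have "p * c * t powr (p - 1) \<le> p * c * ((2 * p / (p - 1)) powr (p - 1) * c powr (p - 1))"
    using p c by (intro mult_left_mono) auto
  also have "\<dots> = p * (2 * p / (p - 1)) powr (p - 1) * (c * c powr (p - 1))" by simp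
  also have "c * c powr (p - 1) = c powr p" using c by (cases "c = 0") (auto simp: powr_diff)
  finally have "p * c * t powr (p - 1) \<le> p * (2 * p / (p - 1)) powr (p - 1) * c powr p" .
  moreover have "0 \<le> (p - 1) / 2 * t powr p" using p by simp
  ultimately show ?thesis by linarith
qed

lemma integrable_of_powr:
  fixes f :: "'a::euclidean_space \<Rightarrow> 'b::euclidean_space"
  assumes p: "1 \<le> p" and [measurable]: "f \<in> borel_measurable borel" and K: "compact K" "\<And>x. x \<notin> K \<Longrightarrow> f x = 0"
    and fp: "integrable lborel (\<lambda>x. norm (f x) powr p)"
  shows "integrable lborel f"
proof (rule Bochner_Integration.integrable_bound)
  have "emeasure lborel K < \<infinity>" using emeasure_bounded_finite[OF compact_imp_bounded[OF K(1)]] by simp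
  then show "integrable lborel (\<lambda>x. indicator K x + norm (f x) powr p)"
    using fp K(1) by (intro Bochner_Integration.integrable_add) (auto simp: compact_imp_closed)
  show "AE x in lborel. norm (f x) \<le> norm (indicator K x + norm (f x) powr p)"
  proof (intro AE_I2)
    fix x
    show "norm (f x) \<le> norm (indicator K x + norm (f x) powr p)"
    proof (cases "x \<in> K")
      case True
      have "norm (f x) \<le> 1 + norm (f x) powr p"
      proof (cases "norm (f x) \<le> 1")
        case False
        then show ?thesis using powr_mono[of 1 p "norm (f x)"] p by simp
      next
        case True
        moreover have "0 \<le> norm (f x) powr p" by simp
        ultimately show ?thesis by linarith
      qed
      with True show ?thesis by simp
    qed (use K in simp)
  qed
qed simp

section \<open>The logarithmic gradient estimate\<close>

lemma shifted_powr_deriv: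
  fixes d p t :: real
  assumes "0 < d" "0 \<le> t"
  shows "((\<lambda>t. (t + d) powr (1 - p)) has_real_derivative (1 - p) * (t + d) powr (- p)) (at t)"
proof -
  have "((\<lambda>t. (t + d) powr (1 - p)) has_real_derivative (1 - p) * (t + d) powr (1 - p - 1) * 1) (at t)"
  proof (rule DERIV_chain2[where f="\<lambda>t. t powr (1 - p)" and g="\<lambda>t. t + d"])
    show "((\<lambda>t. t powr (1 - p)) has_real_derivative (1 - p) * (t + d) powr (1 - p - 1)) (at (t + d))"
      using assms by (intro has_real_derivative_powr) auto
  qed (auto intro!: derivative_eq_intros)
  then show ?thesis by simp
qed

lemma shifted_powr_continuous:
  fixes d q :: real
  assumes "0 < d" shows "continuous_on {0..} (\<lambda>t. c * (t + d) powr q)"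
  using assms by (intro continuous_intros) auto

text \<open>
  The local integrand for the test function, with \<open>g\<close> the gradient of \<open>u\<close>, \<open>a = u + d\<close>, \<open>e\<close> the value of the cutoff function
  and \<open>\<psi>'\<close> the gradient of its \<open>p\<close>-th power. The term with \<open>\<psi>'\<close> is at most \<open>p m (e |g| / a)\<^sup>p\<^sup>-\<^sup>1\<close>, and half of the
  negative term absorbs it.
\<close>

lemma local_energy_pointwise:
  fixes g \<psi>' :: "'a::euclidean_space" and a p e m :: real
  assumes p: "1 < p" and a: "0 < a" and e: "0 \<le> e" and m: "0 \<le> m"
    and psi: "norm \<psi>' \<le> p * e powr (p - 1) * m"
  shows "(norm g powr (p - 2) *\<^sub>R g) \<bullet> (a powr (1 - p) *\<^sub>R \<psi>' + (e powr p * ((1 - p) * a powr (- p))) *\<^sub>R g)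
    \<le> p * (2 * p / (p - 1)) powr (p - 1) * m powr p - (p - 1) / 2 * (e * (norm g / a)) powr p"
proof (cases "g = 0")
  case True
  then show ?thesis using p by simp
next
  case False
  define n where "n = norm g"
  have n: "0 < n" using False by (simp add: n_def)
  have gg: "n powr (p - 2) * (g \<bullet> g) = n powr p"
  proof -
    have "g \<bullet> g = n powr 2" using n by (simp add: n_def power2_norm_eq_inner[symmetric])
    then show ?thesis by (simp flip: powr_add)
  qed
  have s1: "n powr (p - 2) * a powr (1 - p) * (g \<bullet> \<psi>') \<le> p * m * (e * (n / a)) powr (p - 1)"
  proof -
    have "g \<bullet> \<psi>' \<le> n * (p * e powr (p - 1) * m)"
      using norm_cauchy_schwarz[of g \<psi>'] mult_left_mono[OF psi, of n] n unfolding n_def by linarith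
    then have "n powr (p - 2) * a powr (1 - p) * (g \<bullet> \<psi>') \<le> n powr (p - 2) * a powr (1 - p) * (n * (p * e powr (p - 1) * m))"
      by (intro mult_left_mono) auto
    also have "\<dots> = p * m * e powr (p - 1) * (n powr (p - 2) * n) * a powr (1 - p)" by simp
    also have "n powr (p - 2) * n = n powr (p - 1)"
      using n powr_add[of n "p - 2" 1] by simp
    also have "p * m * e powr (p - 1) * n powr (p - 1) * a powr (1 - p) = p * m * (e * (n / a)) powr (p - 1)"
      using e n a by (simp add: powr_mult powr_divide powr_diff field_simps)
    finally show ?thesis .
  qed
  have s2: "n powr (p - 2) * (e powr p * ((1 - p) * a powr (- p))) * (g \<bullet> g) = - (p - 1) * (e * (n / a)) powr p"
  proof -
    have "n powr (p - 2) * (e powr p * ((1 - p) * a powr (- p))) * (g \<bullet> g) =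
      (1 - p) * (e powr p * (n powr (p - 2) * (g \<bullet> g)) * a powr (- p))" by simp
    also have "\<dots> = (1 - p) * (e powr p * n powr p * a powr (- p))" by (simp only: gg)
    also have "e powr p * n powr p * a powr (- p) = (e * (n / a)) powr p"
      using e n a by (simp add: powr_mult powr_divide powr_minus_divide)
    finally show ?thesis by simp
  qed
  have "0 \<le> e * (n / a)" using e n a by simp
  note y = young_absorb[OF p m this]
  have "(norm g powr (p - 2) *\<^sub>R g) \<bullet> (a powr (1 - p) *\<^sub>R \<psi>' + (e powr p * ((1 - p) * a powr (- p))) *\<^sub>R g)
     = n powr (p - 2) * a powr (1 - p) * (g \<bullet> \<psi>') + n powr (p - 2) * (e powr p * ((1 - p) * a powr (- p))) * (g \<bullet> g)"
    by (simp add: n_def inner_add_right algebra_simps)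
  also have "\<dots> \<le> p * m * (e * (n / a)) powr (p - 1) - (p - 1) * (e * (n / a)) powr p"
    using s1 s2 by linarith
  also have "\<dots> \<le> p * (2 * p / (p - 1)) powr (p - 1) * m powr p - (p - 1) / 2 * (e * (n / a)) powr p"
  proof -
    have "(p - 1) * (e * (n / a)) powr p = (p - 1) / 2 * (e * (n / a)) powr p + (p - 1) / 2 * (e * (n / a)) powr p"
      by simp
    then show ?thesis using y by linarith
  qed
  finally show ?thesis by (simp add: n_def)
qed

lemma Tail_neg_part_finite:
  assumes "Tail \<mu> p u x0 R < \<infinity>" "1 < p"
  shows "tail_integral \<mu> p (neg_part u) x0 R < \<infinity>"
proof -
  have "tail_integral \<mu> p (neg_part u) x0 R \<le> tail_integral \<mu> p u x0 R"
    unfolding tail_integral_def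
  proof (intro nn_integral_mono mult_right_mono mult_left_mono ennreal_leI divide_right_mono)
    show "\<bar>neg_part u y\<bar> powr (p - 1) \<le> \<bar>u y\<bar> powr (p - 1)" for y
      using assms(2) by (intro powr_mono2) (auto simp: neg_part_def)
  qed auto
  also have "\<dots> < \<infinity>" using assms(1) by (auto simp: Tail_def less_top split: if_splits)
  finally show ?thesis .
qed

text \<open>
  The test function and its gradient are bounded by \<open>1 + |g0|\<close> up to a constant, since \<open>d > 0\<close> keeps the powers of
  \<open>u0 + d\<close> bounded. The integration by parts formula is the chain rule with \<open>H t = (t + d)\<^sup>1\<^sup>-\<^sup>p\<close>, applied to the product of the
  cutoff function and \<open>\<phi>\<close>.
\<close>

lemma test_function_W1p:
  fixes u0 v :: "'a::euclidean_space \<Rightarrow> real" and g0 gv :: "'a \<Rightarrow> 'a"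
  assumes p: "1 < p" and d: "0 < d" and \<rho>: "0 < \<rho>" "\<rho> < \<rho>'"
    and u0[measurable]: "u0 \<in> borel_measurable borel" and u0n: "\<And>x. 0 \<le> u0 x"
    and g0: "integrable lborel g0" "integrable lborel (\<lambda>x. norm (g0 x) powr p)"
    and ap: "C1_approx (cball x0 \<rho>') u0 g0 U G"
    and v_def: "\<And>x. v x = cutoff x0 \<rho> x powr p * (u0 x + d) powr (1 - p)"
    and gv_def: "\<And>x. gv x = (u0 x + d) powr (1 - p) *\<^sub>R cutoff_grad p x0 \<rho> x +
           (cutoff x0 \<rho> x powr p * ((1 - p) * (u0 x + d) powr (- p))) *\<^sub>R g0 x"
  shows "\<And>x. x \<notin> cball x0 \<rho> \<Longrightarrow> v x = 0" "\<And>x. x \<notin> cball x0 \<rho> \<Longrightarrow> gv x = 0"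
    "integrable lborel v" "integrable lborel (\<lambda>x. norm (v x) powr p)"
    "integrable lborel gv" "integrable lborel (\<lambda>x. norm (gv x) powr p)"
    "\<And>\<phi> D i. C1_grad \<phi> D \<Longrightarrow> i \<in> Basis \<Longrightarrow>
      (LINT x|lborel. v x * (D x \<bullet> i)) = - (LINT x|lborel. (gv x \<bullet> i) * \<phi> x)"
    "integrable lborel (\<lambda>x. (norm (g0 x) powr (p - 2) *\<^sub>R g0 x) \<bullet> gv x)"
proof -
  let ?\<eta> = "cutoff x0 \<rho>" and ?D = "cutoff_grad p x0 \<rho>" and ?K = "cball x0 \<rho>"
  note C = cutoff_powr_C1_grad[OF p \<rho>(1), of x0]
  have [measurable]: "g0 \<in> borel_measurable borel" using g0 by auto
  note [measurable] = C1_grad_measurable[OF C]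
  have eta0: "?\<eta> x = 0" if "x \<notin> ?K" for x
    using cutoff_zero[OF \<rho>(1), of x x0] that by auto
  have psi0: "?\<eta> x powr p = 0" if "x \<notin> ?K" for x using eta0[OF that] by simp
  have D0: "?D x = 0" if "x \<notin> ?K" for x
    by (rule C1_grad_support[OF C closed_cball psi0 that])
  have a: "0 < u0 x + d" for x using u0n[of x] d by linarith
  show v0: "v x = 0" if "x \<notin> ?K" for x using eta0[OF that] by (simp add: v_def)
  show gv0: "gv x = 0" if "x \<notin> ?K" for x using eta0[OF that] D0[OF that] by (simp add: gv_def)
  have [measurable]: "v \<in> borel_measurable borel" "gv \<in> borel_measurable borel"
    unfolding v_def[abs_def] gv_def[abs_def] by measurable
  define M where "M = d powr (1 - p) + (p - 1) * d powr (- p)"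
  have M0: "0 \<le> M" using p by (simp add: M_def)
  have Hb: "\<bar>(t + d) powr (1 - p)\<bar> \<le> M" "\<bar>(1 - p) * (t + d) powr (- p)\<bar> \<le> M" if "0 \<le> t" for t
  proof -
    have "(t + d) powr (1 - p) \<le> d powr (1 - p)" "(t + d) powr (- p) \<le> d powr (- p)"
      using that d p by (intro powr_mono2'; simp)+
    moreover have "(p - 1) * (t + d) powr (- p) \<le> (p - 1) * d powr (- p)"
      using calculation(2) p by (intro mult_left_mono) auto
    moreover have "\<bar>(t + d) powr (1 - p)\<bar> = (t + d) powr (1 - p)" by simp
    moreover have "\<bar>(1 - p) * (t + d) powr (- p)\<bar> = (p - 1) * (t + d) powr (- p)"
      using p by (simp add: abs_mult)
    moreover have "0 \<le> d powr (1 - p)" "0 \<le> (p - 1) * d powr (- p)" using p by auto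
    ultimately show "\<bar>(t + d) powr (1 - p)\<bar> \<le> M" "\<bar>(1 - p) * (t + d) powr (- p)\<bar> \<le> M"
      unfolding M_def by linarith+
  qed
  have eta1: "?\<eta> x powr p \<le> 1" for x
    using powr_mono2[of p "?\<eta> x" 1] p cutoff_bounds[of x0 \<rho> x] by simp
  define c where "c = M * (p * (2 / \<rho>) + 1)"
  have c0: "0 \<le> c" using M0 p \<rho> by (simp add: c_def)
  have Db: "norm (?D x) \<le> p * (2 / \<rho>)" for x
  proof -
    have "norm (?D x) \<le> p * ?\<eta> x powr (p - 1) * (2 / \<rho>)" by (rule cutoff_grad_bound[OF p \<rho>(1)])
    also have "\<dots> \<le> p * 1 * (2 / \<rho>)"
      using p \<rho>(1) powr_mono2[of "p - 1" "?\<eta> x" 1] cutoff_bounds[of x0 \<rho> x]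
      by (intro mult_right_mono mult_left_mono) auto
    finally show ?thesis by simp
  qed
  have vb: "norm (v x) \<le> M * indicator ?K x" for x
  proof (cases "x \<in> ?K")
    case True
    have "?\<eta> x powr p * (u0 x + d) powr (1 - p) \<le> 1 * M"
      using eta1[of x] Hb(1)[OF u0n[of x]] by (intro mult_mono) auto
    then show ?thesis using True by (simp add: v_def)
  qed (simp add: v0)
  have gb: "norm (gv x) \<le> c * (indicator ?K x + norm (g0 x))" for x
  proof (cases "x \<in> ?K")
    case True
    have "norm (gv x) \<le> norm ((u0 x + d) powr (1 - p) *\<^sub>R ?D x) + norm ((?\<eta> x powr p * ((1 - p) * (u0 x + d) powr (- p))) *\<^sub>R g0 x)"
      unfolding gv_def by (rule norm_triangle_ineq)
    also have "norm ((u0 x + d) powr (1 - p) *\<^sub>R ?D x) \<le> M * (p * (2 / \<rho>))"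
      unfolding norm_scaleR using Hb(1)[OF u0n[of x]] Db[of x] M0 by (intro mult_mono) auto
    also have "norm ((?\<eta> x powr p * ((1 - p) * (u0 x + d) powr (- p))) *\<^sub>R g0 x) \<le> (1 * M) * norm (g0 x)"
      unfolding norm_scaleR abs_mult[of "?\<eta> x powr p"] using Hb(2)[OF u0n[of x]] eta1[of x] M0
      by (intro mult_mono mult_right_mono) auto
    also have "M * (p * (2 / \<rho>)) + (1 * M) * norm (g0 x) \<le> c * (1 + norm (g0 x))"
    proof -
      have expand: "M * (q + 1) * (1 + t) = M * q + (1 * M) * t + (M + M * q * t)" for q t
        by (simp add: algebra_simps)
      have "c * (1 + norm (g0 x)) = M * (p * (2 / \<rho>)) + (1 * M) * norm (g0 x) + (M + M * (p * (2 / \<rho>)) * norm (g0 x))"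
        unfolding c_def by (rule expand)
      moreover have "0 \<le> M + M * (p * (2 / \<rho>)) * norm (g0 x)" using M0 p \<rho> by simp
      ultimately show ?thesis by linarith
    qed
    finally show ?thesis using True by simp
  next
    case False
    then show ?thesis using c0 by (simp add: gv0)
  qed
  have iK: "integrable lborel (\<lambda>x. indicator ?K x :: real)"
    using emeasure_bounded_finite[OF bounded_cball, of x0 \<rho>] by simp
  have bd: "integrable lborel f" if "f \<in> borel_measurable lborel" "integrable lborel h" "\<And>x. norm (f x) \<le> h x"
    for f :: "'a \<Rightarrow> 'c::{banach,second_countable_topology}" and h :: "'a \<Rightarrow> real"
    by (rule Bochner_Integration.integrable_bound[OF that(2,1)])
       (use that(3) in \<open>auto intro!: AE_I2 intro: order_trans[OF _ abs_ge_self]\<close>)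
  show iv: "integrable lborel v" by (rule bd[OF _ _ vb]) (use iK in auto)
  show ivp: "integrable lborel (\<lambda>x. norm (v x) powr p)"
  proof (rule bd)
    show "integrable lborel (\<lambda>x. M powr p * indicator ?K x)" using iK by simp
    show "norm (norm (v x) powr p) \<le> M powr p * indicator ?K x" for x
      using vb[of x] p M0 powr_mono2[of p "norm (v x)" M] by (cases "x \<in> ?K") (auto simp: v0)
  qed measurable
  show igv: "integrable lborel gv" by (rule bd[OF _ _ gb]) (use iK g0 in auto)
  show "integrable lborel (\<lambda>x. norm (gv x) powr p)"
  proof (rule bd)
    show "integrable lborel (\<lambda>x. c powr p * (2 powr p * (indicator ?K x + norm (g0 x) powr p)))" using iK g0 by simp
    show "norm (norm (gv x) powr p) \<le> c powr p * (2 powr p * (indicator ?K x + norm (g0 x) powr p))" for x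
    proof -
      have "norm (gv x) powr p \<le> (c * (indicator ?K x + norm (g0 x))) powr p"
        using gb[of x] p by (intro powr_mono2) auto
      also have "\<dots> = c powr p * (indicator ?K x + norm (g0 x)) powr p" using c0 by (simp add: powr_mult)
      also have "\<dots> \<le> c powr p * (2 powr p * (indicator ?K x powr p + norm (g0 x) powr p))"
        using p by (intro mult_left_mono powr_add_le) auto
      also have "indicator ?K x powr p = (indicator ?K x :: real)" by (simp add: indicator_def)
      finally show ?thesis by simp
    qed
  qed measurable
  show "integrable lborel (\<lambda>x. (norm (g0 x) powr (p - 2) *\<^sub>R g0 x) \<bullet> gv x)"
  proof (rule bd)
    show "integrable lborel (\<lambda>x. c * (indicator ?K x + 2 * norm (g0 x) powr p))" using iK g0 by simp
    show "norm ((norm (g0 x) powr (p - 2) *\<^sub>R g0 x) \<bullet> gv x) \<le> c * (indicator ?K x + 2 * norm (g0 x) powr p)" for x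
    proof -
      define n where "n = norm (g0 x)"
      define k where "k = (indicator ?K x :: real)"
      have n: "0 \<le> n" and k: "k = 0 \<or> k = 1" by (auto simp: n_def k_def indicator_def)
      have "norm ((norm (g0 x) powr (p - 2) *\<^sub>R g0 x) \<bullet> gv x) \<le> (n powr (p - 2) * n) * norm (gv x)"
        using Cauchy_Schwarz_ineq2[of "norm (g0 x) powr (p - 2) *\<^sub>R g0 x" "gv x"] by (simp add: n_def)
      also have "n powr (p - 2) * n = n powr (p - 1)"
        using n powr_add[of n "p - 2" 1] by (cases "n = 0") auto
      also have "n powr (p - 1) * norm (gv x) \<le> n powr (p - 1) * (c * (k + n))"
        using gb[of x] by (intro mult_left_mono) (auto simp: n_def k_def)
      also have "\<dots> = c * (k * n powr (p - 1) + n powr (p - 1) * n)" by (simp add: algebra_simps)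
      also have "n powr (p - 1) * n = n powr p"
        using n powr_add[of n "p - 1" 1] by (cases "n = 0") auto
      also have "k * n powr (p - 1) \<le> k + n powr p"
      proof (cases "n \<le> 1")
        case True
        then have "n powr (p - 1) \<le> 1" using n p powr_mono2[of "p - 1" n 1] by simp
        then show ?thesis using k by (auto intro: order_trans)
      next
        case False
        then have "n powr (p - 1) \<le> n powr p" by (intro powr_mono) auto
        then show ?thesis using k by auto
      qed
      finally show ?thesis using c0 by (simp add: n_def k_def mult_left_mono add.commute)
    qed
  qed measurable
  fix \<phi> and D :: "'a \<Rightarrow> 'a" and i :: 'a assume phi: "C1_grad \<phi> D" and i: "i \<in> Basis"
  have cphi: "continuous_on UNIV \<phi>" by (rule C1_grad_continuous[OF phi])
  have cD: "continuous_on UNIV (\<lambda>x. D x \<bullet> i)" using phi by (auto simp: C1_grad_def intro!: continuous_intros)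
  have i1: "integrable lborel (\<lambda>x. v x * (D x \<bullet> i))"
    using integrable_times_continuous[OF iv compact_cball v0 cD] by (simp add: mult.commute)
  have i2: "integrable lborel (\<lambda>x. (gv x \<bullet> i) * \<phi> x)"
    using integrable_times_continuous[of "\<lambda>x. gv x \<bullet> i", OF _ compact_cball[of x0 \<rho>] _ cphi] igv gv0
    by (simp add: mult.commute)
  have chi: "C1_grad (\<lambda>x. ?\<eta> x powr p * \<phi> x) (\<lambda>x. \<phi> x *\<^sub>R ?D x + (?\<eta> x powr p) *\<^sub>R D x)"
    by (rule C1_grad_mult[OF C phi])
  have "(LINT x|lborel. (u0 x + d) powr (1 - p) * ((\<phi> x *\<^sub>R ?D x + (?\<eta> x powr p) *\<^sub>R D x) \<bullet> i) +
      (?\<eta> x powr p * \<phi> x) * ((1 - p) * (u0 x + d) powr (- p)) * (g0 x \<bullet> i)) = 0"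
    by (rule chain_rule_limit[OF ap _ u0 u0n g0(1) shifted_powr_deriv[OF d] shifted_powr_continuous[OF d] Hb chi compact_cball])
       (use \<rho> eta0 in auto)
  also have "(\<lambda>x. (u0 x + d) powr (1 - p) * ((\<phi> x *\<^sub>R ?D x + (?\<eta> x powr p) *\<^sub>R D x) \<bullet> i) +
      (?\<eta> x powr p * \<phi> x) * ((1 - p) * (u0 x + d) powr (- p)) * (g0 x \<bullet> i)) =
      (\<lambda>x. v x * (D x \<bullet> i) + (gv x \<bullet> i) * \<phi> x)"
    by (simp add: fun_eq_iff v_def gv_def inner_add_left algebra_simps)
  finally show "(LINT x|lborel. v x * (D x \<bullet> i)) = - (LINT x|lborel. (gv x \<bullet> i) * \<phi> x)"
    using i1 i2 by simp
qed

text \<open>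
  The selected weak gradients are replaced by Borel functions; they have to be known only on a set outside of which the
  gradient of the test function vanishes.
\<close>

lemma local_form_eq:
  fixes u v :: "'a::euclidean_space \<Rightarrow> real"
  assumes op: "open \<Omega>"
    and wu: "is_weak_gradient \<Omega> u g" and wv: "is_weak_gradient \<Omega> v gv"
    and K: "K \<subseteq> \<Omega>" and [measurable]: "g0 \<in> borel_measurable borel" "gv \<in> borel_measurable borel"
    and g0: "AE x in lborel. x \<in> K \<longrightarrow> g0 x = g x" and gv: "\<And>x. x \<notin> K \<Longrightarrow> gv x = 0"
  shows "local_form p \<Omega> u v = (LINT x|lborel. (norm (g0 x) powr (p - 2) *\<^sub>R g0 x) \<bullet> gv x)"
proof -
  let ?W = "\<lambda>x. indicator \<Omega> x *\<^sub>R weak_gradient \<Omega> u x" and ?V = "\<lambda>x. indicator \<Omega> x *\<^sub>R weak_gradient \<Omega> v x"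
  have [measurable]: "?W \<in> borel_measurable lebesgue" "?V \<in> borel_measurable lebesgue"
    using weak_gradient_represents(1)[OF wu op] weak_gradient_represents(1)[OF wv op]
    by (auto simp: is_weak_gradient_def Lp_loc_def set_borel_measurable_def)
  have eq: "(\<lambda>x. indicator \<Omega> x *\<^sub>R ((norm (weak_gradient \<Omega> u x) powr (p - 2) *\<^sub>R weak_gradient \<Omega> u x) \<bullet> weak_gradient \<Omega> v x))
     = (\<lambda>x. (norm (?W x) powr (p - 2) *\<^sub>R ?W x) \<bullet> ?V x)"
    by (auto simp: fun_eq_iff indicator_def)
  show ?thesis
    unfolding local_form_def set_lebesgue_integral_def eq
  proof (rule integrable_lebesgue_lborel(2))
    show "AE x in lborel. (norm (?W x) powr (p - 2) *\<^sub>R ?W x) \<bullet> ?V x = (norm (g0 x) powr (p - 2) *\<^sub>R g0 x) \<bullet> gv x"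
      using weak_gradient_represents(2)[OF wu op] weak_gradient_represents(2)[OF wv op] g0
    proof eventually_elim
      case (elim x)
      show ?case
      proof (cases "x \<in> K")
        case True
        then have "x \<in> \<Omega>" using K by blast
        then show ?thesis using elim True by simp
      next
        case False
        then show ?thesis using elim gv[OF False] by (cases "x \<in> \<Omega>") auto
      qed
    qed
  qed measurable
qed

text \<open>
  The constant in front of \<open>m\<^sup>p\<close> in \<open>local_energy_pointwise\<close>.
\<close>

definition local_const :: "real \<Rightarrow> real" where
  "local_const p = p * (2 * p / (p - 1)) powr (p - 1)"

text \<open>
  The fraction \<open>49 / 13\<close> is the inverse of the lower bound \<open>1 - (6 / 7)\<^sup>2\<close> for the cutoff function of radius \<open>7 r\<close> on the ball
  of radius \<open>6 r\<close>; \<open>\<alpha>\<close> is the weight of the local form.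
\<close>

definition log_gradient_const :: "nat \<Rightarrow> real \<Rightarrow> real \<Rightarrow> real \<Rightarrow> real \<Rightarrow> real" where
  "log_gradient_const N p M m \<alpha> = unit_ball_vol (real N) * 6 ^ N + (49 / 13) powr p *
     (2 / (\<alpha> * (p - 1)) * (nonlocal_const N p M m + \<alpha> * (local_const p * (unit_ball_vol (real N) * 7 ^ N))))"

lemma log_gradient_const_pos:
  assumes "1 < p" "0 < M" "0 \<le> m" "0 < \<alpha>" shows "0 < log_gradient_const N p M m \<alpha>"
proof -
  have "0 < nonlocal_const N p M m" by (rule nonlocal_const_pos[OF assms(1-3)])
  then have "0 \<le> (49 / 13) powr p *
     (2 / (\<alpha> * (p - 1)) * (nonlocal_const N p M m + \<alpha> * (local_const p * (unit_ball_vol (real N) * 7 ^ N))))"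
    using assms unfolding local_const_def
    by (intro mult_nonneg_nonneg divide_nonneg_nonneg add_nonneg_nonneg) auto
  then show ?thesis unfolding log_gradient_const_def by (intro add_pos_nonneg) auto
qed

text \<open>
  The weak inequality is applied to \<open>v = \<eta>\<^sup>p (u0 + d)\<^sup>1\<^sup>-\<^sup>p\<close> on the ball of radius \<open>8 r\<close>. With \<open>L = |g0| / (u0 + d)\<close>, the upper
  bounds for the nonlocal form and for the local integrand leave an estimate of the integral of \<open>(\<eta> L)\<^sup>p\<close> by a multiple
  of \<open>r\<^sup>N\<^sup>-\<^sup>p\<close>. On the ball of radius \<open>6 r\<close> this passes to \<open>L\<close> by \<open>r L \<le> 1 + (r L)\<^sup>p\<close>. The functions \<open>u0\<close> and \<open>g0\<close> represent
  \<open>u\<close> and its gradient near the centre, and the approximation is handed on to the Poincare inequality.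
\<close>

lemma log_gradient_estimate:
  fixes u :: "'a::euclidean_space \<Rightarrow> real" and \<mu> :: "real measure"
  assumes p: "1 < p" and sets: "sets \<mu> = sets (restrict_space borel {0..1})" and fin: "finite_measure \<mu>"
    and alpha: "0 < measure \<mu> {1}"
    and M: "0 < M" "\<And>s. s \<in> {0<..<1} \<Longrightarrow> 0 \<le> frac_const DIM('a) s p"
      "\<And>s. s \<in> {0<..<1} \<Longrightarrow> frac_const DIM('a) s p \<le> M * (s * (1 - s))"
    and op: "open \<Omega>" and super: "weak_supersolution \<mu> p \<Omega> u" and BR: "ball x0 R \<subseteq> \<Omega>"
    and upos: "AE x in lborel. x \<in> ball x0 R \<longrightarrow> 0 \<le> u x"
    and r: "0 < r" "r \<le> 1" "16 * r < R" and d: "0 < d"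
    and dT: "\<And>s. s \<in> measure_support \<mu> \<Longrightarrow> (r / R) powr (s * p / (p - 1)) * enn2real (Tail \<mu> p (neg_part u) x0 R) \<le> 2 * d"
  obtains u0 g0 U G where "u0 \<in> borel_measurable borel" "\<And>x. 0 \<le> u0 x"
    "AE x in lborel. x \<in> ball x0 (8 * r) \<longrightarrow> u0 x = u x" "integrable lborel g0"
    "C1_approx (cball x0 (8 * r)) u0 g0 U G"
    "(LINT x|lborel. indicator (ball x0 (6 * r)) x * (\<bar>1 / (u0 x + d)\<bar> * norm (g0 x)))
      \<le> log_gradient_const DIM('a) p M (measure \<mu> (space \<mu>)) (measure \<mu> {1}) * r ^ DIM('a) / r"
proof -
  define \<alpha> where "\<alpha> = measure \<mu> {1}"
  have \<alpha>: "0 < \<alpha>" using alpha by (simp add: \<alpha>_def)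
  define V where "V = unit_ball_vol (real DIM('a))"
  have V: "0 < V" by (simp add: V_def)
  define Kp where "Kp = local_const p"
  have Kp: "0 \<le> Kp" using p by (simp add: Kp_def local_const_def)
  define CN where "CN = nonlocal_const DIM('a) p M (measure \<mu> (space \<mu>))"
  define C2 where "C2 = 2 / (\<alpha> * (p - 1)) * (CN + \<alpha> * (Kp * (V * 7 ^ DIM('a))))"
  define C where "C = V * 6 ^ DIM('a) + (49 / 13) powr p * C2"
  have C: "C = log_gradient_const DIM('a) p M (measure \<mu> (space \<mu>)) (measure \<mu> {1})"
    by (simp add: C_def C2_def CN_def Kp_def V_def \<alpha>_def log_gradient_const_def)
  let ?N = "DIM('a)"
  let ?K = "cball x0 (9 * r)"
  have KB: "?K \<subseteq> ball x0 R" using r by auto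
  have K\<Omega>: "?K \<subseteq> \<Omega>" using KB BR by blast
  have uW: "u \<in> W1p_loc p \<Omega>" and uT: "u \<in> tail_space \<mu> p" using super by (auto simp: weak_supersolution_def)
  have um: "u \<in> borel_measurable lebesgue"
    using uT by (simp add: tail_space_def Lp_loc_def set_borel_measurable_def)
  have tf: "tail_integral \<mu> p (neg_part u) x0 R < \<infinity>"
    using uT r by (intro Tail_neg_part_finite p) (simp add: tail_space_def)
  obtain g where g: "is_weak_gradient \<Omega> u g" "Lp_loc p \<Omega> g" and uL: "Lp_loc p \<Omega> u"
    using uW by (auto simp: W1p_loc_def)
  have p0: "0 < p" using p by simp
  obtain u1 where u1[measurable]: "u1 \<in> borel_measurable borel" and u1K: "\<And>x. x \<notin> ?K \<Longrightarrow> u1 x = 0"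
    "AE x in lborel. x \<in> ?K \<longrightarrow> u1 x = u x" "integrable lborel (\<lambda>x. norm (u1 x) powr p)"
    by (rule Lp_loc_borel_restriction[OF uL compact_cball K\<Omega> p0]) blast
  obtain g0 where g0[measurable]: "g0 \<in> borel_measurable borel" and g0K: "\<And>x. x \<notin> ?K \<Longrightarrow> g0 x = 0"
    "AE x in lborel. x \<in> ?K \<longrightarrow> g0 x = g x" and g0p: "integrable lborel (\<lambda>x. norm (g0 x) powr p)"
    by (rule Lp_loc_borel_restriction[OF g(2) compact_cball K\<Omega> p0]) blast
  (* The negative values of u1 form a null set; without them u0 is nonnegative everywhere,
     as the approximation requires. *)
  define u0 where "u0 x = max 0 (u1 x)" for x
  have u0[measurable]: "u0 \<in> borel_measurable borel" unfolding u0_def[abs_def] by measurable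
  have u0n: "0 \<le> u0 x" for x by (simp add: u0_def)
  have u0u: "AE x in lborel. x \<in> ?K \<longrightarrow> u0 x = u x"
    using u1K(2) upos by eventually_elim (use KB in \<open>auto simp: u0_def\<close>)
  have u0u8: "AE x in lborel. x \<in> ball x0 (8 * r) \<longrightarrow> u0 x = u x"
    using u0u by eventually_elim (use r in auto)
  have iu1: "integrable lborel u1" by (rule integrable_of_powr[OF _ u1 compact_cball u1K(1,3)]) (use p in simp)
  have iu0: "integrable lborel u0" unfolding u0_def[abs_def] using iu1 by simp
  have ig0: "integrable lborel g0" by (rule integrable_of_powr[OF _ g0 compact_cball g0K(1) g0p]) (use p in simp)
  obtain U G where ap: "C1_approx (cball x0 (8 * r)) u0 g0 U G"
    by (rule weak_gradient_C1_approx[OF g(1) _ K\<Omega> iu0 u0u ig0 g0K(2), of "8 * r"]) (use r in auto)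
  have rho: "0 < 7 * r" "7 * r < 8 * r" using r by auto
  define \<eta> where "\<eta> = cutoff x0 (7 * r)"
  define v where "v x = \<eta> x powr p * (u0 x + d) powr (1 - p)" for x
  define gv where "gv x = (u0 x + d) powr (1 - p) *\<^sub>R cutoff_grad p x0 (7 * r) x +
         (\<eta> x powr p * ((1 - p) * (u0 x + d) powr (- p))) *\<^sub>R g0 x" for x
  note T = test_function_W1p[OF p d rho u0 u0n ig0 g0p ap v_def[unfolded \<eta>_def] gv_def[unfolded \<eta>_def]]
  have B8: "closure (ball x0 (8 * r)) \<subseteq> \<Omega>" "compact (closure (ball x0 (8 * r)))"
    using K\<Omega> r by auto
  have [measurable]: "gv \<in> borel_measurable borel" using T(5) by auto
  have vn: "0 \<le> v x" for x by (simp add: v_def)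
  have vW: "v \<in> W1p_zero p (ball x0 (8 * r))"
    by (rule W1p_zeroI[OF p rho(2) T(3) T(1) T(4) T(5) T(2) T(6) T(7)])
  have sub7: "cball x0 (7 * r) \<subseteq> ?K" using r by auto
  have wv: "is_weak_gradient \<Omega> v gv"
  proof (rule weak_gradient_of_identity[OF _ T(3) _ T(5) _ T(7)])
    show "\<Omega> \<in> sets lebesgue" using op by auto
  next
    fix x assume "x \<notin> \<Omega>"
    then have "x \<notin> cball x0 (7 * r)" using sub7 K\<Omega> by blast
    then show "v x = 0" "gv x = 0" using T(1,2) by blast+
  qed
  define X where "X x = (norm (g0 x) powr (p - 2) *\<^sub>R g0 x) \<bullet> gv x" for x
  have iX: "integrable lborel X" unfolding X_def[abs_def] by (rule T(8))
  have LF: "local_form p \<Omega> u v = (LINT x|lborel. X x)"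
    unfolding X_def
  proof (rule local_form_eq[OF op g(1) wv K\<Omega> g0 _ g0K(2)])
    show "gv x = 0" if "x \<notin> ?K" for x using T(2) that sub7 by blast
  qed measurable
  have "0 \<le> (LINT s:{0<..<1}|\<mu>. frac_const ?N s p * nonlocal_form p s u v) + \<alpha> * local_form p \<Omega> u v"
    using super vW vn B8 unfolding weak_supersolution_def \<alpha>_def by (auto dest!: spec[of _ "ball x0 (8 * r)"])
  moreover have "(LINT s:{0<..<1}|\<mu>. frac_const ?N s p * nonlocal_form p s u v) \<le> CN * r powr (real ?N - p)"
  unfolding CN_def
  proof (rule nonlocal_energy_bound[OF p sets fin M r d _ _ _ _ um u0n u0u8 upos _ tf dT])
    show "\<bar>\<eta> x - \<eta> y\<bar> \<le> norm (x - y) / r" for x y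
    proof -
      have "\<bar>\<eta> x - \<eta> y\<bar> \<le> 2 / (7 * r) * norm (x - y)" unfolding \<eta>_def by (rule cutoff_lipschitz[OF rho(1)])
      also have "\<dots> \<le> 1 / r * norm (x - y)" using r by (intro mult_right_mono) (auto simp: field_simps)
      finally show ?thesis by simp
    qed
    show "\<eta> x = 0" if "x \<notin> ball x0 (7 * r)" for x unfolding \<eta>_def by (rule cutoff_zero[OF rho(1) that])
  qed (simp_all add: \<eta>_def cutoff_bounds v_def)
  ultimately have low: "0 \<le> CN * r powr (real ?N - p) + \<alpha> * (LINT x|lborel. X x)"
    unfolding LF by linarith
  define L where "L x = norm (g0 x) / (u0 x + d)" for x
  have L0: "0 \<le> L x" for x using u0n[of x] d by (simp add: L_def)
  have [measurable]: "L \<in> borel_measurable borel" unfolding L_def[abs_def] by measurable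
  have [measurable]: "\<eta> \<in> borel_measurable borel" unfolding \<eta>_def cutoff_def[abs_def] by measurable
  have \<eta>01: "0 \<le> \<eta> x" "\<eta> x \<le> 1" for x by (simp_all add: \<eta>_def cutoff_bounds)
  have Ld: "L x \<le> norm (g0 x) / d" for x
    unfolding L_def using u0n[of x] d by (intro divide_left_mono) auto
  have Lp: "L x powr p \<le> d powr (- p) * norm (g0 x) powr p" for x
  proof -
    have "L x powr p \<le> (norm (g0 x) / d) powr p" using p L0 Ld by (intro powr_mono2) auto
    then show ?thesis using d by (simp add: powr_divide powr_minus_divide)
  qed
  have iLp: "integrable lborel (\<lambda>x. L x powr p)"
    by (rule Bochner_Integration.integrable_bound[of _ "\<lambda>x. d powr (- p) * norm (g0 x) powr p"])
       (use g0p Lp in auto)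
  have i\<eta>L: "integrable lborel (\<lambda>x. (\<eta> x * L x) powr p)"
  proof (rule Bochner_Integration.integrable_bound[OF iLp])
    show "AE x in lborel. norm ((\<eta> x * L x) powr p) \<le> norm (L x powr p)"
    proof (intro AE_I2)
      fix x
      have "\<eta> x * L x \<le> 1 * L x" using \<eta>01 L0 by (intro mult_right_mono)
      then show "norm ((\<eta> x * L x) powr p) \<le> norm (L x powr p)"
        using p \<eta>01 L0 by (auto intro!: powr_mono2)
    qed
  qed measurable
  define B7 where "B7 = cball x0 (7 * r)"
  have iB7: "integrable lborel (\<lambda>x. indicator B7 x :: real)"
    using emeasure_bounded_finite[OF bounded_cball, of x0 "7 * r"] by (simp add: B7_def)
  have XL: "X x \<le> Kp * r powr (- p) * indicator B7 x - (p - 1) / 2 * (\<eta> x * L x) powr p" for x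
  proof (cases "x \<in> B7")
    case True
    have "X x \<le> p * (2 * p / (p - 1)) powr (p - 1) * (1 / r) powr p - (p - 1) / 2 * (\<eta> x * (norm (g0 x) / (u0 x + d))) powr p"
      unfolding X_def gv_def
    proof (rule local_energy_pointwise[OF p])
      show "0 < u0 x + d" using u0n[of x] d by linarith
      have "norm (cutoff_grad p x0 (7 * r) x) \<le> p * \<eta> x powr (p - 1) * (2 / (7 * r))"
        unfolding \<eta>_def by (rule cutoff_grad_bound[OF p rho(1)])
      also have "\<dots> \<le> p * \<eta> x powr (p - 1) * (1 / r)"
        using p r by (intro mult_left_mono) (auto simp: field_simps)
      finally show "norm (cutoff_grad p x0 (7 * r) x) \<le> p * \<eta> x powr (p - 1) * (1 / r)" .
    qed (use \<eta>01 r in auto)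
    moreover have "(1 / r) powr p = r powr (- p)" using r by (simp add: powr_divide powr_minus_divide)
    ultimately show ?thesis using True by (simp add: Kp_def local_const_def L_def)
  next
    case False
    then have "gv x = 0" using T(2) by (simp add: B7_def)
    moreover have "\<eta> x = 0" using False unfolding \<eta>_def by (intro cutoff_zero[OF rho(1)]) (auto simp: B7_def)
    ultimately show ?thesis using False by (simp add: X_def)
  qed
  have "(LINT x|lborel. X x) \<le> (LINT x|lborel. Kp * r powr (- p) * indicator B7 x - (p - 1) / 2 * (\<eta> x * L x) powr p)"
    using iX iB7 i\<eta>L XL by (intro integral_mono) auto
  also have "\<dots> = Kp * r powr (- p) * measure lborel B7 - (p - 1) / 2 * (LINT x|lborel. (\<eta> x * L x) powr p)"
    using iB7 i\<eta>L by simp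
  also have "measure lborel B7 = V * 7 ^ ?N * r ^ ?N"
    using r by (simp add: B7_def content_cball V_def power_mult_distrib)
  finally have Xle: "(LINT x|lborel. X x) \<le> Kp * r powr (- p) * (V * 7 ^ ?N * r ^ ?N) - (p - 1) / 2 * (LINT x|lborel. (\<eta> x * L x) powr p)" .
  have rN: "r powr (real ?N - p) = r ^ ?N * r powr (- p)"
    using r by (simp add: powr_realpow[symmetric] flip: powr_add)
  define J where "J = (LINT x|lborel. (\<eta> x * L x) powr p)"
  have J: "J \<le> C2 * (r ^ ?N * r powr (- p))"
  proof -
    have "\<alpha> * (LINT x|lborel. X x) \<le> \<alpha> * (Kp * r powr (- p) * (V * 7 ^ ?N * r ^ ?N) - (p - 1) / 2 * J)"
      using \<alpha> Xle unfolding J_def by (intro mult_left_mono) auto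
    then have "0 \<le> CN * (r ^ ?N * r powr (- p)) + \<alpha> * (Kp * r powr (- p) * (V * 7 ^ ?N * r ^ ?N) - (p - 1) / 2 * J)"
      using low unfolding rN by linarith
    then have "\<alpha> * (p - 1) / 2 * J \<le> (CN + \<alpha> * (Kp * (V * 7 ^ ?N))) * (r ^ ?N * r powr (- p))"
      by (simp add: algebra_simps)
    moreover have "0 < \<alpha> * (p - 1) / 2" using \<alpha> p by simp
    ultimately have "J \<le> (CN + \<alpha> * (Kp * (V * 7 ^ ?N))) * (r ^ ?N * r powr (- p)) / (\<alpha> * (p - 1) / 2)"
      by (simp add: pos_le_divide_eq mult.commute)
    also have "\<dots> = C2 * (r ^ ?N * r powr (- p))" using \<alpha> p by (simp add: C2_def field_simps)
    finally show ?thesis .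
  qed
  define B6 where "B6 = ball x0 (6 * r)"
  have [measurable]: "B6 \<in> sets borel" by (simp add: B6_def)
  have iB6: "integrable lborel (\<lambda>x. indicator B6 x :: real)"
    using emeasure_bounded_finite[OF bounded_ball, of x0 "6 * r"] by (simp add: B6_def)
  have \<eta>6: "13 / 49 \<le> \<eta> x" if "x \<in> B6" for x
  proof -
    have "norm (x - x0) \<le> 6 * r" using that by (simp add: B6_def dist_norm norm_minus_commute)
    then have "(x - x0) \<bullet> (x - x0) \<le> (6 * r)\<^sup>2"
      unfolding power2_norm_eq_inner[symmetric] by (intro power_mono) auto
    then have "((x - x0) \<bullet> (x - x0)) / (7 * r)\<^sup>2 \<le> (6 * r)\<^sup>2 / (7 * r)\<^sup>2" by (intro divide_right_mono) auto
    also have "\<dots> = 36 / 49" using r by (simp add: power2_eq_square)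
    finally show ?thesis by (simp add: \<eta>_def cutoff_def)
  qed
  have rL: "indicator B6 x * L x \<le> 1 / r * (indicator B6 x + r powr p * (49 / 13) powr p * (\<eta> x * L x) powr p)" for x
  proof (cases "x \<in> B6")
    case True
    have "r * L x \<le> 1 + (r * L x) powr p"
    proof (cases "r * L x \<le> 1")
      case False
      then show ?thesis using powr_mono[of 1 p "r * L x"] p by simp
    next
      case True
      moreover have "0 \<le> (r * L x) powr p" by simp
      ultimately show ?thesis by linarith
    qed
    also have "(r * L x) powr p \<le> (r * (49 / 13 * (\<eta> x * L x))) powr p"
    proof (rule powr_mono2)
      have "1 * L x \<le> (49 / 13 * \<eta> x) * L x" using \<eta>6[OF True] L0 by (intro mult_right_mono) auto
      then show "r * L x \<le> r * (49 / 13 * (\<eta> x * L x))" using r by (intro mult_left_mono) auto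
    qed (use p r L0 in auto)
    also have "\<dots> = r powr p * (49 / 13) powr p * (\<eta> x * L x) powr p"
      by (simp only: powr_mult mult.assoc)
    finally have "1 / r * (r * L x) \<le> 1 / r * (1 + r powr p * (49 / 13) powr p * (\<eta> x * L x) powr p)"
      using r by (intro mult_left_mono) auto
    then show ?thesis using True r by simp
  qed (use r in simp)
  have "(LINT x|lborel. indicator B6 x * (\<bar>1 / (u0 x + d)\<bar> * norm (g0 x))) = (LINT x|lborel. indicator B6 x * L x)"
    using u0n d by (intro Bochner_Integration.integral_cong) (auto simp: L_def abs_of_nonneg add_nonneg_nonneg less_imp_le)
  also have "\<dots> \<le> (LINT x|lborel. 1 / r * (indicator B6 x + r powr p * (49 / 13) powr p * (\<eta> x * L x) powr p))"
    using iB6 i\<eta>L rL r by (intro integral_mono') (auto intro!: mult_nonneg_nonneg add_nonneg_nonneg)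
  also have "\<dots> = 1 / r * (measure lborel B6 + r powr p * (49 / 13) powr p * J)"
    using iB6 i\<eta>L by (simp add: J_def)
  also have "\<dots> \<le> 1 / r * (measure lborel B6 + r powr p * (49 / 13) powr p * (C2 * (r ^ ?N * r powr (- p))))"
    using r by (intro mult_left_mono add_left_mono J) auto
  also have "r powr p * (49 / 13) powr p * (C2 * (r ^ ?N * r powr (- p))) = (49 / 13) powr p * C2 * r ^ ?N * (r powr p * r powr (- p))"
    by (simp only: ac_simps)
  also have "r powr p * r powr (- p) = 1" using r by (simp flip: powr_add)
  also have "measure lborel B6 = V * 6 ^ ?N * r ^ ?N"
    using r by (simp add: B6_def content_ball V_def power_mult_distrib)
  also have "1 / r * (V * 6 ^ ?N * r ^ ?N + (49 / 13) powr p * C2 * r ^ ?N * 1) = C * r ^ ?N / r"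
    by (simp add: C_def add_divide_distrib ring_distribs)
  finally have "(LINT x|lborel. indicator (ball x0 (6 * r)) x * (\<bar>1 / (u0 x + d)\<bar> * norm (g0 x))) \<le> C * r ^ ?N / r"
    by (simp only: B6_def)
  with u0 u0n u0u8 ig0 ap show ?thesis using that unfolding C by blast
qed

section \<open>The measure estimate\<close>

text \<open>
  For \<open>x\<close> in \<open>S\<close> and \<open>y\<close> in \<open>E\<close> the logarithms differ by at least \<open>ln (1 / (2 \<delta>))\<close>; the double integral is restricted to
  these pairs.
\<close>

lemma level_set_estimate:
  fixes u0 :: "'a::euclidean_space \<Rightarrow> real"
  assumes [measurable]: "u0 \<in> borel_measurable borel" and u0: "\<And>x. 0 \<le> u0 x" and d: "0 < d"
    and B: "B \<in> sets borel" "emeasure lborel B < \<infinity>" and \<zeta>: "0 < \<zeta>" and \<delta>: "0 < \<delta>" "\<delta> < 1 / 2"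
    and S: "S \<in> sets borel" "S \<subseteq> B" "\<And>x. x \<in> S \<Longrightarrow> u0 x + d \<le> 2 * \<delta> * \<zeta>"
    and E: "E \<in> sets borel" "E \<subseteq> B" "\<And>x. x \<in> E \<Longrightarrow> \<zeta> \<le> u0 x"
    and le: "(\<integral>\<^sup>+x. \<integral>\<^sup>+y. ennreal \<bar>ln (u0 x + d) - ln (u0 y + d)\<bar> * (indicator B x * indicator B y) \<partial>lborel \<partial>lborel)
      \<le> ennreal Q" and Q: "0 \<le> Q"
  shows "ln (1 / (2 * \<delta>)) * measure lborel S * measure lborel E \<le> Q"
proof -
  note [measurable] = B(1) S(1) E(1)
  let ?l = "ln (1 / (2 * \<delta>))"
  have l: "0 \<le> ?l" using \<delta> by simp
  have fS: "emeasure lborel S < \<infinity>" and fE: "emeasure lborel E < \<infinity>"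
    using B emeasure_mono[OF S(2), of lborel] emeasure_mono[OF E(2), of lborel] by (auto intro: le_less_trans)
  have "ennreal ?l * emeasure lborel E * emeasure lborel S = (\<integral>\<^sup>+x. ennreal ?l * emeasure lborel E * indicator S x \<partial>lborel)"
    by (rule nn_integral_cmult_indicator[symmetric]) simp
  also have "\<dots> = (\<integral>\<^sup>+x. \<integral>\<^sup>+y. (ennreal ?l * indicator S x) * indicator E y \<partial>lborel \<partial>lborel)"
  proof (rule nn_integral_cong)
    fix x
    have "(\<integral>\<^sup>+y. (ennreal ?l * indicator S x) * indicator E y \<partial>lborel) = (ennreal ?l * indicator S x) * emeasure lborel E"
      by (rule nn_integral_cmult_indicator) simp
    then show "ennreal ?l * emeasure lborel E * indicator S x = (\<integral>\<^sup>+y. (ennreal ?l * indicator S x) * indicator E y \<partial>lborel)"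
      by (simp only: ac_simps)
  qed
  also have "\<dots> \<le> (\<integral>\<^sup>+x. \<integral>\<^sup>+y. ennreal \<bar>ln (u0 x + d) - ln (u0 y + d)\<bar> * (indicator B x * indicator B y) \<partial>lborel \<partial>lborel)"
  proof (intro nn_integral_mono)
    fix x y
    show "(ennreal ?l * indicator S x) * indicator E y \<le> ennreal \<bar>ln (u0 x + d) - ln (u0 y + d)\<bar> * (indicator B x * indicator B y)"
    proof (cases "x \<in> S \<and> y \<in> E")
      case True
      have "0 < u0 x + d" using u0[of x] d by linarith
      then have "ln (u0 x + d) \<le> ln (2 * \<delta> * \<zeta>)" using S(3)[of x] True by (subst ln_le_cancel_iff) auto
      also have "\<dots> = ln \<zeta> - ?l" using \<delta> \<zeta> by (simp add: ln_mult ln_div)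
      also have "ln \<zeta> \<le> ln (u0 y + d)" using E(3)[of y] True \<zeta> d by (subst ln_le_cancel_iff) auto
      finally have "?l \<le> \<bar>ln (u0 x + d) - ln (u0 y + d)\<bar>" by linarith
      moreover have "x \<in> B" "y \<in> B" using True S(2) E(2) by auto
      ultimately show ?thesis using True by (simp add: ennreal_leI)
    qed auto
  qed
  also note le
  finally have "ennreal ?l * emeasure lborel E * emeasure lborel S \<le> ennreal Q" .
  moreover have "emeasure lborel E = ennreal (measure lborel E)" "emeasure lborel S = ennreal (measure lborel S)"
    using fS fE by (auto simp: emeasure_eq_ennreal_measure)
  ultimately have "ennreal (?l * measure lborel E * measure lborel S) \<le> ennreal Q"
    using l by (simp add: ennreal_mult)
  then show ?thesis using Q by (simp add: ennreal_le_iff ac_simps)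
qed

theorem lemma6p1:
  fixes p :: real and \<mu> :: "real measure"
  assumes "1 < p"
    and "sets \<mu> = sets (restrict_space borel {0..1})"
    and "finite_measure \<mu>"
    and "0 < emeasure \<mu> {0<..<1}"
    and "emeasure \<mu> {0} = 0"
    and "0 < emeasure \<mu> {1}"
  shows "\<exists>C>0. \<forall>(\<Omega> :: 'a::euclidean_space set) u x0 R \<zeta> \<sigma> r.
    open \<Omega> \<and> connected \<Omega> \<and> \<Omega> \<noteq> {} \<and> bounded \<Omega> \<and>
    weak_supersolution \<mu> p \<Omega> u \<and>
    ball x0 R \<subseteq> \<Omega> \<and> (AE x in lebesgue. x \<in> ball x0 R \<longrightarrow> 0 \<le> u x) \<and>
    0 \<le> \<zeta> \<and> 0 < \<sigma> \<and> \<sigma> \<le> 1 \<and> 0 < r \<and> r \<le> 1 \<and> 0 < 16 * r \<and> 16 * r < R \<and>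
    \<sigma> * measure lebesgue (ball x0 r) \<le> measure lebesgue ({x. \<zeta> \<le> u x} \<inter> ball x0 r)
    \<longrightarrow> (\<forall>\<delta> \<epsilon>. 0 < \<delta> \<and> \<delta> < 1 / 4 \<and> 0 < \<epsilon> \<longrightarrow>
      measure lebesgue (ball x0 (6 * r) \<inter>
        {x. u x \<le> 2 * \<delta> * \<zeta>
             - 1 / 2 * (SUP s\<in>measure_support \<mu>.
                 (r / R) powr (s * p / (p - 1)) * enn2real (Tail \<mu> p (neg_part u) x0 R))
             - \<epsilon>})
      \<le> C * measure lebesgue (ball x0 (6 * r)) / (\<sigma> * ln (1 / (2 * \<delta>))))"
proof -
  note p = assms(1) and sets = assms(2)
  obtain M where M: "0 < M" "\<And>s. s \<in> {0<..<1} \<Longrightarrow> 0 \<le> frac_const DIM('a) s p"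
      "\<And>s. s \<in> {0<..<1} \<Longrightarrow> frac_const DIM('a) s p \<le> M * (s * (1 - s))"
    using frac_const_bound(2)[OF p DIM_positive[where 'a='a]] by blast
  have \<alpha>: "0 < measure \<mu> {1}"
    using assms(6) finite_measure.emeasure_eq_measure[OF assms(3), of "{1}"] by simp
  define C3 where "C3 = log_gradient_const DIM('a) p M (measure \<mu> (space \<mu>)) (measure \<mu> {1})"
  have C3: "0 < C3" unfolding C3_def by (rule log_gradient_const_pos[OF p M(1) _ \<alpha>]) simp
  let ?N = "DIM('a)"
  define V where "V = unit_ball_vol (real ?N)"
  have V: "0 < V" by (simp add: V_def)
  define C where "C = 12 * 2 ^ ?N * C3 / V"
  have C: "0 < C" using C3 V by (simp add: C_def)
  show ?thesis
  proof (intro exI[of _ C] conjI C allI impI, elim conjE)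
    fix \<Omega> :: "'a set" and u :: "'a \<Rightarrow> real" and x0 :: 'a and R \<zeta> \<sigma> r \<delta> \<epsilon> :: real
    assume op: "open \<Omega>" and super: "weak_supersolution \<mu> p \<Omega> u" and BR: "ball x0 R \<subseteq> \<Omega>"
      and pos: "AE x in lebesgue. x \<in> ball x0 R \<longrightarrow> 0 \<le> u x"
      and \<zeta>: "0 \<le> \<zeta>" and \<sigma>: "0 < \<sigma>" "\<sigma> \<le> 1" and r: "0 < r" "r \<le> 1" "16 * r < R"
      and dens: "\<sigma> * measure lebesgue (ball x0 r) \<le> measure lebesgue ({x. \<zeta> \<le> u x} \<inter> ball x0 r)"
      and \<delta>: "0 < \<delta>" "\<delta> < 1 / 4" and \<epsilon>: "0 < \<epsilon>"
    define T where "T = enn2real (Tail \<mu> p (neg_part u) x0 R)"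
    define W where "W = (SUP s\<in>measure_support \<mu>. (r / R) powr (s * p / (p - 1)) * T)"
    (* With this shift the set to be measured is where u + d is at most 2 \<delta> \<zeta>. *)
    define d where "d = 1 / 2 * W + \<epsilon>"
    let ?B = "ball x0 (6 * r)"
    have bdd: "(r / R) powr (s * p / (p - 1)) * T \<le> T" if "s \<in> measure_support \<mu>" for s
    proof -
      have "s \<in> {0..1}" using that by (simp add: measure_support_def)
      then have "(r / R) powr (s * p / (p - 1)) \<le> 1"
        using r p by (intro powr_le1) auto
      then show ?thesis using mult_right_mono[of "(r / R) powr (s * p / (p - 1))" 1 T] by (simp add: T_def)
    qed
    have up: "(r / R) powr (s * p / (p - 1)) * T \<le> W" if "s \<in> measure_support \<mu>" for s
      unfolding W_def using bdd that by (intro cSUP_upper bdd_aboveI2)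
    have "measure_support \<mu> \<noteq> {}"
    proof
      assume "measure_support \<mu> = {}"
      with AE_in_measure_support[OF sets] have "AE s in \<mu>. False" by simp
      then obtain N where N: "N \<in> null_sets \<mu>" "space \<mu> \<subseteq> N" by (auto simp: eventually_ae_filter)
      then have "emeasure \<mu> (space \<mu>) = 0" using emeasure_mono[of "space \<mu>" N \<mu>] by (auto simp: null_sets_def)
      moreover have "emeasure \<mu> {0<..<1} \<le> emeasure \<mu> (space \<mu>)"
        by (rule emeasure_space)
      ultimately show False using assms(4) by simp
    qed
    then obtain s0 where s0: "s0 \<in> measure_support \<mu>" by blast
    have "0 \<le> (r / R) powr (s0 * p / (p - 1)) * T" by (simp add: T_def)
    then have W0: "0 \<le> W" using up[OF s0] by linarith
    have d: "0 < d" using W0 \<epsilon> by (simp add: d_def)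
    have dT: "(r / R) powr (s * p / (p - 1)) * enn2real (Tail \<mu> p (neg_part u) x0 R) \<le> 2 * d"
      if "s \<in> measure_support \<mu>" for s
      using up[OF that] \<epsilon> by (simp add: T_def[symmetric] d_def)
    have pos': "AE x in lborel. x \<in> ball x0 R \<longrightarrow> 0 \<le> u x" using pos by (simp add: AE_lebesgue_iff)
    obtain u0 g0 U G where u0[measurable]: "u0 \<in> borel_measurable borel" and u0n: "\<And>x. 0 \<le> u0 x"
      and u0u: "AE x in lborel. x \<in> ball x0 (8 * r) \<longrightarrow> u0 x = u x" and g0: "integrable lborel g0"
      and ap: "C1_approx (cball x0 (8 * r)) u0 g0 U G"
      and grad: "(LINT x|lborel. indicator ?B x * (\<bar>1 / (u0 x + d)\<bar> * norm (g0 x))) \<le> C3 * r ^ ?N / r"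
      by (rule log_gradient_estimate[OF p sets assms(3) \<alpha> M op super BR pos' r d dT]) (auto simp: C3_def)
    have um[measurable]: "u \<in> borel_measurable lebesgue"
      using super by (simp add: weak_supersolution_def tail_space_def Lp_loc_def set_borel_measurable_def)
    have u0L[measurable]: "u0 \<in> borel_measurable lebesgue" by (rule measurable_completion) simp
    have lev: "{x. u x \<le> c} \<in> sets lebesgue" "{x. c \<le> u x} \<in> sets lebesgue" for c
    proof -
      have "{x \<in> space lebesgue. u x \<le> c} \<in> sets lebesgue" "{x \<in> space lebesgue. c \<le> u x} \<in> sets lebesgue"
        by measurable
      then show "{x. u x \<le> c} \<in> sets lebesgue" "{x. c \<le> u x} \<in> sets lebesgue" by simp_all
    qed
    define S where "S = {x \<in> ?B. u0 x + d \<le> 2 * \<delta> * \<zeta>}"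
    define E where "E = {x \<in> ball x0 r. \<zeta> \<le> u0 x}"
    have [measurable]: "S \<in> sets borel" "E \<in> sets borel" unfolding S_def E_def by measurable
    have aeL: "AE x in lebesgue. x \<in> ball x0 (8 * r) \<longrightarrow> u0 x = u x" using u0u by (simp add: AE_lebesgue_iff)
    have "measure lebesgue (?B \<inter> {x. u x \<le> 2 * \<delta> * \<zeta> - 1 / 2 * W - \<epsilon>}) = measure lebesgue S"
    proof (rule measure_eq_AE)
      show "AE x in lebesgue. (x \<in> ?B \<inter> {x. u x \<le> 2 * \<delta> * \<zeta> - 1 / 2 * W - \<epsilon>}) = (x \<in> S)"
        using aeL by eventually_elim (use r in \<open>auto simp: S_def d_def\<close>)
    qed (auto intro!: sets.Int lev)
    also have "\<dots> = measure lborel S" by simp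
    finally have mS: "measure lebesgue (?B \<inter> {x. u x \<le> 2 * \<delta> * \<zeta> - 1 / 2 * W - \<epsilon>}) = measure lborel S" .
    have "measure lebesgue ({x. \<zeta> \<le> u x} \<inter> ball x0 r) = measure lebesgue E"
    proof (rule measure_eq_AE)
      show "AE x in lebesgue. (x \<in> {x. \<zeta> \<le> u x} \<inter> ball x0 r) = (x \<in> E)"
        using aeL by eventually_elim (use r in \<open>auto simp: E_def\<close>)
    qed (auto intro!: sets.Int lev)
    also have "\<dots> = measure lborel E" by simp
    finally have mE: "measure lebesgue ({x. \<zeta> \<le> u x} \<inter> ball x0 r) = measure lborel E" .
    let ?l = "ln (1 / (2 * \<delta>))"
    have l: "0 < ?l" using \<delta> by simp
    have "measure lborel S \<le> C * measure lborel ?B / (\<sigma> * ?l)"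
    proof (cases "\<zeta> = 0")
      case True
      (* For \<zeta> = 0 the set is empty because u0 + d is positive. *)
      have "S = {}" using u0n d by (auto simp: S_def True not_le intro: add_nonneg_pos)
      then show ?thesis using C \<sigma> l by simp
    next
      case False
      have H: "((\<lambda>t. ln (t + d)) has_real_derivative 1 / (t + d)) (at t)" if "0 \<le> t" for t
        using that d by (auto intro!: derivative_eq_intros)
      have cH: "continuous_on {0..} (\<lambda>t. 1 / (t + d))" using d by (intro continuous_intros) auto
      have bH: "\<bar>1 / (t + d)\<bar> \<le> 1 / d" if "0 \<le> t" for t using that d by (simp add: frac_le)
      define Q where "Q = 2 * (6 * r) * 2 ^ ?N * measure lborel ?B * (C3 * r ^ ?N / r)"
      have Q: "0 \<le> Q" using r C3 by (simp add: Q_def)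
      have "(\<integral>\<^sup>+x. \<integral>\<^sup>+y. ennreal \<bar>ln (u0 x + d) - ln (u0 y + d)\<bar> * (indicator ?B x * indicator ?B y) \<partial>lborel \<partial>lborel)
        \<le> ennreal (2 * (6 * r) * 2 ^ ?N * measure lborel ?B * (LINT x|lborel. indicator ?B x * (\<bar>1 / (u0 x + d)\<bar> * norm (g0 x))))"
        by (rule poincare_limit[OF ap _ u0 u0n g0 H cH bH refl]) (use r in auto)
      also have "\<dots> \<le> ennreal Q"
        unfolding Q_def using r by (intro ennreal_leI mult_left_mono grad) auto
      finally have dbl: "(\<integral>\<^sup>+x. \<integral>\<^sup>+y. ennreal \<bar>ln (u0 x + d) - ln (u0 y + d)\<bar> * (indicator ?B x * indicator ?B y) \<partial>lborel \<partial>lborel) \<le> ennreal Q" .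
      have SE: "?l * measure lborel S * measure lborel E \<le> Q"
      proof (rule level_set_estimate[OF u0 u0n d _ _ _ \<delta>(1) _ _ _ _ _ _ _ dbl Q])
        show "emeasure lborel ?B < \<infinity>" using emeasure_bounded_finite[OF bounded_ball, of x0 "6 * r"] by simp
        show "0 < \<zeta>" using \<zeta> False by simp
        show "E \<subseteq> ?B" using r by (auto simp: E_def)
      qed (use \<delta> in \<open>auto simp: S_def E_def\<close>)
      have "measure lborel (ball x0 r) = V * r ^ ?N" using r by (simp add: content_ball V_def)
      then have EV: "\<sigma> * (V * r ^ ?N) \<le> measure lborel E" using dens mE by simp
      have pos3: "0 < \<sigma> * (V * r ^ ?N)" "0 < \<sigma> * ?l" using \<sigma> V r l by simp_all
      have "?l * measure lborel S * (\<sigma> * (V * r ^ ?N)) \<le> ?l * measure lborel S * measure lborel E"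
        using l by (intro mult_left_mono EV) auto
      also have "\<dots> \<le> Q" by (rule SE)
      also have "Q = C * measure lborel ?B * (V * r ^ ?N)"
        using r V by (simp add: Q_def C_def)
      finally have "(\<sigma> * ?l * measure lborel S) * (V * r ^ ?N) \<le> (C * measure lborel ?B) * (V * r ^ ?N)"
        by (simp only: ac_simps)
      moreover have "0 < V * r ^ ?N" using V r by simp
      ultimately have "\<sigma> * ?l * measure lborel S \<le> C * measure lborel ?B"
        by (rule mult_right_le_imp_le)
      then show ?thesis using pos3(2) by (simp add: pos_le_divide_eq mult.commute)
    qed
    then show "measure lebesgue (?B \<inter>
        {x. u x \<le> 2 * \<delta> * \<zeta>
             - 1 / 2 * (SUP s\<in>measure_support \<mu>.
                 (r / R) powr (s * p / (p - 1)) * enn2real (Tail \<mu> p (neg_part u) x0 R))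
             - \<epsilon>})
      \<le> C * measure lebesgue ?B / (\<sigma> * ?l)"
      using mS by (simp add: W_def T_def)
  qed
qed

end
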